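(* Let $d>1$ be an integer and let $m,t$ be positive integers such that $t$ divides $m$, and let $\theta:\mathbb{D}^d\to\theta(\mathbb{D}^d)$ be the basic polynomial map associated to the group $G(m,t,d)$. Given a rational inner function $f$ on $\theta(\mathbb{D}^d)$, there exist a non-negative integer $k$, $\tau\in\mathbb{T}$ and a polynomial $g$ with no zero in $\theta(\mathbb{D}^d)$ such that $$f(p_1,\dots,p_{d-1},p_d)=\tau p_d^{k}\,\frac{\overline{g\left(\frac{\overline{p_{d-1}}}{\overline{p_d}^{\,t}},\frac{\overline{p_{d-2}}}{\overline{p_d}^{\,t}},\dots,\frac{\overline{p_1}}{\overline{p_d}^{\,t}},\frac{1}{\overline{p_d}}\right)}}{g(p_1,\dots,p_{d-1},p_d)}.\qquad( * )$$ Conversely, any rational function of the form $( * )$ is inner. Moreover, any inner function $f\in\mathcal{A}(\theta(\mathbb{D}^d))$ is a rational function of the form $( * )$ with the additional property that $g$ has no zeros in $\overline{\theta(\mathbb{D}^d)}$.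
   Context: $\mathbb{D}$ is the open unit disc, $\mathbb{T}$ the unit circle. The map $\theta=(\theta_1,\dots,\theta_d)$ is given by $\theta_j(\boldsymbol z)=E_j(z_1^m,\dots,z_d^m)$ for $1\le j\le d-1$ and $\theta_d(\boldsymbol z)=(z_1\cdots z_d)^{m/t}$, where $E_j$ is the $j$-th elementary symmetric polynomial in $d$ variables. ($G(m,t,d)$ is the group of maps $\boldsymbol z\mapsto(\alpha^{\nu_1}z_{\sigma(1)},\dots,\alpha^{\nu_d}z_{\sigma(d)})$ with $\alpha=e^{2\pi i/m}$, $\sigma\in S_d$ and integers $\nu_1,\dots,\nu_d$ whose sum is divisible by $t$; $\theta(\mathbb{D}^d)$ is a domain in $\mathbb{C}^d$ biholomorphic to $\mathbb{D}^d/G(m,t,d)$.) Coordinates in $\theta(\mathbb{D}^d)$ are written $\boldsymbol p=(p_1,\dots,p_d)$. $H^\infty(\theta(\mathbb{D}^d))$ is the Banach algebra of bounded holomorphic functions on $\theta(\mathbb{D}^d)$ with the sup norm, and $\mathcal{A}(\theta(\mathbb{D}^d))$ is the algebra of continuous functions on $\overline{\theta(\mathbb{D}^d)}$ that are holomorphic in $\theta(\mathbb{D}^d)$. Write $\partial\theta(\mathbb{D}^d)=\theta(\mathbb{T}^d)$ (the Šilov boundary of $\theta(\mathbb{D}^d)$ with respect to $\mathcal{A}(\theta(\mathbb{D}^d))$), and let $\mu$ be the push-forward under $\theta$ of the normalized Haar measure $\nu$ on $\mathbb{T}^d$. Each $f\in H^\infty(\theta(\mathbb{D}^d))$ has a boundary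 function $f^*(\boldsymbol q)=\lim_{r\to1^-}f(r^mq_1,r^{2m}q_2,\dots,r^{(d-1)m}q_{d-1},r^{dm/t}q_d)$, defined for $\mu$-almost every $\boldsymbol q\in\partial\theta(\mathbb{D}^d)$. A function $f\in H^\infty(\theta(\mathbb{D}^d))$ is called inner if $|f^*|=1$ $\mu$-almost everywhere on $\partial\theta(\mathbb{D}^d)$; a rational inner function on $\theta(\mathbb{D}^d)$ is a rational function with poles off $\theta(\mathbb{D}^d)$ which is also inner.
   Formalization: In the converse, the rational function f of the form ( * ) is also required to have its poles off θ(D^d); without this it fails, e.g. g = 2 − p_d, k = 0 gives a pole along p_d = 0. *)

theory Defs
  imports "HOL-Analysis.Analysis"
begin

text \<open>
  Points of complex \<open>d\<close>-space are vectors \<open>complex^'n\<close> with \<open>d = CARD('n)\<close>. The linear order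
  on \<open>'n\<close> numbers the coordinates by \<open>1, \<dots>, d\<close>: \<open>pos i\<close> is the number of the
  index \<open>i\<close>, and \<open>p \<section> j\<close> is the coordinate number \<open>j\<close> of \<open>p\<close> (meaningful for
  \<open>1 \<le> j \<le> d\<close> only).
\<close>

definition pos :: "'n::{finite,linorder} \<Rightarrow> nat" where
  "pos i = card {..i}"

definition coord :: "'a^'n::{finite,linorder} \<Rightarrow> nat \<Rightarrow> 'a"  (infixl "\<section>" 90) where
  "p \<section> j = p $ the_inv pos j"

lemma bij_betw_pos: "bij_betw pos (UNIV :: 'n::{finite,linorder} set) {1..CARD('n)}"
proof -
  have less: "pos i < pos j" if "i < j" for i j :: 'n
    unfolding pos_def by (rule psubset_card_mono) (use that in auto)
  have inj: "inj (pos :: 'n \<Rightarrow> nat)"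
    by (metis injI less less_irrefl linorder_less_linear)
  have "range (pos :: 'n \<Rightarrow> nat) \<subseteq> {1..CARD('n)}"
    by (auto simp: pos_def card_gt_0_iff Suc_le_eq intro!: card_mono)
  moreover have "card (range (pos :: 'n \<Rightarrow> nat)) = card {1..CARD('n)}"
    by (simp add: card_image[OF inj])
  ultimately have "range (pos :: 'n \<Rightarrow> nat) = {1..CARD('n)}"
    by (simp add: card_subset_eq)
  with inj show ?thesis
    by (simp add: bij_betw_def)
qed

lemma coord_pos [simp]: "p \<section> pos i = p $ i"
  by (simp add: coord_def the_inv_f_f bij_betw_imp_inj_on[OF bij_betw_pos])

definition polydisc :: "(complex^'n) set" where
  "polydisc = {z. \<forall>i. norm (z $ i) < 1}"

definition elem_sym :: "nat \<Rightarrow> complex^'n \<Rightarrow> complex" where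
  "elem_sym j z = (\<Sum>S | S \<subseteq> UNIV \<and> card S = j. \<Prod>i\<in>S. z $ i)"

definition basic_map :: "nat \<Rightarrow> nat \<Rightarrow> complex^'n::{finite,linorder} \<Rightarrow> complex^'n::{finite,linorder}" where
  "basic_map m t z =
     (\<chi> i. if pos i < CARD('n) then elem_sym (pos i) (\<chi> l. (z $ l) ^ m)
           else (\<Prod>l\<in>UNIV. z $ l) ^ (m div t))"

definition basic_domain :: "nat \<Rightarrow> nat \<Rightarrow> (complex^'n::{finite,linorder}) set" where
  "basic_domain m t = basic_map m t ` polydisc"

text \<open>Holomorphy in several variables: complex linear Frechet derivative at each point.\<close>

definition holomorphic_several :: "(complex^'n) set \<Rightarrow> (complex^'n \<Rightarrow> complex) \<Rightarrow> bool" where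
  "holomorphic_several S f \<longleftrightarrow>
     (\<forall>z\<in>S. \<exists>D. (f has_derivative D) (at z) \<and> (\<forall>c v. D (c *s v) = c * D v))"

definition H_infinity :: "(complex^'n) set \<Rightarrow> (complex^'n \<Rightarrow> complex) set" where
  "H_infinity S = {f. holomorphic_several S f \<and> bounded (f ` S)}"

definition disc_algebra :: "(complex^'n) set \<Rightarrow> (complex^'n \<Rightarrow> complex) set" where
  "disc_algebra S = {f. continuous_on (closure S) f \<and> holomorphic_several S f}"

text \<open>
  The normalized Haar measure of the torus, as a Borel measure on \<open>complex^'n\<close> carried by the
  torus, and its push-forward, which is carried by the image of the torus.
\<close>

definition torus_measure :: "(complex^'n) measure" where
  "torus_measure =
     distr (uniform_measure lborel (cbox 0 (vec 1 :: real^'n))) borel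
           (\<lambda>x. \<chi> i. cis (2 * pi * x $ i))"

definition boundary_measure :: "nat \<Rightarrow> nat \<Rightarrow> (complex^'n::{finite,linorder}) measure" where
  "boundary_measure m t = distr torus_measure borel (basic_map m t)"

text \<open>
  \<open>dilate m t r (basic_map m t z) = basic_map m t (r z)\<close>; in the last coordinate
  \<open>CARD('n) * (m div t)\<close> is \<open>dm/t\<close>, as \<open>t\<close> divides \<open>m\<close>.
\<close>

definition dilate :: "nat \<Rightarrow> nat \<Rightarrow> real \<Rightarrow> complex^'n::{finite,linorder} \<Rightarrow> complex^'n::{finite,linorder}" where
  "dilate m t r q =
     (\<chi> i. (if pos i < CARD('n) then of_real r ^ (pos i * m)
            else of_real r ^ (CARD('n) * (m div t))) * q $ i)"

definition has_boundary_value ::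
  "nat \<Rightarrow> nat \<Rightarrow> (complex^'n::{finite,linorder} \<Rightarrow> complex) \<Rightarrow> complex^'n::{finite,linorder} \<Rightarrow> complex \<Rightarrow> bool" where
  "has_boundary_value m t f q w \<longleftrightarrow> ((\<lambda>r. f (dilate m t r q)) \<longlongrightarrow> w) (at_left 1)"

definition inner_fun :: "nat \<Rightarrow> nat \<Rightarrow> (complex^'n::{finite,linorder} \<Rightarrow> complex) \<Rightarrow> bool" where
  "inner_fun m t f \<longleftrightarrow> f \<in> H_infinity (basic_domain m t) \<and>
     (AE q in boundary_measure m t. \<exists>w. has_boundary_value m t f q w \<and> norm w = 1)"

text \<open>Polynomials are identified with polynomial functions, the field being infinite.\<close>

definition poly_fun :: "(complex^'n \<Rightarrow> complex) \<Rightarrow> bool" where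
  "poly_fun g \<longleftrightarrow>
     (\<exists>(A :: ('n \<Rightarrow> nat) set) c. finite A \<and>
        (\<forall>p. g p = (\<Sum>a\<in>A. c a * (\<Prod>i\<in>UNIV. (p $ i) ^ a i))))"

text \<open>Rational functions with poles off \<open>S\<close>, as functions on \<open>S\<close>.\<close>

definition rational_on :: "(complex^'n) set \<Rightarrow> (complex^'n \<Rightarrow> complex) \<Rightarrow> bool" where
  "rational_on S f \<longleftrightarrow>
     (\<exists>P Q. poly_fun P \<and> poly_fun Q \<and> (\<forall>p\<in>S. Q p \<noteq> 0 \<and> f p = P p / Q p))"

definition rational_inner :: "nat \<Rightarrow> nat \<Rightarrow> (complex^'n::{finite,linorder} \<Rightarrow> complex) \<Rightarrow> bool" where
  "rational_inner m t f \<longleftrightarrow> rational_on (basic_domain m t) f \<and> inner_fun m t f"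

text \<open>
  \<open>reflect t p\<close> has the coordinates \<open>p\<^sub>d\<^sub>-\<^sub>1 / p\<^sub>d\<^sup>t, \<dots>, p\<^sub>1 / p\<^sub>d\<^sup>t, 1 / p\<^sub>d\<close>.
\<close>

definition reflect :: "nat \<Rightarrow> complex^'n::{finite,linorder} \<Rightarrow> complex^'n::{finite,linorder}" where
  "reflect t p =
     (\<chi> i. if pos i < CARD('n) then p \<section> (CARD('n) - pos i) / (p \<section> CARD('n)) ^ t
           else 1 / p \<section> CARD('n))"

text \<open>
  The right-hand side of the representation involves \<open>1 / p\<^sub>d\<close>, so as an identity between rational
  functions it is evaluated where \<open>p\<^sub>d \<noteq> 0\<close>. On the domain this set is dense, hence the
  identity determines a continuous \<open>f\<close>. The right-hand side alone may have a pole along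
  \<open>p\<^sub>d = 0\<close> if \<open>k\<close> is small (for instance \<open>g = 2 - p\<^sub>d\<close>, \<open>k = 0\<close>), so this form does not
  by itself make \<open>f\<close> regular on the domain.
\<close>

definition has_reflection_form ::
  "nat \<Rightarrow> (complex^'n::{finite,linorder}) set \<Rightarrow> (complex^'n::{finite,linorder} \<Rightarrow> complex) \<Rightarrow>
   nat \<Rightarrow> complex \<Rightarrow> (complex^'n::{finite,linorder} \<Rightarrow> complex) \<Rightarrow> bool" where
  "has_reflection_form t S f k \<tau> g \<longleftrightarrow>
     (\<forall>p\<in>S. p \<section> CARD('n) \<noteq> 0 \<longrightarrow>
        f p = \<tau> * (p \<section> CARD('n)) ^ k * (cnj (g (reflect t (\<chi> i. cnj (p $ i)))) / g p))"

end

theory Submission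
  imports Defs "HOL-Complex_Analysis.Complex_Analysis"
    "HOL-Computational_Algebra.Fundamental_Theorem_Algebra"
begin

text \<open>
  Write \<open>dil c\<close> for the weighted dilation with \<open>theta (c z) = dil c (theta z)\<close>. Along the orbits of
  the dilations a bounded holomorphic \<open>f\<close> becomes a power series in \<open>c\<close> whose coefficients are
  polynomials in the base point, and \<open>f\<close> is a fraction iff this series is a quotient \<open>A / B\<close> of
  polynomials in \<open>c\<close> over the ring of polynomial functions. Take the degree of \<open>B\<close> minimal: then
  \<open>A\<close> and \<open>B\<close> satisfy a Bezout identity, so at a generic point the roots of \<open>B\<close> are poles of \<open>f\<close>.
  They stay away from the domain, which bounds the coefficients of \<open>B\<close> by its constant coefficient;
  hence the latter divides all of them, and one can normalize it to be \<open>1\<close>. (This takes the place of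
  unique factorization.) On a generic boundary orbit \<open>A\<close> and \<open>B\<close> are coprime and have equal modulus
  on the unit circle, which forces \<open>A\<close> to be the leading coefficient of \<open>A\<close> times the
  reflection of \<open>B\<close>. This leading coefficient is a polynomial that is unimodular on the boundary, so it
  is a unimodular constant times a power of \<open>p\<^sub>d\<close>. Putting \<open>c = 1\<close> yields the representation with
  \<open>g = B(1)\<close>.

  Conversely, the representation gives \<open>f = P / Q\<close> with \<open>|P| = |Q|\<close> on the boundary; then \<open>|f| \<le> 1\<close> on
  the orbits of boundary points, and everywhere by the maximum principle on polydiscs.

  If \<open>f\<close> is continuous up to the boundary, its restrictions to boundary orbits are finite
  Blaschke products of bounded degree. So the Hankel matrices of the coefficients have bounded rank at
  each boundary point, hence over the ring of polynomial functions, and \<open>f\<close> is a fraction. The poles of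
  these Blaschke products stay away from the closed disc, so \<open>g\<close> is bounded below on the boundary,
  and the maximum principle for \<open>1 / g\<close> extends this to the closure.
\<close>

text \<open>The Bezout identity \<open>U * A + V * B = [:\<rho>:]\<close> replaces coprimality, but
  it says something only at points where the polynomial function \<open>\<rho>\<close> does not
  vanish. This shapes the proof: a pointwise fact is proved off the zeros of \<open>\<rho>\<close>,
  stated as a closed condition, and extended by density, by \<open>poly_fun_dense\<close> in the
  whole space and by \<open>bdry_closed_property\<close> on the boundary. In the same way
  \<open>bdry_closed_AE\<close> turns almost everywhere into everywhere. That the coefficients are
  polynomials in the base point rests on the boundedness of \<open>f\<close>: the orbit of
  \<open>p\<close> stays in the domain up to a radius of order \<open>1 / (1 + norm p)\<close>, so
  Cauchy's estimate gives polynomial growth and Liouville's theorem applies in each coordinate. The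
  normalization \<open>coeff B 0 = 1\<close> makes the position of the poles quantitative: if all
  roots have modulus at least \<open>s > 1\<close>, then the value at \<open>1\<close> is at least
  \<open>(1 - 1 / s) ^ n\<close> in modulus, uniformly in the base point. Such a bound survives
  passage to limits, which mere absence of zeros does not.\<close>

no_notation fps_nth (infixl \<open>$\<close> 75)

text \<open>Writing \<open>complex^'n\<close> attaches the sort \<open>finite\<close> to \<open>'n\<close>, which is refused where
  a larger sort of \<open>'n\<close> has been declared; this synonym does not.\<close>

type_synonym 'n cvec = "(complex, 'n) vec"

section \<open>Polynomial functions of several variables\<close>

lemma poly_fun_monom: "poly_fun (\<lambda>p::complex^'n. c * (\<Prod>i\<in>UNIV. (p $ i) ^ a i))"
  unfolding poly_fun_def by (intro exI[of _ "{a}"] exI[of _ "\<lambda>_. c"]) simp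

lemma poly_fun_add:
  assumes "poly_fun g" "poly_fun h"
  shows "poly_fun (\<lambda>p::complex^'n. g p + h p)"
proof -
  obtain A c where A: "finite A" "\<And>p. g p = (\<Sum>a\<in>A. c a * (\<Prod>i\<in>UNIV. (p $ i) ^ a i))"
    using assms(1) unfolding poly_fun_def by blast
  obtain B d where B: "finite B" "\<And>p. h p = (\<Sum>a\<in>B. d a * (\<Prod>i\<in>UNIV. (p $ i) ^ a i))"
    using assms(2) unfolding poly_fun_def by blast
  define e where "e a = (if a \<in> A then c a else 0) + (if a \<in> B then d a else 0)" for a
  have 1: "(\<Sum>a\<in>A. c a * m a) = (\<Sum>a\<in>A\<union>B. (if a \<in> A then c a else 0) * m a)" for m :: "('n \<Rightarrow> nat) \<Rightarrow> complex"
    using A(1) B(1) by (intro sum.mono_neutral_cong_left) auto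
  have 2: "(\<Sum>a\<in>B. d a * m a) = (\<Sum>a\<in>A\<union>B. (if a \<in> B then d a else 0) * m a)" for m :: "('n \<Rightarrow> nat) \<Rightarrow> complex"
    using A(1) B(1) by (intro sum.mono_neutral_cong_left) auto
  have "g p + h p = (\<Sum>a\<in>A\<union>B. e a * (\<Prod>i\<in>UNIV. (p $ i) ^ a i))" for p
    unfolding A(2) B(2) 1 2 e_def by (simp add: sum.distrib distrib_right)
  then show ?thesis unfolding poly_fun_def using A(1) B(1) by (intro exI[of _ "A \<union> B"] exI[of _ e]) simp
qed

lemma poly_fun_const: "poly_fun (\<lambda>p::complex^'n. c)" using poly_fun_monom[of c "\<lambda>_. 0"] by simp

lemma poly_fun_sum:
  assumes "\<And>k. k \<in> K \<Longrightarrow> poly_fun (h k)"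
  shows "poly_fun (\<lambda>p::complex^'n. \<Sum>k\<in>K. h k p)" using assms
proof (induction K rule: infinite_finite_induct)
  case (insert k K)
  then show ?case by (simp add: poly_fun_add)
qed (simp_all add: poly_fun_const)

lemma poly_fun_coord: "poly_fun (\<lambda>p::complex^'n. p $ i)"
proof -
  have "(\<Prod>j\<in>UNIV. (p $ j) ^ (if j = i then 1 else 0)) = p $ i" for p :: "complex^'n"
  proof -
    have "(\<Prod>j\<in>UNIV. (p $ j) ^ (if j = i then 1 else 0)) = (\<Prod>j\<in>UNIV. if j = i then p $ j else 1)"
      by (intro prod.cong) auto
    then show ?thesis by simp
  qed
  then show ?thesis using poly_fun_monom[of 1 "\<lambda>j. if j = i then 1 else 0"] by simp
qed

lemma poly_fun_mult:
  assumes "poly_fun g" "poly_fun h"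
  shows "poly_fun (\<lambda>p::complex^'n. g p * h p)"
proof -
  obtain A c where A: "finite A" "\<And>p. g p = (\<Sum>a\<in>A. c a * (\<Prod>i\<in>UNIV. (p $ i) ^ a i))"
    using assms(1) unfolding poly_fun_def by blast
  obtain B d where B: "finite B" "\<And>p. h p = (\<Sum>a\<in>B. d a * (\<Prod>i\<in>UNIV. (p $ i) ^ a i))"
    using assms(2) unfolding poly_fun_def by blast
  have "g p * h p = (\<Sum>a\<in>A. \<Sum>b\<in>B. (c a * d b) * (\<Prod>i\<in>UNIV. (p $ i) ^ (a i + b i)))" for p
    unfolding A(2) B(2) sum_product by (intro sum.cong refl) (simp add: power_add prod.distrib ac_simps)
  then show ?thesis by (simp add: poly_fun_sum poly_fun_monom)
qed

lemma poly_fun_prod: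
  assumes "\<And>k. k \<in> K \<Longrightarrow> poly_fun (h k)"
  shows "poly_fun (\<lambda>p::complex^'n. \<Prod>k\<in>K. h k p)" using assms
proof (induction K rule: infinite_finite_induct)
  case (insert k K)
  then show ?case by (simp add: poly_fun_mult)
qed (simp_all add: poly_fun_const)

lemma poly_fun_power: "poly_fun g \<Longrightarrow> poly_fun (\<lambda>p::complex^'n. g p ^ k)"
  by (induction k) (simp_all add: poly_fun_const poly_fun_mult)

lemma poly_fun_uminus: "poly_fun g \<Longrightarrow> poly_fun (\<lambda>p::complex^'n. - g p)"
  using poly_fun_mult[OF poly_fun_const[of "-1"], of g] by simp

lemma poly_fun_diff: "poly_fun g \<Longrightarrow> poly_fun h \<Longrightarrow> poly_fun (\<lambda>p::complex^'n. g p - h p)"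
  using poly_fun_add[OF _ poly_fun_uminus, of g h] by simp

lemma poly_fun_poly: "poly_fun g \<Longrightarrow> poly_fun (\<lambda>p::complex^'n. poly q (g p))"
  by (induction q) (simp_all add: poly_fun_const poly_fun_add poly_fun_mult)

text \<open>Structural induction hides the exponents. Composition, restriction to curves,
  differentiability, reflection and expansion along the dilations all use it.\<close>

lemma poly_fun_induct [consumes 1, case_names const coord add mult]:
  assumes "poly_fun (g :: complex^'n \<Rightarrow> complex)"
    and c: "\<And>c. P (\<lambda>p. c)"
    and x: "\<And>i. P (\<lambda>p. p $ i)"
    and a: "\<And>g h. poly_fun g \<Longrightarrow> poly_fun h \<Longrightarrow> P g \<Longrightarrow> P h \<Longrightarrow> P (\<lambda>p. g p + h p)"
    and m: "\<And>g h. poly_fun g \<Longrightarrow> poly_fun h \<Longrightarrow> P g \<Longrightarrow> P h \<Longrightarrow> P (\<lambda>p. g p * h p)"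
  shows "P g"
proof -
  obtain A c where A: "finite A" "g = (\<lambda>p. \<Sum>a\<in>A. c a * (\<Prod>i\<in>UNIV. (p $ i) ^ a i))"
    using assms(1) unfolding poly_fun_def by blast
  have pw: "P (\<lambda>p. (p $ i) ^ k)" for i k by (induction k) (auto simp: c intro!: m x poly_fun_coord poly_fun_power)
  have pr: "finite I \<Longrightarrow> P (\<lambda>p. \<Prod>i\<in>I. (p $ i) ^ k i)" for I and k :: "'n \<Rightarrow> nat"
    by (induction I rule: finite_induct)
      (auto simp: c intro!: m pw poly_fun_coord poly_fun_power poly_fun_prod)
  have "P (\<lambda>p. \<Sum>a\<in>A. c a * (\<Prod>i\<in>UNIV. (p $ i) ^ a i))" using A(1)
  proof (induction A rule: finite_induct)
    case (insert b B)
    have "P (\<lambda>p. c b * (\<Prod>i\<in>UNIV. (p $ i) ^ b i))"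
      by (intro m[OF poly_fun_const _ assms(2)] pr poly_fun_prod poly_fun_power poly_fun_coord) simp
    then have "P (\<lambda>p. c b * (\<Prod>i\<in>UNIV. (p $ i) ^ b i) + (\<Sum>a\<in>B. c a * (\<Prod>i\<in>UNIV. (p $ i) ^ a i)))"
      by (intro a poly_fun_monom poly_fun_sum insert.IH)
    then show ?case using insert.hyps by simp
  qed (simp add: assms(2))
  then show ?thesis using A by simp
qed

lemma poly_fun_compose:
  assumes "poly_fun (g :: complex^'n \<Rightarrow> complex)" "\<And>i. poly_fun (\<lambda>p::complex^'k. \<Phi> p $ i)"
  shows "poly_fun (\<lambda>p. g (\<Phi> p))" using assms(1)
  by (induction rule: poly_fun_induct) (auto intro: poly_fun_const poly_fun_add poly_fun_mult assms(2))

lemma poly_fun_curve: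
  assumes "poly_fun (g :: complex^'n \<Rightarrow> complex)" "\<And>i. \<exists>q. \<forall>x. c x $ i = poly q x"
  shows "\<exists>q. \<forall>x. g (c x) = poly q x" using assms(1)
proof (induction rule: poly_fun_induct)
  case (const a)
  show ?case by (rule exI[of _ "[:a:]"]) simp
next
  case (add g h)
  then show ?case by (metis poly_add)
next
  case (mult g h)
  then show ?case by (metis poly_mult)
qed (use assms(2) in auto)

section \<open>Restriction to coordinate lines, identity theorems and interpolation\<close>

definition upd :: "'a^'n \<Rightarrow> 'n \<Rightarrow> 'a \<Rightarrow> 'a^'n" where
  "upd p i x = (\<chi> j. if j = i then x else p $ j)"

lemma upd_nth [simp]: "upd p i x $ j = (if j = i then x else p $ j)" by (simp add: upd_def)

lemma upd_same [simp]: "upd p i (p $ i) = p" by (simp add: vec_eq_iff)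

lemma poly_fun_upd:
  assumes "poly_fun (g :: complex^'n \<Rightarrow> complex)"
  shows "\<exists>q. \<forall>x. g (upd p i x) = poly q x"
proof (rule poly_fun_curve[OF assms])
  fix j
  show "\<exists>q. \<forall>x. upd p i x $ j = poly q x"
    by (cases "j = i") (auto intro: exI[of _ "[:0, 1:]"] exI[of _ "[:p $ j:]"])
qed

text \<open>The coordinates leave the grid one at a time; in the induction \<open>S\<close> holds
  those that are already free. In the next one \<open>h\<close> is a polynomial of one variable with
  infinitely many zeros.\<close>

lemma separately_poly_zero:
  fixes h :: "complex^'n \<Rightarrow> complex"
  assumes sep: "\<And>p i. \<exists>q. \<forall>x. h (upd p i x) = poly q x"
    and inf: "\<And>i. infinite (X i)"
    and zero: "\<And>p. (\<And>i. p $ i \<in> X i) \<Longrightarrow> h p = 0"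
  shows "h p = 0"
proof -
  have "finite S \<Longrightarrow> \<forall>p. (\<forall>i. i \<notin> S \<longrightarrow> p $ i \<in> X i) \<longrightarrow> h p = 0" for S
  proof (induction S rule: finite_induct)
    case empty
    then show ?case using zero by simp
  next
    case (insert i S)
    show ?case
    proof (intro allI impI)
      fix p :: "complex^'n" assume p: "\<forall>j. j \<notin> insert i S \<longrightarrow> p $ j \<in> X j"
      obtain q where q: "\<And>x. h (upd p i x) = poly q x" using sep by blast
      have "X i \<subseteq> {x. poly q x = 0}" using insert.IH p insert.hyps q[symmetric] by auto
      then have "q = 0" using inf poly_roots_finite infinite_super by blast
      then show "h p = 0" using q[of "p $ i"] by simp
    qed
  qed
  from this[of UNIV] show ?thesis by simp
qed

lemma poly_fun_zero:
  fixes h :: "complex^'n \<Rightarrow> complex"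
  assumes "poly_fun h" "\<And>i. infinite (X i)" "\<And>p. (\<And>i. p $ i \<in> X i) \<Longrightarrow> h p = 0"
  shows "h p = 0" by (rule separately_poly_zero[OF poly_fun_upd[OF assms(1)] assms(2,3)])

lemma open_contains_box:
  assumes "open (U :: (complex^'n) set)" "p \<in> U"
  obtains e where "e > 0" "\<And>q. (\<And>i. dist (q $ i) (p $ i) < e) \<Longrightarrow> q \<in> U"
proof -
  obtain e where e: "e > 0" "ball p e \<subseteq> U" using assms openE by blast
  have "q \<in> U" if "\<And>i. dist (q $ i) (p $ i) < e / CARD('n)" for q
  proof -
    have "dist q p \<le> (\<Sum>i\<in>UNIV. dist (q $ i) (p $ i))" unfolding dist_vec_def by (rule L2_set_le_sum) simp
    also have "\<dots> < (\<Sum>i\<in>(UNIV::'n set). e / CARD('n))" by (rule sum_strict_mono) (use that in auto)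
    finally show ?thesis using e(2) by (auto simp: dist_commute)
  qed
  then show thesis using e(1) by (intro that[of "e / CARD('n)"]) auto
qed

lemma poly_fun_zero_open:
  fixes h :: "complex^'n \<Rightarrow> complex"
  assumes "poly_fun h" "open U" "U \<noteq> {}" "\<And>p. p \<in> U \<Longrightarrow> h p = 0"
  shows "h p = 0"
proof -
  obtain u where "u \<in> U" using assms(3) by blast
  then obtain e where e: "e > 0" "\<And>q. (\<And>i. dist (q $ i) (u $ i) < e) \<Longrightarrow> q \<in> U"
    using open_contains_box[OF assms(2)] by metis
  have "infinite (ball (u $ i) e)" for i using uncountable_ball[OF e(1)] countable_finite by blast
  then show ?thesis by (rule poly_fun_zero[OF assms(1), of "\<lambda>i. ball (u $ i) e"])
       (rule assms(4), rule e(2), simp add: dist_commute)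
qed

lemma poly_fun_has_derivative:
  assumes "poly_fun (g :: complex^'n \<Rightarrow> complex)"
  shows "\<exists>D. (g has_derivative D) (at z) \<and> (\<forall>c v. D (c *s v) = c * D v)" using assms
proof (induction rule: poly_fun_induct)
  case (const c)
  show ?case by (rule exI[of _ "\<lambda>_. 0"]) auto
next
  case (coord i)
  have "((\<lambda>p. p $ i) has_derivative (\<lambda>p. p $ i)) (at z)"
    by (rule bounded_linear.has_derivative[OF bounded_linear_vec_nth has_derivative_ident])
  then show ?case by (intro exI[of _ "\<lambda>p. p $ i"]) simp
next
  case (add g h)
  then obtain D E where D: "(g has_derivative D) (at z)" "\<forall>c v. D (c *s v) = c * D v"
    and E: "(h has_derivative E) (at z)" "\<forall>c v. E (c *s v) = c * E v" by blast
  show ?case by (intro exI[of _ "\<lambda>v. D v + E v"] conjI has_derivative_add D E) (simp add: D E distrib_left)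
next
  case (mult g h)
  then obtain D E where D: "(g has_derivative D) (at z)" "\<forall>c v. D (c *s v) = c * D v"
    and E: "(h has_derivative E) (at z)" "\<forall>c v. E (c *s v) = c * E v" by blast
  show ?case by (intro exI[of _ "\<lambda>v. g z * E v + D v * h z"] conjI has_derivative_mult D E)
       (simp add: D E algebra_simps)
qed

lemma poly_fun_continuous: "poly_fun g \<Longrightarrow> continuous_on A (g :: complex^'n \<Rightarrow> complex)"
  by (meson continuous_at_imp_continuous_on has_derivative_continuous poly_fun_has_derivative)

text \<open>The basis \<open>l\<close> is chosen before \<open>q\<close> and depends on the nodes
  alone. So the values at the nodes may be functions of further coordinates, which is how
  polynomials in separate variables are glued below.\<close>

lemma Lagrange_basis:
  fixes X :: "complex set"
  assumes "finite X" "card X = Suc M"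
  shows "\<exists>l. \<forall>q. degree q \<le> M \<longrightarrow> (\<forall>x. poly q x = (\<Sum>a\<in>X. poly (l a) x * poly q a))"
proof -
  define w where "w a = (\<Prod>b\<in>X - {a}. [:- b, 1:])" for a :: complex
  define l where "l a = smult (inverse (poly (w a) a)) (w a)" for a
  have wa: "poly (w a) a \<noteq> 0" for a using assms(1) by (simp add: w_def poly_prod)
  have l1: "poly (l a) a = 1" for a using wa by (simp add: l_def)
  have l0: "poly (l a) b = 0" if "b \<in> X" "b \<noteq> a" for a b using assms(1) that by (auto simp: l_def w_def poly_prod)
  have dl: "degree (l a) \<le> M" if "a \<in> X" for a
  proof -
    have "degree (w a) \<le> (\<Sum>b\<in>X - {a}. degree [:- b, 1:])"
      unfolding w_def using degree_prod_sum_le[of "X - {a}" "\<lambda>b. [:- b, 1:]"] assms(1) by (simp add: o_def)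
    also have "\<dots> = M" using assms that by simp
    finally show ?thesis by (simp add: l_def)
  qed
  have "poly q x = (\<Sum>a\<in>X. poly (l a) x * poly q a)" if "degree q \<le> M" for q x
  proof -
    define r where "r = q - (\<Sum>a\<in>X. smult (poly q a) (l a))"
    have "poly r b = 0" if "b \<in> X" for b
    proof -
      have "(\<Sum>a\<in>X. poly q a * poly (l a) b) = poly q b * poly (l b) b"
        using assms(1) that l0[of b] by (subst sum.remove[of _ b]) (fastforce intro!: sum.neutral)+
      then show ?thesis by (simp add: r_def poly_sum l1)
    qed
    then have "X \<subseteq> {x. poly r x = 0}" by auto
    moreover have "degree r \<le> M" unfolding r_def using that dl assms(1)
      by (intro degree_diff_le degree_sum_le) (auto intro: order.trans[OF degree_smult_le])
    ultimately have "r = 0"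
      using poly_roots_finite[of r] card_poly_roots_bound[of r] card_mono[of "{x. poly r x = 0}" X] assms(2) by fastforce
    then have "poly r x = 0" by simp
    then show ?thesis unfolding r_def by (simp add: poly_sum mult.commute)
  qed
  then show ?thesis by blast
qed

text \<open>Induction on the set \<open>S\<close> of coordinates that vary while the others are
  frozen at a point \<open>u\<close> of the box: interpolation at \<open>M + 1\<close> nodes
  releases one more coordinate. The restriction to a box allows \<open>h\<close> to be a quotient
  whose denominator has zeros elsewhere.\<close>

lemma separately_poly_imp_poly_fun:
  fixes h :: "complex^'n \<Rightarrow> complex"
  assumes inf: "\<And>i. infinite (X i)"
    and sep: "\<And>p i. (\<And>j. p $ j \<in> X j) \<Longrightarrow> \<exists>q. degree q \<le> M \<and> (\<forall>x\<in>X i. h (upd p i x) = poly q x)"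
  shows "\<exists>g. poly_fun g \<and> (\<forall>p. (\<forall>j. p $ j \<in> X j) \<longrightarrow> h p = g p)"
proof -
  define ov where "ov S u p = (\<chi> j. if j \<in> S then p $ j else u $ j)" for S and u p :: "complex^'n"
  define Box where "Box = {p. \<forall>j. p $ j \<in> X j}"
  have "finite S \<Longrightarrow> \<forall>u\<in>Box. \<exists>g. poly_fun g \<and> (\<forall>p\<in>Box. h (ov S u p) = g p)" for S
  proof (induction S rule: finite_induct)
    case empty
    have "ov {} u p = u" for u p by (simp add: ov_def)
    then show ?case by (auto intro: poly_fun_const)
  next
    case (insert i S)
    obtain Y where Y: "finite Y" "card Y = Suc M" "Y \<subseteq> X i" using infinite_arbitrarily_large[OF inf] by blast
    obtain l where l: "\<And>q x. degree q \<le> M \<Longrightarrow> poly q x = (\<Sum>a\<in>Y. poly (l a) x * poly q a)"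
      using Lagrange_basis[OF Y(1,2)] by blast
    show ?case
    proof
      fix u assume u: "u \<in> Box"
      have "\<forall>a\<in>Y. \<exists>g. poly_fun g \<and> (\<forall>p\<in>Box. h (ov S (upd u i a) p) = g p)"
        using insert.IH u Y(3) by (auto simp: Box_def intro!: bspec[OF insert.IH])
      then obtain G where G: "\<And>a. a \<in> Y \<Longrightarrow> poly_fun (G a)"
        "\<And>a p. a \<in> Y \<Longrightarrow> p \<in> Box \<Longrightarrow> h (ov S (upd u i a) p) = G a p" by metis
      have "h (ov (insert i S) u p) = (\<Sum>a\<in>Y. poly (l a) (p $ i) * G a p)" if p: "p \<in> Box" for p
      proof -
        let ?v = "ov (insert i S) u p"
        have "?v \<in> Box" using u p by (auto simp: Box_def ov_def)
        then obtain q where q: "degree q \<le> M" "\<And>x. x \<in> X i \<Longrightarrow> h (upd ?v i x) = poly q x"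
          using sep[of ?v i] by (auto simp: Box_def)
        have "p $ i \<in> X i" using p by (simp add: Box_def)
        moreover have "upd ?v i (p $ i) = ?v" by (simp add: vec_eq_iff ov_def)
        ultimately have "h ?v = poly q (p $ i)" using q(2) by metis
        also have "\<dots> = (\<Sum>a\<in>Y. poly (l a) (p $ i) * poly q a)" by (rule l[OF q(1)])
        also have "\<dots> = (\<Sum>a\<in>Y. poly (l a) (p $ i) * G a p)"
        proof (rule sum.cong[OF refl])
          fix a assume a: "a \<in> Y"
          have "upd ?v i a = ov S (upd u i a) p" using insert.hyps by (auto simp: vec_eq_iff ov_def)
          then have "poly q a = G a p" using q(2) a Y(3) G(2)[OF a p] by (metis subsetD)
          then show "poly (l a) (p $ i) * poly q a = poly (l a) (p $ i) * G a p" by simp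
        qed
        finally show ?thesis .
      qed
      moreover have "poly_fun (\<lambda>p. \<Sum>a\<in>Y. poly (l a) (p $ i) * G a p)"
        by (intro poly_fun_sum poly_fun_mult poly_fun_poly poly_fun_coord G)
      ultimately show "\<exists>g. poly_fun g \<and> (\<forall>p\<in>Box. h (ov (insert i S) u p) = g p)" by blast
    qed
  qed
  note * = this[of UNIV]
  have "\<forall>j. \<exists>x. x \<in> X j" using inf by (metis ex_in_conv finite.emptyI)
  then obtain x where x: "\<And>j. x j \<in> X j" by metis
  have "(\<chi> j. x j) \<in> Box" using x by (simp add: Box_def)
  moreover have "ov UNIV u p = p" for u p by (simp add: ov_def)
  ultimately obtain g where "poly_fun g" "\<forall>p\<in>Box. h p = g p" using * by force
  then show ?thesis by (auto simp: Box_def)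
qed

section \<open>The geometry of the domain\<close>

definition lst :: "'n::{finite,linorder}" where
  "lst = the_inv pos CARD('n)"

lemma inj_pos: "inj (pos :: 'n::{finite,linorder} \<Rightarrow> nat)" using bij_betw_pos by (rule bij_betw_imp_inj_on)

lemma pos_bounds: "1 \<le> pos i" "pos (i :: 'n::{finite,linorder}) \<le> CARD('n)"
  using bij_betw_pos[where 'n='n] by (auto simp: bij_betw_def)

lemma pos_surj:
  assumes "1 \<le> j" "j \<le> CARD('n)"
  obtains i :: "'n::{finite,linorder}" where "pos i = j"
  using bij_betw_pos[where 'n='n] assms unfolding bij_betw_def by (metis atLeastAtMost_iff imageE)

lemma pos_lst [simp]: "pos (lst :: 'n::{finite,linorder}) = CARD('n)" unfolding lst_def
  by (rule f_the_inv_into_f[OF inj_pos]) (metis bij_betw_imp_surj_on bij_betw_pos atLeastAtMost_iff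
      One_nat_def Suc_leI order_refl zero_less_card_finite)

lemma pos_less_card_iff [simp]: "pos i < CARD('n) \<longleftrightarrow> (i :: 'n::{finite,linorder}) \<noteq> lst"
  by (metis inj_pos injD less_irrefl nat_less_le pos_bounds(2) pos_lst)

lemma coord_card [simp]: "p \<section> CARD('n) = p $ (lst :: 'n::{finite,linorder})" by (metis coord_pos pos_lst)

text \<open>The elementary symmetric polynomials of the \<open>z_i^m\<close>, expressed through
  \<open>p = theta z\<close>. The last component of \<open>theta\<close> is only a
  \<open>t\<close>-th root of their product, hence the power \<open>t\<close>.\<close>

definition esym :: "nat \<Rightarrow> complex^'n::{finite,linorder} \<Rightarrow> nat \<Rightarrow> complex" where
  "esym t p j = (if j = 0 then 1 else if j < CARD('n) then p \<section> j else (p $ lst) ^ t)"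

text \<open>For \<open>p = theta z\<close> this is the product of the factors
  \<open>1 - z_i^m * y\<close>. Its zeros are reciprocals, so that membership in the domain becomes
  the absence of zeros in a compact disc.\<close>

definition char_fun :: "nat \<Rightarrow> complex^'n::{finite,linorder} \<Rightarrow> complex \<Rightarrow> complex" where
  "char_fun t p y = (\<Sum>j\<le>CARD('n). (-1) ^ j * esym t p j * y ^ j)"

definition torus :: "(complex^'n) set" where
  "torus = {z. \<forall>i. norm (z $ i) = 1}"

lemma elem_sym_0: "elem_sym 0 a = 1"
proof -
  have "{S. S \<subseteq> UNIV \<and> card S = 0} = {{} :: 'a::finite set}" by auto
  then show ?thesis by (simp add: elem_sym_def)
qed

lemma elem_sym_card: "elem_sym CARD('n) (a :: complex^'n) = (\<Prod>i\<in>UNIV. a $ i)"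
proof -
  have "{S. S \<subseteq> UNIV \<and> card S = CARD('n)} = {UNIV :: 'n set}"
    using card_eq_UNIV_imp_eq_UNIV[OF finite] by fastforce
  then show ?thesis by (simp add: elem_sym_def)
qed

lemma prod_elem_sym:
  "(\<Prod>i\<in>UNIV. 1 - (a :: complex^'n) $ i * y) = (\<Sum>j\<le>CARD('n). (-1) ^ j * elem_sym j a * y ^ j)"
proof -
  have "(\<Prod>i\<in>UNIV. 1 - a $ i * y) = (\<Prod>i\<in>UNIV. - y * a $ i + 1)" by (simp add: mult.commute)
  also have "\<dots> = (\<Sum>X\<in>Pow UNIV. (\<Prod>i\<in>X. - y * a $ i) * (\<Prod>i\<in>UNIV - X. 1))"
    by (rule prod_add) simp
  also have "\<dots> = (\<Sum>X\<in>UNIV. (- y) ^ card X * (\<Prod>i\<in>X. a $ i))"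
    by (simp only: prod.distrib prod_constant prod.neutral_const power_one mult_1_right Pow_UNIV)
  also have "\<dots> = (\<Sum>j\<le>CARD('n). \<Sum>X | X \<in> UNIV \<and> card X = j. (- y) ^ card X * (\<Prod>i\<in>X. a $ i))"
    by (rule sum.group[symmetric]) (auto intro: card_mono)
  also have "\<dots> = (\<Sum>j\<le>CARD('n). (-1) ^ j * elem_sym j a * y ^ j)" unfolding elem_sym_def
    by (intro sum.cong refl) (simp add: sum_distrib_left sum_distrib_right power_minus[of y] ac_simps)
  finally show ?thesis .
qed

lemma monic_factor:
  fixes p :: "complex poly"
  assumes "finite S" "degree p = card S" "lead_coeff p = 1"
  shows "\<exists>a. p = (\<Prod>i\<in>S. [:- a i, 1:])" using assms
proof (induction S arbitrary: p rule: finite_induct)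
  case empty
  then show ?case by (metis card.empty degree_eq_zeroE lead_coeff_pCons(2) pCons_one pCons_0_0 prod.empty)
next
  case (insert i S)
  then have "degree p \<noteq> 0" by simp
  then have "\<not> constant (poly p)" by (simp add: constant_degree)
  then obtain c where "poly p c = 0" using fundamental_theorem_of_algebra by blast
  then obtain q where q: "p = [:- c, 1:] * q" by (metis dvdE poly_eq_0_iff_dvd)
  then have "q \<noteq> 0" using insert.prems by auto
  then have "degree p = degree [:- c, 1:] + degree q" unfolding q by (intro degree_mult_eq) auto
  then have "degree q = card S" using insert.prems(1) insert.hyps by simp
  moreover have "lead_coeff q = 1" using insert.prems(2) q by (simp only: lead_coeff_mult) simp
  ultimately obtain a where a: "q = (\<Prod>i\<in>S. [:- a i, 1:])" using insert.IH by blast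
  have "p = (\<Prod>j\<in>insert i S. [:- (a(i := c)) j, 1:])"
  proof -
    have "(\<Prod>j\<in>S. [:- (a(i := c)) j, 1:]) = q" unfolding a using insert.hyps by (intro prod.cong) auto
    then show ?thesis using insert.hyps q by simp
  qed
  then show ?case by blast
qed

text \<open>Vieta: \<open>a\<close> lists the roots of the monic polynomial with the coefficients
  \<open>(-1) ^ j * e j\<close>. The expansion \<open>prod_elem_sym\<close> uses the reversed
  variable, so the comparison is made at \<open>1 / y\<close> with
  \<open>y \<noteq> 0\<close>.\<close>

lemma elem_sym_surj:
  fixes e :: "nat \<Rightarrow> complex"
  assumes "e 0 = 1"
  shows "\<exists>a :: complex^'n. \<forall>j\<le>CARD('n). elem_sym j a = e j"
proof -
  define p where "p = (\<Sum>j\<le>CARD('n). monom ((-1) ^ j * e j) (CARD('n) - j))"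
  have dle: "degree p \<le> CARD('n)" unfolding p_def by (intro degree_sum_le) (auto intro: order.trans[OF degree_monom_le])
  have c: "coeff p CARD('n) = 1"
  proof -
    have "coeff p CARD('n) = (\<Sum>j\<le>CARD('n). if j = 0 then (-1) ^ j * e j else 0)"
      unfolding p_def coeff_sum by (intro sum.cong refl) auto
    then show ?thesis using assms by simp
  qed
  have d: "degree p = CARD('n)" using c dle by (metis le_antisym le_degree zero_neq_one)
  obtain a where a: "p = (\<Prod>i\<in>(UNIV::'n set). [:- a i, 1:])" using monic_factor[of "UNIV :: 'n set" p] c d by auto
  define v :: "complex^'n" where "v = (\<chi> i. a i)"
  define r where "r = (\<Sum>j\<le>CARD('n). monom ((-1) ^ j * e j) j) - (\<Sum>j\<le>CARD('n). monom ((-1) ^ j * elem_sym j v) j)"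
  have "poly r y = 0" if y: "y \<noteq> 0" for y
  proof -
    have "(\<Sum>j\<le>CARD('n). (-1) ^ j * e j * y ^ j) = y ^ CARD('n) * poly p (1 / y)"
      unfolding p_def poly_sum sum_distrib_left poly_monom
      by (intro sum.cong refl) (use y in \<open>simp add: power_diff field_simps\<close>)
    also have "\<dots> = (\<Prod>i\<in>(UNIV::'n set). y * (1 / y - a i))" unfolding a poly_prod prod.distrib by simp
    also have "\<dots> = (\<Prod>i\<in>UNIV. 1 - v $ i * y)" using y by (intro prod.cong) (auto simp: v_def field_simps)
    also have "\<dots> = (\<Sum>j\<le>CARD('n). (-1) ^ j * elem_sym j v * y ^ j)" by (rule prod_elem_sym)
    finally show ?thesis by (simp add: r_def poly_sum poly_monom)
  qed
  then have "- {0} \<subseteq> {y. poly r y = 0}" by auto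
  moreover have "infinite (- {0::complex})" using infinite_UNIV_char_0 by (simp add: Compl_eq_Diff_UNIV)
  ultimately have r0: "r = 0" using poly_roots_finite infinite_super by blast
  have "elem_sym j v = e j" if "j \<le> CARD('n)" for j
  proof -
    have cs: "coeff (\<Sum>j\<le>CARD('n). monom ((-1) ^ j * f j) j) j = (-1) ^ j * f j" for f :: "nat \<Rightarrow> complex"
      unfolding coeff_sum using that by (simp add: sum.delta)
    have "coeff r j = 0" using r0 by simp
    then have "(-1) ^ j * e j = (-1) ^ j * elem_sym j v" unfolding r_def coeff_diff cs by simp
    then show ?thesis by simp
  qed
  then show ?thesis by blast
qed

section \<open>Weighted dilations and the domain as an image of the polydisc\<close>

locale weights =
  fixes m t :: nat
  assumes m_pos: "m > 0" and t_pos: "t > 0" and t_dvd: "t dvd m"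
begin

lemma quot_pos: "m div t > 0" using m_pos t_pos t_dvd by (simp add: div_greater_zero_iff dvd_imp_le)

abbreviation theta :: "complex^'n::{finite,linorder} \<Rightarrow> complex^'n::{finite,linorder}" where
  "theta \<equiv> basic_map m t"

abbreviation dom :: "(complex^'n::{finite,linorder}) set" where
  "dom \<equiv> basic_domain m t"

definition bdry :: "(complex^'n::{finite,linorder}) set" where
  "bdry = theta ` torus"

text \<open>The degree of \<open>theta z $ i\<close> as a homogeneous polynomial in
  \<open>z\<close>.\<close>

definition wt :: "'n::{finite,linorder} \<Rightarrow> nat" where
  "wt i = (if pos i < CARD('n) then pos i * m else CARD('n) * (m div t))"

definition dil :: "complex \<Rightarrow> complex^'n::{finite,linorder} \<Rightarrow> complex^'n::{finite,linorder}" where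
  "dil c p = (\<chi> i. c ^ wt i * p $ i)"

lemma dilate_eq_dil: "dilate m t r = dil (of_real r)" by (auto simp: dilate_def dil_def wt_def fun_eq_iff vec_eq_iff)

lemma wt_pos: "wt i > 0" using m_pos quot_pos pos_bounds(1)[of i] by (auto simp: wt_def)

lemma dil_nth: "dil c p $ i = c ^ wt i * p $ i" by (simp add: dil_def)

lemma dil_mult: "dil a (dil b p) = dil (a * b) p" by (simp add: vec_eq_iff dil_nth power_mult_distrib)

lemma dil_1 [simp]: "dil 1 p = p" by (simp add: vec_eq_iff dil_nth)

lemma dil_0 [simp]: "dil 0 (p :: complex^'n::{finite,linorder}) = 0"
proof -
  have "(0::complex) ^ wt i = 0" for i :: 'n using wt_pos[of i] by (simp add: power_0_left)
  then show ?thesis by (simp add: vec_eq_iff dil_nth)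
qed

lemma dil_curve: "\<exists>q. \<forall>c. dil c p $ i = poly q c"
  by (rule exI[of _ "monom (p $ i) (wt i)"]) (simp add: dil_nth poly_monom mult.commute)

lemma continuous_dil: "continuous_on UNIV (\<lambda>(c, p :: complex^'n::{finite,linorder}). dil c p)"
  unfolding dil_def case_prod_beta by (intro continuous_intros)

lemma continuous_dil' [continuous_intros]:
  assumes "continuous_on A f" "continuous_on A g"
  shows "continuous_on A (\<lambda>x. dil (f x) (g x :: complex^'n::{finite,linorder}))"
  using continuous_on_compose2[OF continuous_dil continuous_on_Pair[OF assms]] by simp

lemma theta_nth: "theta z $ i = (if i = lst then (\<Prod>l\<in>UNIV. z $ l) ^ (m div t)
    else elem_sym (pos i) (\<chi> l. (z $ l) ^ m))" by (simp add: basic_map_def)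

lemma esym_theta:
  assumes "j \<le> CARD('n)"
  shows "esym t (theta (z :: complex^'n::{finite,linorder})) j = elem_sym j (\<chi> l. (z $ l) ^ m)"
proof -
  have mt: "m div t * t = m" using t_dvd by simp
  consider "j = 0" | "1 \<le> j" "j < CARD('n)" | "j = CARD('n)" using assms by linarith
  then show ?thesis
  proof cases
    case 1
    then show ?thesis by (simp add: esym_def elem_sym_0)
  next
    case 2
    then obtain i :: 'n where i: "pos i = j" using pos_surj[of j, where 'n='n] by auto
    then have "i \<noteq> lst" using 2 by auto
    then have "theta z \<section> pos i = elem_sym (pos i) (\<chi> l. (z $ l) ^ m)" by (simp add: theta_nth)
    then show ?thesis using 2 i by (simp add: esym_def)
  next
    case 3
    have "((\<Prod>l\<in>UNIV. z $ l) ^ (m div t)) ^ t = (\<Prod>l\<in>UNIV. z $ l) ^ m" by (simp add: mt flip: power_mult)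
    then have "(theta z $ lst) ^ t = (\<Prod>l\<in>UNIV. (z $ l) ^ m)" by (simp add: theta_nth prod_power_distrib)
    then show ?thesis using 3 by (simp add: esym_def elem_sym_card)
  qed
qed

lemma char_fun_theta: "char_fun t (theta z) y = (\<Prod>i\<in>UNIV. 1 - (z $ i) ^ m * y)"
  using prod_elem_sym[of "\<chi> l. (z $ l) ^ m" y] by (simp add: char_fun_def esym_theta)

lemma theta_surj:
  fixes p :: "complex^'n::{finite,linorder}"
  obtains z where "theta z = p"
proof -
  obtain a :: "'n cvec" where a: "\<And>j. j \<le> CARD('n) \<Longrightarrow> elem_sym j a = esym t p j"
    using elem_sym_surj[of "esym t p"] by (auto simp: esym_def)
  have "\<forall>i. \<exists>w. w ^ m = a $ i" using exists_complex_root[of m] m_pos by (metis less_numeral_extra(3))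
  then obtain w where w: "\<And>i. w i ^ m = a $ i" by metis
  define s where "s = m div t"
  have st: "s * t = m" using t_dvd by (simp add: s_def)
  define u where "u = (\<Prod>i\<in>UNIV. w i)"
  have um: "(u ^ s) ^ t = (p $ lst) ^ t"
  proof -
    have "(u ^ s) ^ t = (\<Prod>i\<in>UNIV. w i ^ m)" by (simp add: u_def prod_power_distrib st flip: power_mult)
    also have "\<dots> = elem_sym CARD('n) a" by (simp add: w elem_sym_card)
    finally show ?thesis using a by (simp add: esym_def)
  qed
  \<comment> \<open>The roots \<open>w\<close> produce \<open>p $ lst\<close> only up to a
    \<open>t\<close>-th root of unity. The factor \<open>c\<close> corrects this in a single
    coordinate and, being an \<open>m\<close>-th root of unity, leaves the powers
    \<open>w i ^ m\<close> alone.\<close>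
  have "\<exists>c. c ^ m = 1 \<and> (c * u) ^ s = p $ lst"
  proof (cases "u = 0")
    case True
    then have "p $ lst = 0" using um t_pos quot_pos by (simp add: s_def power_0_left split: if_splits)
    then show ?thesis using True quot_pos by (intro exI[of _ 1]) (simp add: s_def)
  next
    case False
    obtain c where c: "c ^ s = p $ lst / u ^ s"
      using exists_complex_root[of s] quot_pos unfolding s_def by (metis less_numeral_extra(3))
    have "c ^ m = (c ^ s) ^ t" by (simp add: st flip: power_mult)
    also have "\<dots> = (p $ lst) ^ t / (u ^ s) ^ t" by (simp add: c power_divide)
    also have "\<dots> = 1" unfolding um[symmetric] using False by simp
    finally show ?thesis using c False by (intro exI[of _ c]) (simp add: power_mult_distrib)
  qed
  then obtain c where c: "c ^ m = 1" "(c * u) ^ s = p $ lst" by blast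
  define z :: "complex^'n::{finite,linorder}" where "z = (\<chi> i. if i = lst then c * w i else w i)"
  have zm: "(z $ i) ^ m = a $ i" for i using c(1) w by (simp add: z_def power_mult_distrib)
  have "(\<Prod>i\<in>UNIV. z $ i) = c * u"
  proof -
    have "(\<Prod>i\<in>UNIV. z $ i) = (\<Prod>i\<in>UNIV. (if i = lst then c else 1) * w i)"
      by (intro prod.cong) (auto simp: z_def)
    then show ?thesis by (simp add: prod.distrib u_def)
  qed
  then have "theta z $ i = p $ i" for i
  proof (cases "i = lst")
    case False
    then have "pos i < CARD('n)" by simp
    then have "elem_sym (pos i) a = p $ i"
      using a[of "pos i"] pos_bounds(1)[of i] by (simp add: esym_def del: pos_less_card_iff)
    moreover have "(\<chi> l. (z $ l) ^ m) = a" by (simp add: vec_eq_iff zm)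
    ultimately show ?thesis using False by (simp add: theta_nth)
  qed (use c(2) in \<open>simp add: theta_nth s_def\<close>)
  then show thesis by (intro that[of z]) (simp add: vec_eq_iff)
qed

text \<open>For any \<open>z\<close> with \<open>theta z = p\<close>, the zeros of
  \<open>char_fun t p\<close> are the reciprocals of the nonzero \<open>z_i^m\<close>. They decide
  whether \<open>z\<close> lies in the polydisc, whichever preimage is chosen.\<close>

lemma mem_dom_iff: "p \<in> dom \<longleftrightarrow> (\<forall>y\<in>cball 0 1. char_fun t p y \<noteq> 0)"
proof
  assume "p \<in> dom"
  then obtain z where z: "p = theta z" "\<And>i. norm (z $ i) < 1" by (auto simp: basic_domain_def polydisc_def)
  show "\<forall>y\<in>cball 0 1. char_fun t p y \<noteq> 0"
  proof
    fix y :: complex assume "y \<in> cball 0 1"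
    have "(z $ i) ^ m * y \<noteq> 1" for i
    proof -
      have "norm (z $ i) ^ m < 1" using z(2)[of i] m_pos by (simp add: power_less_one_iff)
      then have "norm ((z $ i) ^ m * y) < 1" using \<open>y \<in> cball 0 1\<close>
        by (auto simp: norm_mult norm_power intro: le_less_trans[OF mult_left_le])
      then show ?thesis by auto
    qed
    then show "char_fun t p y \<noteq> 0" by (auto simp: z char_fun_theta)
  qed
next
  assume *: "\<forall>y\<in>cball 0 1. char_fun t p y \<noteq> 0"
  obtain z where z: "theta z = p" using theta_surj .
  have "norm (z $ i) < 1" for i
  proof (rule ccontr)
    assume "\<not> norm (z $ i) < 1"
    then have 1: "norm (z $ i) \<ge> 1" by simp
    define y where "y = 1 / (z $ i) ^ m"
    have "z $ i \<noteq> 0" using 1 by auto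
    then have "1 - (z $ i) ^ m * y = 0" by (simp add: y_def)
    then have "char_fun t p y = 0" unfolding z[symmetric] char_fun_theta by (auto intro: prod_zero)
    moreover have "norm y \<le> 1" using one_le_power[OF 1, of m] by (simp add: y_def norm_divide norm_power divide_le_eq_1)
    ultimately show False using * by simp
  qed
  then show "p \<in> dom" using z by (auto simp: basic_domain_def polydisc_def)
qed

lemma continuous_char_fun:
  "continuous_on UNIV (\<lambda>(p :: complex^'n::{finite,linorder}, y). char_fun t p y)"
  unfolding char_fun_def esym_def coord_def case_prod_beta
proof (intro continuous_intros)
  fix j
  show "continuous_on UNIV (\<lambda>x :: 'n cvec \<times> complex. if j = 0 then 1
      else if j < CARD('n) then fst x $ the_inv pos j else fst x $ lst ^ t)"
    by (cases "j = 0"; cases "j < CARD('n)") (auto intro!: continuous_intros)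
qed

text \<open>By \<open>mem_dom_iff\<close> the complement is the projection of a closed set along the
  compact disc of all \<open>y\<close>, hence closed.\<close>

lemma open_dom: "open (dom :: (complex^'n::{finite,linorder}) set)"
proof -
  let ?F = "(\<lambda>x. char_fun t (snd x :: complex^'n::{finite,linorder}) (fst x)) -` {0}"
  have "continuous_on UNIV (\<lambda>x. char_fun t (snd x :: 'n cvec) (fst x))"
    using continuous_on_compose2[OF continuous_char_fun[where 'n='n] continuous_on_swap, of UNIV]
    by (simp add: prod.swap_def case_prod_beta)
  then have "closed ?F" by (intro closed_vimage) auto
  then have "closed {p. \<exists>y. y \<in> cball 0 1 \<and> (y, p) \<in> ?F}" by (intro closed_compact_projection) auto
  moreover have "dom = - {p :: 'n cvec. \<exists>y. y \<in> cball 0 1 \<and> (y, p) \<in> ?F}"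
    by (simp add: set_eq_iff mem_dom_iff Ball_def)
  ultimately show ?thesis by (simp add: closed_def)
qed

lemma poly_fun_theta: "poly_fun (\<lambda>z. theta z $ i)" unfolding theta_nth elem_sym_def by (cases "i = lst")
     (auto intro!: poly_fun_power poly_fun_prod poly_fun_sum poly_fun_coord)

lemma poly_fun_compose_theta: "poly_fun R \<Longrightarrow> poly_fun (\<lambda>z. R (theta z))"
  by (rule poly_fun_compose[OF _ poly_fun_theta])

lemma continuous_theta [continuous_intros]:
  fixes f :: "_ \<Rightarrow> complex^'n::{finite,linorder}"
  assumes "continuous_on A f"
  shows "continuous_on A (\<lambda>x. theta (f x))"
proof -
  have "continuous_on UNIV (theta :: complex^'n::{finite,linorder} \<Rightarrow> _)"
    using continuous_on_vec_lambda[of UNIV "\<lambda>i z. theta (z :: 'n cvec) $ i"]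
      poly_fun_continuous[OF poly_fun_theta[where 'a='n]] by simp
  then show ?thesis using continuous_on_compose2[OF _ assms] by blast
qed

lemma dil_theta: "dil c (theta z) = theta (c *s z)"
proof -
  have "dil c (theta z) $ i = theta (c *s z) $ i" for i
  proof (cases "i = lst")
    case True
    then show ?thesis by (simp add: dil_nth wt_def theta_nth prod.distrib power_mult_distrib power_mult)
  next
    case False
    then have "wt i = pos i * m" by (simp add: wt_def)
    then show ?thesis using False by (auto simp: dil_nth theta_nth elem_sym_def power_mult_distrib prod.distrib sum_distrib_left
          power_mult[symmetric] mult.commute[of m] intro!: sum.cong)
  qed
  then show ?thesis by (simp add: vec_eq_iff)
qed

lemma dil_dom: "p \<in> dom \<Longrightarrow> norm c \<le> 1 \<Longrightarrow> dil c p \<in> dom"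
proof -
  assume "p \<in> dom" "norm c \<le> 1"
  then obtain z where z: "p = theta z" "\<And>i. norm (z $ i) < 1" by (auto simp: basic_domain_def polydisc_def)
  have "norm ((c *s z) $ i) < 1" for i
    using z(2)[of i] \<open>norm c \<le> 1\<close> by (auto simp: norm_mult intro: le_less_trans[OF mult_left_le_one_le])
  then show ?thesis by (auto simp: z dil_theta basic_domain_def polydisc_def)
qed

lemma dil_bdry: "q \<in> bdry \<Longrightarrow> norm c < 1 \<Longrightarrow> dil c q \<in> dom"
proof -
  assume "q \<in> bdry" and c: "norm c < 1"
  then obtain z where z: "q = theta z" "z \<in> torus" by (auto simp: bdry_def)
  then have "norm ((c *s z) $ i) < 1" for i using c by (simp add: norm_mult torus_def)
  then show ?thesis by (auto simp: z dil_theta basic_domain_def polydisc_def)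
qed

lemma dil_bdry_bdry: "q \<in> bdry \<Longrightarrow> norm c = 1 \<Longrightarrow> dil c q \<in> bdry"
proof -
  assume "q \<in> bdry" "norm c = 1"
  then obtain z where "q = theta z" "c *s z \<in> torus" by (auto simp: bdry_def torus_def norm_mult)
  then show ?thesis by (auto simp: bdry_def dil_theta)
qed

lemma bdry_nonempty: "(bdry :: (complex^'n::{finite,linorder}) set) \<noteq> {}"
proof -
  have "(\<chi> i. 1) \<in> (torus :: 'n cvec set)" by (simp add: torus_def)
  then show ?thesis by (auto simp: bdry_def)
qed

lemma zero_in_dom: "0 \<in> (dom :: (complex^'n::{finite,linorder}) set)"
proof -
  obtain q :: "'n cvec" where "q \<in> bdry" using bdry_nonempty by blast
  then show ?thesis using dil_bdry[of q 0] by simp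
qed

lemma open_dil_dom: "open {c. dil c p \<in> dom}"
proof -
  have "open ((\<lambda>c. dil c p) -` dom)" by (intro open_vimage[OF open_dom] continuous_intros)
  then show ?thesis by (simp add: vimage_def)
qed

lemma dil_dom_mono: "dil c p \<in> dom \<Longrightarrow> norm c' \<le> norm c \<Longrightarrow> dil c' p \<in> dom"
proof (cases "c = 0")
  case False
  assume "dil c p \<in> dom" "norm c' \<le> norm c"
  then have "dil (c' / c) (dil c p) \<in> dom"
    using False dil_dom[of "dil c p" "c' / c"] by (auto simp: norm_divide divide_le_eq_1 simp del: dil_mult)
  then show ?thesis using False by (simp add: dil_mult)
qed auto

text \<open>Openness gives a point further out on the ray through \<open>c\<close>, and
  \<open>dil_dom_mono\<close> then the whole disc of that radius. For \<open>c = 1\<close> this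
  margin beyond the unit circle keeps the roots of the denominator away from
  \<open>1\<close>.\<close>

lemma dil_dom_enlarge:
  assumes "dil c p \<in> dom"
  obtains r where "r > norm c" "\<And>c'. norm c' \<le> r \<Longrightarrow> dil c' p \<in> dom"
proof -
  obtain e where e: "e > 0" "ball c e \<subseteq> {c. dil c p \<in> dom}" using openE[OF open_dil_dom[of p], of c] assms by auto
  define u where "u = (if c = 0 then 1 else c / norm c)"
  have u: "norm u = 1" by (simp add: u_def norm_divide)
  have cu: "c = norm c * u" by (simp add: u_def)
  define c2 where "c2 = (norm c + e / 2) * u"
  have "dist c c2 = norm (c - c2)" by (simp add: dist_norm)
  also have "c - c2 = - (e / 2) * u" unfolding c2_def by (subst cu) (simp add: algebra_simps)
  also have "norm \<dots> = e / 2" using e(1) by (simp add: norm_mult u)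
  finally have "dist c c2 < e" using e(1) by simp
  then have "dil c2 p \<in> dom" using e(2) by auto
  moreover have "norm c2 = norm c + e / 2"
    unfolding c2_def norm_mult u using e(1) by (simp add: norm_mult u flip: of_real_add of_real_divide)
  ultimately show thesis using e(1) dil_dom_mono[of c2 p] by (intro that[of "norm c + e / 2"]) auto
qed

text \<open>All weights are at least \<open>1\<close>, so for \<open>norm c \<le> 1\<close> the map
  \<open>dil c\<close> shrinks at least by the factor \<open>norm c\<close>. The resulting radius
  \<open>e / (1 + norm p)\<close> is the source of every polynomial growth bound in
  \<open>p\<close>.\<close>

lemma dil_dom_small:
  obtains e where "0 < e" "e \<le> 1"
    "\<And>c (p :: complex^'n::{finite,linorder}). norm c * (1 + norm p) \<le> e \<Longrightarrow> dil c p \<in> dom"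
proof -
  obtain d where d: "d > 0" "ball (0 :: 'n cvec) d \<subseteq> dom" using openE[OF open_dom zero_in_dom] by auto
  define e where "e = min 1 (d / 2)"
  have e: "0 < e" "e \<le> 1" "e < d" using d(1) by (auto simp: e_def)
  have "dil c p \<in> dom" if c: "norm c * (1 + norm p) \<le> e" for c and p :: "'n cvec"
  proof -
    have "norm c * 1 \<le> norm c * (1 + norm p)" by (intro mult_left_mono) auto
    then have c1: "norm c \<le> 1" using c e(2) by simp
    have "norm (dil c p) \<le> norm (norm c *\<^sub>R p)"
    proof (rule norm_le_componentwise_cart)
      fix i :: 'n
      have "norm c ^ wt i \<le> norm c ^ 1" by (rule power_decreasing) (use wt_pos[of i] c1 in auto)
      then show "norm (dil c p $ i) \<le> norm ((norm c *\<^sub>R p) $ i)"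
        by (simp add: dil_nth norm_mult norm_power mult_right_mono)
    qed
    also have "\<dots> = norm c * norm p" by simp
    also have "\<dots> \<le> norm c * (1 + norm p)" by (intro mult_left_mono) auto
    also have "\<dots> < d" using c e by simp
    finally show ?thesis using d(2) by auto
  qed
  then show thesis using that e by blast
qed

lemma compact_torus: "compact (torus :: (complex^'n) set)"
proof -
  have "norm z \<le> CARD('n)" if "z \<in> torus" for z :: "complex^'n"
  proof -
    have "norm z \<le> (\<Sum>i\<in>UNIV. norm (z $ i))" unfolding norm_vec_def by (rule L2_set_le_sum) simp
    then show ?thesis using that by (simp add: torus_def)
  qed
  then have "bounded (torus :: (complex^'n) set)" by (rule boundedI)
  moreover have "closed (torus :: (complex^'n) set)"
    unfolding torus_def by (intro closed_Collect_all closed_Collect_eq continuous_intros)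
  ultimately show ?thesis by (simp add: compact_eq_bounded_closed)
qed

lemma bdry_subset_closure: "bdry \<subseteq> closure (dom :: (complex^'n::{finite,linorder}) set)"
proof
  fix q :: "'n cvec" assume q: "q \<in> bdry"
  have "(\<lambda>n. dil (of_real (1 - 1 / Suc n)) q) \<longlonglongrightarrow> dil (of_real (1 - 0)) q"
  proof (rule continuous_on_tendsto_compose[of UNIV "\<lambda>c. dil c q"])
    show "(\<lambda>n. complex_of_real (1 - 1 / Suc n)) \<longlonglongrightarrow> of_real (1 - 0)"
      by (intro tendsto_of_real tendsto_diff tendsto_const) (rule lim_inverse_n'[THEN LIMSEQ_Suc])
  qed (auto intro!: continuous_intros)
  moreover have "dil (of_real (1 - 1 / Suc n)) q \<in> dom" for n
    by (rule dil_bdry[OF q]) (simp only: norm_of_real, auto simp: field_simps)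
  ultimately show "q \<in> closure dom"
    by (auto simp: closure_sequential intro!: exI[of _ "\<lambda>n. dil (of_real (1 - 1 / Suc n)) q"])
qed

lemma dil_bdry_closure:
  assumes "q \<in> bdry" "norm c \<le> 1"
  shows "dil c q \<in> closure dom"
proof (cases "norm c = 1")
  case True
  then show ?thesis using dil_bdry_bdry[OF assms(1)] bdry_subset_closure by blast
next
  case False
  then have "dil c q \<in> dom" using assms(2) by (intro dil_bdry[OF assms(1)]) auto
  then show ?thesis using closure_subset by blast
qed

lemma (in -) infinite_circle_arc: "norm z = 1 \<Longrightarrow> e > 0 \<Longrightarrow> infinite (sphere (0::complex) 1 \<inter> ball z e)"
proof -
  assume "norm z = 1" "e > 0"
  have "connected (sphere (0::complex) 1)" by (simp add: connected_sphere)
  moreover have "-1 \<in> sphere (0::complex) 1" "1 \<in> sphere (0::complex) 1" by auto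
  then have "\<not> (\<exists>x. sphere (0::complex) 1 = {x})" by (metis one_neq_neg_one singletonD)
  ultimately have "z islimpt sphere 0 1" using \<open>norm z = 1\<close> by (intro connected_imp_perfect) auto
  then show ?thesis using \<open>e > 0\<close> by (simp add: islimpt_eq_infinite_ball)
qed

text \<open>A torus point has a product of arcs as a neighbourhood. Arcs are infinite, so if
  \<open>R\<close> composed with \<open>theta\<close> vanished there, it would vanish identically,
  and so would \<open>R\<close>, as \<open>theta\<close> is onto.\<close>

lemma bdry_dense_nonzero:
  fixes R :: "complex^'n::{finite,linorder} \<Rightarrow> complex"
  assumes "poly_fun R" "R p \<noteq> 0" "q \<in> bdry"
  shows "q \<in> closure {q\<in>bdry. R q \<noteq> 0}"
proof (rule ccontr)
  let ?C = "closure {q\<in>bdry. R q \<noteq> 0}"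
  assume "q \<notin> ?C"
  obtain z where z: "q = theta z" "\<And>i. norm (z $ i) = 1" using assms(3) by (auto simp: bdry_def torus_def)
  have "open (theta -` (- ?C))" by (intro open_vimage continuous_intros) auto
  moreover have "z \<in> theta -` (- ?C)" using \<open>q \<notin> ?C\<close> z by simp
  ultimately obtain e where e: "e > 0" "\<And>w. (\<And>i. dist (w $ i) (z $ i) < e) \<Longrightarrow> w \<in> theta -` (- ?C)"
    by (rule open_contains_box[where U = "theta -` (- ?C)" and p = z]) blast
  have "R (theta w) = 0" for w
  proof (rule poly_fun_zero[OF poly_fun_compose_theta[OF assms(1)]])
    show "infinite (sphere 0 1 \<inter> ball (z $ i) e)" for i using infinite_circle_arc z(2) e(1) by blast
    fix w :: "'n cvec" assume w: "\<And>i. w $ i \<in> sphere 0 1 \<inter> ball (z $ i) e"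
    then have "theta w \<notin> ?C" using e(2)[of w] by (auto simp: dist_commute)
    then have "theta w \<notin> {q\<in>bdry. R q \<noteq> 0}" using closure_subset[THEN subsetD] by metis
    moreover have "theta w \<in> bdry" using w by (auto simp: bdry_def torus_def)
    ultimately show "R (theta w) = 0" by blast
  qed
  then show False using assms(2) theta_surj[of p] by metis
qed

lemma bdry_closed_property:
  assumes "poly_fun R" "R p \<noteq> 0" "closed {q. P q}" "\<And>q. q \<in> bdry \<Longrightarrow> R q \<noteq> 0 \<Longrightarrow> P q" "q \<in> bdry"
  shows "P q"
proof -
  have "closure {q\<in>bdry. R q \<noteq> 0} \<subseteq> {q. P q}" by (rule closure_minimal) (use assms(3,4) in auto)
  then show ?thesis using bdry_dense_nonzero[OF assms(1,2,5)] by blast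
qed

lemma poly_fun_zero_bdry:
  fixes R :: "complex^'n::{finite,linorder} \<Rightarrow> complex"
  assumes "poly_fun R" "\<And>q. q \<in> bdry \<Longrightarrow> R q = 0"
  shows "R p = 0"
proof (rule ccontr)
  assume "R p \<noteq> 0"
  obtain q :: "'n cvec" where "q \<in> bdry" using bdry_nonempty by blast
  moreover have "{q\<in>bdry. R q \<noteq> 0} = {}" using assms(2) by blast
  ultimately show False
    using bdry_dense_nonzero[OF assms(1) \<open>R p \<noteq> 0\<close>, of q] by (metis closure_empty empty_iff)
qed

lemma poly_fun_zero_dom:
  fixes R :: "complex^'n::{finite,linorder} \<Rightarrow> complex"
  assumes "poly_fun R" "\<And>q. q \<in> dom \<Longrightarrow> R q = 0"
  shows "R p = 0" using poly_fun_zero_open[OF assms(1) open_dom] assms(2) zero_in_dom by blast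

subsection \<open>Reflection\<close>

definition tilde :: "(complex^'n::{finite,linorder} \<Rightarrow> complex) \<Rightarrow> complex^'n::{finite,linorder} \<Rightarrow> complex" where
  "tilde g p = cnj (g (reflect t (\<chi> i. cnj (p $ i))))"

text \<open>Reflection divides by powers of \<open>p $ lst\<close> only. Once they are cleared,
  identities that involve \<open>tilde g\<close> are identities of polynomial functions and can be
  checked on the boundary, where \<open>tilde g\<close> is the conjugate of
  \<open>g\<close>.\<close>

lemma tilde_poly:
  fixes g :: "complex^'n::{finite,linorder} \<Rightarrow> complex"
  assumes "poly_fun g"
  shows "\<exists>M g'. poly_fun g' \<and> (\<forall>p. p $ lst \<noteq> 0 \<longrightarrow> g' p = (p $ lst) ^ M * tilde g p)"
  using assms
proof (induction rule: poly_fun_induct)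
  case (const c)
  show ?case by (intro exI[of _ 0] exI[of _ "\<lambda>_. cnj c"]) (auto simp: tilde_def poly_fun_const)
next
  case (coord i)
  show ?case
  proof (cases "i = lst")
    case True
    then show ?thesis by (intro exI[of _ 1] exI[of _ "\<lambda>_. 1"]) (auto simp: tilde_def poly_fun_const reflect_def)
  next
    case False
    then show ?thesis by (intro exI[of _ t] exI[of _ "\<lambda>p. p \<section> (CARD('n) - pos i)"])
         (auto simp: tilde_def poly_fun_coord reflect_def coord_def simp flip: lst_def)
  qed
next
  case (add g h)
  then obtain M g' K h' where
    g': "poly_fun g'" "\<And>p. p $ lst \<noteq> 0 \<Longrightarrow> g' p = (p $ lst) ^ M * tilde g p" and
    h': "poly_fun h'" "\<And>p. p $ lst \<noteq> 0 \<Longrightarrow> h' p = (p $ lst) ^ K * tilde h p" by blast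
  show ?case by (intro exI[of _ "M + K"] exI[of _ "\<lambda>p. (p $ lst) ^ K * g' p + (p $ lst) ^ M * h' p"] conjI
        poly_fun_add poly_fun_mult poly_fun_power poly_fun_coord g' h')
       (auto simp: g' h' tilde_def power_add algebra_simps)
next
  case (mult g h)
  then obtain M g' K h' where
    g': "poly_fun g'" "\<And>p. p $ lst \<noteq> 0 \<Longrightarrow> g' p = (p $ lst) ^ M * tilde g p" and
    h': "poly_fun h'" "\<And>p. p $ lst \<noteq> 0 \<Longrightarrow> h' p = (p $ lst) ^ K * tilde h p" by blast
  show ?case by (intro exI[of _ "M + K"] exI[of _ "\<lambda>p. g' p * h' p"] conjI poly_fun_mult g' h')
       (auto simp: g' h' tilde_def power_add algebra_simps)
qed

lemma norm_lst_bdry: "q \<in> bdry \<Longrightarrow> norm (q $ lst) = 1"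
  by (auto simp: bdry_def torus_def theta_nth norm_power simp flip: prod_norm)

lemma elem_sym_inverse:
  fixes a :: "complex^'n::{finite,linorder}"
  assumes "\<And>i. a $ i \<noteq> 0" "j \<le> CARD('n)"
  shows "elem_sym j (\<chi> i. inverse (a $ i)) = elem_sym (CARD('n) - j) a / (\<Prod>i\<in>UNIV. a $ i)"
proof -
  have "elem_sym j (\<chi> i. inverse (a $ i)) = (\<Sum>S | S \<subseteq> UNIV \<and> card S = j. inverse (\<Prod>i\<in>S. a $ i))"
    unfolding elem_sym_def by (intro sum.cong refl) (simp add: prod_inversef[unfolded o_def])
  also have "\<dots> = (\<Sum>S | S \<subseteq> UNIV \<and> card S = CARD('n) - j. inverse (\<Prod>i\<in>- S. a $ i))"
    by (rule sum.reindex_bij_witness[of _ uminus uminus])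
       (use assms(2) in \<open>auto simp: Compl_eq_Diff_UNIV card_Diff_subset Diff_Diff_Int\<close>)
  also have "\<dots> = (\<Sum>S | S \<subseteq> UNIV \<and> card S = CARD('n) - j. (\<Prod>i\<in>S. a $ i) / (\<Prod>i\<in>UNIV. a $ i))"
  proof (intro sum.cong refl)
    fix S :: "'n set"
    have "(\<Prod>i\<in>UNIV. a $ i) = (\<Prod>i\<in>S. a $ i) * (\<Prod>i\<in>- S. a $ i)"
      by (metis Compl_partition finite prod.union_disjoint Compl_disjoint)
    then show "inverse (\<Prod>i\<in>- S. a $ i) = (\<Prod>i\<in>S. a $ i) / (\<Prod>i\<in>UNIV. a $ i)"
      using assms(1) by (simp add: field_simps)
  qed
  finally show ?thesis by (simp add: elem_sym_def sum_divide_distrib)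
qed

text \<open>On the torus conjugation is inversion, and by \<open>elem_sym_inverse\<close> inversion
  turns the elementary symmetric polynomial of degree \<open>j\<close> into the one of degree
  \<open>d - j\<close>, divided by the full product. That product is \<open>p_d^t\<close>, which
  explains the shape of \<open>reflect\<close>.\<close>

lemma reflect_bdry:
  assumes "q \<in> bdry"
  shows "reflect t (\<chi> i. cnj (q $ i)) = q"
proof -
  obtain z where z: "q = theta z" "\<And>i. norm (z $ i) = 1" using assms by (auto simp: bdry_def torus_def)
  have znz: "z $ i \<noteq> 0" for i using z(2)[of i] by auto
  have cz: "cnj (z $ i) = inverse (z $ i)" for i
    using z(2)[of i] complex_norm_square[of "z $ i"] by (intro inverse_unique[symmetric]) simp
  define a where "a = (\<chi> l. (z $ l) ^ m)"
  define P where "P = (\<Prod>l\<in>UNIV. z $ l)"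
  have P0: "P \<noteq> 0" using znz by (simp add: P_def)
  have cE: "cnj (elem_sym j a) = elem_sym (CARD('a) - j) a / P ^ m" if "j \<le> CARD('a)" for j
  proof -
    have "cnj (elem_sym j a) = elem_sym j (\<chi> i. inverse (a $ i))" by (simp add: elem_sym_def a_def cz power_inverse)
    also have "\<dots> = elem_sym (CARD('a) - j) a / (\<Prod>i\<in>UNIV. a $ i)"
      using that znz by (intro elem_sym_inverse) (auto simp: a_def)
    finally show ?thesis by (simp add: a_def P_def prod_power_distrib)
  qed
  have cP: "cnj (P ^ (m div t)) = 1 / P ^ (m div t)"
    by (simp add: P_def cz prod_inversef[unfolded o_def] inverse_eq_divide power_one_over prod_dividef)
  have mt: "(P ^ (m div t)) ^ t = P ^ m" using t_dvd by (simp flip: power_mult)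
  have "reflect t (\<chi> i. cnj (q $ i)) $ i = q $ i" for i
  proof (cases "i = lst")
    case True
    then show ?thesis using cP by (simp add: reflect_def z theta_nth flip: P_def)
  next
    case False
    then have i: "pos i < CARD('a)" "1 \<le> pos i" using pos_bounds(1)[of i] by auto
    then have "1 \<le> CARD('a) - pos i" by linarith
    then obtain i' :: 'a where i': "pos i' = CARD('a) - pos i" by (rule pos_surj) auto
    have "pos i' < CARD('a)" unfolding i' using i(2) zero_less_card_finite[where 'a='a] by linarith
    then have "i' \<noteq> lst" by simp
    have "reflect t (\<chi> i. cnj (q $ i)) $ i
        = (\<chi> i. cnj (q $ i)) \<section> (pos i') / cnj (P ^ (m div t)) ^ t"
      using False i' by (simp add: reflect_def z theta_nth P_def)
    also have "\<dots> = cnj (elem_sym (pos i') a) * P ^ m"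
      using \<open>i' \<noteq> lst\<close> mt unfolding cP by (simp add: z theta_nth a_def power_divide)
    also have "\<dots> = elem_sym (pos i) a" using cE[of "pos i'"] i i' P0 by simp
    finally show ?thesis using False by (simp add: z theta_nth a_def)
  qed
  then show ?thesis by (simp add: vec_eq_iff)
qed

lemma tilde_bdry: "q \<in> bdry \<Longrightarrow> tilde g q = cnj (g q)" by (simp add: tilde_def reflect_bdry)

end

section \<open>Complex polynomials and functions on the unit disc\<close>

lemma infinite_unit_circle: "infinite (sphere (0::complex) 1)" using infinite_circle_arc[of 1 1] by (auto intro: infinite_super)

lemma poly_eqI_circle:
  fixes p q :: "complex poly"
  assumes "\<And>x. norm x = 1 \<Longrightarrow> poly p x = poly q x"
  shows "p = q"
proof -
  have "sphere 0 1 \<subseteq> {x. poly (p - q) x = 0}" using assms by auto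
  then have "p - q = 0" using infinite_unit_circle poly_roots_finite infinite_super by blast
  then show ?thesis by simp
qed

lemma poly_map_cnj: "poly (map_poly cnj p) x = cnj (poly p (cnj x))" by (induction p) (simp_all add: map_poly_pCons)

lemma degree_map_cnj: "degree (map_poly cnj p) = degree p" by (intro degree_map_poly) simp

text \<open>Up to powers of the variable, equal moduli on the circle mean
  \<open>A * sh A = B * sh B\<close>, where \<open>sh\<close> is reflection at the circle. As
  \<open>B\<close> is coprime to \<open>A\<close> and to the variable, it divides
  \<open>sh A\<close>; counting degrees leaves a constant quotient \<open>\<sigma>\<close>.
  Comparing constant and leading coefficients shows that \<open>\<sigma>\<close> is both the
  conjugate and the inverse of \<open>lead_coeff A\<close>.\<close>

lemma coprime_unimodular_circle:
  fixes A B :: "complex poly"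
  assumes bez: "U * A + V * B = [:\<rho>:]" "\<rho> \<noteq> 0"
    and abs: "\<And>x. norm x = 1 \<Longrightarrow> norm (poly A x) = norm (poly B x)"
    and B0: "coeff B 0 = 1"
  shows "norm (lead_coeff A) = 1" "poly A 1 = lead_coeff A * cnj (poly B 1)"
proof -
  define sh where "sh p = reflect_poly (map_poly cnj p)" for p
  define a b where "a = degree A" and "b = degree B"
  have sh: "poly (sh p) x = x ^ degree p * cnj (poly p x)" if "norm x = 1" for p x
  proof -
    have x: "x \<noteq> 0" "cnj (inverse x) = x" using that complex_norm_square[of x] by (auto simp: divide_simps mult.commute)
    then show ?thesis by (simp add: sh_def poly_reflect_poly_nz degree_map_cnj poly_map_cnj del: complex_cnj_inverse)
  qed
  have "monom 1 b * (A * sh A) = monom 1 a * (B * sh B)"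
  proof (rule poly_eqI_circle)
    fix x :: complex assume x: "norm x = 1"
    have "poly A x * cnj (poly A x) = poly B x * cnj (poly B x)"
      using abs[OF x] complex_norm_square[of "poly A x"] complex_norm_square[of "poly B x"] by simp
    then show "poly (monom 1 b * (A * sh A)) x = poly (monom 1 a * (B * sh B)) x"
      by (simp add: sh[OF x] poly_monom a_def b_def algebra_simps)
  qed
  note eq = this
  \<comment> \<open>The constant coefficient of \<open>B\<close> is \<open>1\<close>, so the
    variable is invertible modulo \<open>B\<close> and its powers can be cancelled.\<close>
  have X: "B dvd Z" if "B dvd monom 1 k * Z" for k Z using that
  proof (induction k)
    case (Suc k)
    obtain Y where Y: "B = 1 + [:0, 1:] * Y"
    proof -
      obtain c Y where "B = pCons c Y" by (cases B)
      then show thesis using B0 by (intro that[of Y]) (simp add: one_pCons)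
    qed
    let ?W = "monom 1 k * Z"
    have "monom 1 (Suc k) * Z = [:0, 1:] * ?W" by (simp add: monom_Suc)
    then have "B dvd [:0, 1:] * ?W" using Suc.prems by simp
    moreover have "?W = B * ?W - Y * ([:0, 1:] * ?W)" by (subst Y) (simp add: algebra_simps)
    ultimately have "B dvd ?W" by (metis dvd_diff dvd_triv_left dvd_mult)
    then show ?case by (rule Suc.IH)
  qed simp
  have "B dvd A * sh A" by (rule X[of b]) (use eq in \<open>metis dvd_triv_left dvd_mult\<close>)
  moreover have "[:\<rho>:] * sh A = U * (A * sh A) + B * (V * sh A)" unfolding bez(1)[symmetric] by (simp add: algebra_simps)
  ultimately have "B dvd [:\<rho>:] * sh A" by (metis dvd_add dvd_mult dvd_triv_left)
  then have "B dvd sh A" using bez(2) by (simp add: dvd_smult_cancel)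
  then obtain S where S: "sh A = B * S" by (elim dvdE)
  have "B \<noteq> 0" using B0 by auto
  have "A \<noteq> 0"
  proof
    assume "A = 0"
    then have "B = 0" using abs by (intro poly_eqI_circle) auto
    then show False using \<open>B \<noteq> 0\<close> by simp
  qed
  then have "map_poly cnj A \<noteq> 0" by (auto simp: poly_eq_iff coeff_map_poly)
  then have "S \<noteq> 0" using S by (auto simp: sh_def)
  have cB0: "coeff (map_poly cnj B) 0 = 1" by (simp add: coeff_map_poly B0)
  have "B * (monom 1 b * A * S) = B * (monom 1 a * sh B)" using eq S by (simp add: ac_simps)
  then have eq2: "monom 1 b * A * S = monom 1 a * sh B" using \<open>B \<noteq> 0\<close> by simp
  \<comment> \<open>Reflection lowers the degree only if the constant coefficient vanishes; here
    that coefficient becomes the leading one.\<close>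
  have sB: "degree (sh B) = b" using cB0 by (simp add: sh_def b_def degree_map_cnj)
  have lsB: "lead_coeff (sh B) = 1" using cB0 sB by (simp add: sh_def b_def degree_map_cnj coeff_reflect_poly)
  then have "sh B \<noteq> 0" by auto
  have "b + a + degree S = a + b"
    using arg_cong[OF eq2, of degree] \<open>S \<noteq> 0\<close> \<open>A \<noteq> 0\<close> \<open>sh B \<noteq> 0\<close> sB
    by (simp add: degree_mult_eq degree_monom_eq a_def)
  then obtain \<sigma> where \<sigma>: "S = [:\<sigma>:]" by (auto elim: degree_eq_zeroE)
  have "coeff (sh A) 0 = cnj (lead_coeff A)" by (simp add: sh_def degree_map_cnj coeff_map_poly)
  then have s1: "\<sigma> = cnj (lead_coeff A)" using S \<sigma> B0 by simp
  have s2: "lead_coeff A * \<sigma> = 1" using arg_cong[OF eq2, of lead_coeff] lsB unfolding lead_coeff_mult \<sigma>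
    by (simp add: degree_monom_eq)
  have n2: "norm (lead_coeff A) ^ 2 = 1"
    using s2 unfolding s1 complex_norm_square[symmetric] by (metis of_real_1 of_real_eq_iff)
  then show "norm (lead_coeff A) = 1"
    using abs_norm_cancel[of "lead_coeff A"] by (simp add: power2_eq_1_iff) (smt (verit) norm_ge_zero)
  have "poly A 1 * \<sigma> = cnj (poly B 1)"
    using arg_cong[OF eq2, of "\<lambda>p. poly p 1"] by (simp add: \<sigma> poly_monom sh mult.commute)
  then show "poly A 1 = lead_coeff A * cnj (poly B 1)" using s2 by (metis mult.assoc mult.commute mult.left_neutral)
qed

section \<open>Estimates for polynomials with zeros away from the origin\<close>

lemma poly_split_root:
  fixes p :: "complex poly"
  assumes "degree p > 0" "\<And>x. poly p x = 0 \<Longrightarrow> s \<le> norm x" "s > 0"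
  obtains \<alpha> q where "p = [:1, - 1 / \<alpha>:] * q" "s \<le> norm \<alpha>" "degree q = degree p - 1" "\<And>x. poly q x = 0 \<Longrightarrow> s \<le> norm x"
proof -
  have "\<not> constant (poly p)" using assms(1) by (simp add: constant_degree)
  then obtain \<alpha> where a: "poly p \<alpha> = 0" using fundamental_theorem_of_algebra by blast
  then obtain r where r: "p = [:- \<alpha>, 1:] * r" by (metis dvdE poly_eq_0_iff_dvd)
  have s: "s \<le> norm \<alpha>" using assms(2) a by blast
  then have a0: "\<alpha> \<noteq> 0" using assms(3) by auto
  define q where "q = smult (- \<alpha>) r"
  have "[:- \<alpha>, 1:] = smult (- \<alpha>) [:1, - 1 / \<alpha>:]" using a0 by simp
  then have p: "p = [:1, - 1 / \<alpha>:] * q" by (simp only: r q_def mult_smult_left mult_smult_right)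
  moreover have "r \<noteq> 0" using r assms(1) by auto
  then have "q \<noteq> 0" using a0 by (simp add: q_def)
  then have "degree p = 1 + degree q" unfolding p using a0 by (subst degree_mult_eq) auto
  moreover have "poly q x = 0 \<Longrightarrow> s \<le> norm x" for x using assms(2) p by simp
  ultimately show thesis using s by (intro that[of \<alpha> q]) auto
qed

text \<open>A factor \<open>1 - x / \<alpha>\<close> with \<open>s \<le> norm \<alpha>\<close>
  enlarges a bound for all coefficients by at most \<open>1 + 1 / s\<close>, which is at most
  \<open>2 / s\<close> as \<open>s \<le> 1\<close>. It has constant term \<open>1\<close>, so
  \<open>coeff p 0\<close> passes unchanged to the cofactor.\<close>

lemma poly_coeff_bound:
  fixes p :: "complex poly"
  assumes "degree p \<le> n" "0 < s" "s \<le> 1" "\<And>x. poly p x = 0 \<Longrightarrow> s \<le> norm x"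
  shows "norm (coeff p i) \<le> (2 / s) ^ n * norm (coeff p 0)" using assms(1,4)
proof (induction n arbitrary: p i)
  case 0
  then show ?case by (cases i) (auto simp: coeff_eq_0)
next
  case (Suc n)
  have s1: "1 \<le> 2 / s" "1 + 1 / s \<le> 2 / s" using assms(2,3) by (auto simp: field_simps)
  show ?case
  proof (cases "degree p = 0")
    case True
    then have "norm (coeff p i) \<le> 1 * norm (coeff p 0)" by (cases i) (auto simp: coeff_eq_0)
    also have "\<dots> \<le> (2 / s) ^ Suc n * norm (coeff p 0)" by (intro mult_right_mono one_le_power s1) auto
    finally show ?thesis .
  next
    case False
    then obtain \<alpha> q where q: "p = [:1, - 1 / \<alpha>:] * q" "s \<le> norm \<alpha>" "degree q = degree p - 1"
        "\<And>x. poly q x = 0 \<Longrightarrow> s \<le> norm x" using poly_split_root[of p s] Suc.prems(2) assms(2) by blast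
    define C where "C = (2 / s) ^ n * norm (coeff q 0)"
    have IH: "norm (coeff q j) \<le> C" for j unfolding C_def using q(3,4) Suc.prems(1) by (intro Suc.IH) auto
    have "C \<ge> 0" using assms(2) by (simp add: C_def)
    have "coeff p i = coeff q i - 1 / \<alpha> * (case i of 0 \<Rightarrow> 0 | Suc j \<Rightarrow> coeff q j)"
      by (simp add: q(1) coeff_pCons split: nat.split)
    moreover have "norm (1 / \<alpha> * (case i of 0 \<Rightarrow> 0 | Suc j \<Rightarrow> coeff q j)) \<le> 1 / s * C"
      unfolding norm_mult using q(2) assms(2) IH \<open>C \<ge> 0\<close>
      by (intro mult_mono) (auto simp: norm_divide split: nat.split intro!: divide_left_mono mult_pos_pos)
    ultimately have "norm (coeff p i) \<le> C + 1 / s * C" using norm_triangle_ineq4 IH[of i] by (smt (verit))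
    also have "\<dots> = (1 + 1 / s) * C" by (simp add: algebra_simps)
    also have "\<dots> \<le> (2 / s) * C" using s1(2) \<open>C \<ge> 0\<close> by (rule mult_right_mono)
    finally show ?thesis by (simp add: C_def q(1))
  qed
qed

text \<open>At \<open>1\<close> each factor \<open>1 - x / \<alpha>\<close> has modulus at least
  \<open>1 - 1 / s\<close>.\<close>

lemma poly_lower_bound:
  fixes p :: "complex poly"
  assumes "degree p \<le> n" "1 < s" "\<And>x. poly p x = 0 \<Longrightarrow> s \<le> norm x"
  shows "(1 - 1 / s) ^ n * norm (coeff p 0) \<le> norm (poly p 1)" using assms(1,3)
proof (induction n arbitrary: p)
  case 0
  then show ?case by (auto elim: degree_eq_zeroE)
next
  case (Suc n)
  have s1: "0 \<le> 1 - 1 / s" "1 - 1 / s \<le> 1" using assms(2) by auto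
  show ?case
  proof (cases "degree p = 0")
    case True
    have "(1 - 1 / s) ^ Suc n * norm (coeff p 0) \<le> 1 * norm (coeff p 0)" by (intro mult_right_mono power_le_one s1) auto
    then show ?thesis using True by (auto elim: degree_eq_zeroE)
  next
    case False
    then obtain \<alpha> q where q: "p = [:1, - 1 / \<alpha>:] * q" "s \<le> norm \<alpha>" "degree q = degree p - 1"
        "\<And>x. poly q x = 0 \<Longrightarrow> s \<le> norm x"
      using poly_split_root[of p s] Suc.prems(2) assms(2) by (metis gr0I less_trans zero_less_one)
    have "1 - 1 / s \<le> 1 - norm (1 / \<alpha>)"
      using q(2) assms(2) by (auto simp: norm_divide intro!: divide_left_mono mult_pos_pos)
    also have "\<dots> \<le> norm (1 - 1 / \<alpha>)" by (metis norm_one norm_triangle_ineq2)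
    finally have 1: "1 - 1 / s \<le> norm (1 - 1 / \<alpha>)" .
    have "(1 - 1 / s) ^ Suc n * norm (coeff p 0) = (1 - 1 / s) * ((1 - 1 / s) ^ n * norm (coeff q 0))" by (simp add: q(1))
    also have "\<dots> \<le> norm (1 - 1 / \<alpha>) * norm (poly q 1)"
      using s1 q(3,4) Suc.prems(1) by (intro mult_mono 1 Suc.IH) auto
    also have "\<dots> = norm (poly p 1)" by (simp add: q(1) norm_mult algebra_simps flip: norm_mult)
    finally show ?thesis .
  qed
qed

lemma entire_poly_growth:
  assumes "f holomorphic_on UNIV" "\<And>x. norm (f x) \<le> K * (1 + norm x) ^ M"
  shows "\<exists>q. degree q \<le> M \<and> (\<forall>x. f x = poly q x)"
proof -
  have "norm (f z) \<le> (K * 2 ^ M) * norm z ^ M" if "1 \<le> norm z" for z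
  proof -
    have "norm (f 0) \<le> K" using assms(2)[of 0] by simp
    then have "K \<ge> 0" using norm_ge_zero order.trans by blast
    then have "K * (1 + norm z) ^ M \<le> K * (2 * norm z) ^ M" using that by (intro mult_left_mono power_mono) auto
    then show ?thesis using assms(2)[of z] by (simp add: power_mult_distrib ac_simps)
  qed
  from Liouville_polynomial[OF assms(1) this]
  have f: "f x = (\<Sum>k\<le>M. (deriv ^^ k) f 0 / fact k * x ^ k)" for x by blast
  show ?thesis by (rule exI[of _ "\<Sum>k\<le>M. monom ((deriv ^^ k) f 0 / fact k) k"])
       (auto simp: f poly_sum poly_monom intro!: degree_sum_le order.trans[OF degree_monom_le])
qed

text \<open>The estimate makes every zero of \<open>\<beta>\<close> a zero of \<open>b\<close>, and
  it persists when a common linear factor is removed; at the removed point it holds by continuity.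
  When \<open>\<beta>\<close> has become constant, Liouville's theorem bounds the degree.\<close>

lemma poly_division_growth:
  fixes b \<beta> :: "complex poly"
  assumes "\<beta> \<noteq> 0" "\<And>x. norm (poly b x) \<le> K * (1 + norm x) ^ M * norm (poly \<beta> x)"
  shows "\<exists>q. b = \<beta> * q \<and> degree q \<le> M" using assms
proof (induction "degree \<beta>" arbitrary: b \<beta>)
  case 0
  then obtain c where c: "\<beta> = [:c:]" "c \<noteq> 0" by (metis degree_eq_zeroE pCons_0_0)
  define q where "q = smult (1 / c) b"
  have "norm (poly q x) \<le> K * (1 + norm x) ^ M" for x using 0(3)[of x] c by (simp add: q_def norm_divide divide_le_eq)
  then obtain q' where "degree q' \<le> M" "\<And>x. poly q x = poly q' x"
    using entire_poly_growth[of "poly q" K M] poly_holomorphic_on[OF holomorphic_on_ident, of q UNIV] by auto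
  then have "degree q \<le> M" by (metis poly_eqI_circle)
  moreover have "b = \<beta> * q" using c by (simp add: q_def)
  ultimately show ?case by blast
next
  case (Suc n)
  then have "\<not> constant (poly \<beta>)" by (simp add: constant_degree)
  then obtain \<alpha> where a: "poly \<beta> \<alpha> = 0" using fundamental_theorem_of_algebra by blast
  then have "poly b \<alpha> = 0" using Suc.prems(2)[of \<alpha>] by simp
  then obtain b' where b': "b = [:- \<alpha>, 1:] * b'" by (metis dvdE poly_eq_0_iff_dvd)
  obtain \<beta>' where \<beta>': "\<beta> = [:- \<alpha>, 1:] * \<beta>'" using a by (metis dvdE poly_eq_0_iff_dvd)
  have "\<beta>' \<noteq> 0" using \<beta>' Suc.prems(1) by auto
  then have "degree \<beta> = 1 + degree \<beta>'" unfolding \<beta>' by (subst degree_mult_eq) auto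
  then have "n = degree \<beta>'" using Suc.hyps(2) by simp
  let ?S = "{x. norm (poly b' x) \<le> K * (1 + norm x) ^ M * norm (poly \<beta>' x)}"
  have "- {\<alpha>} \<subseteq> ?S"
  proof
    fix x assume "x \<in> - {\<alpha>}"
    then have "norm (x - \<alpha>) > 0" by simp
    moreover have ev: "norm (poly b x) = norm (x - \<alpha>) * norm (poly b' x)"
        "norm (poly \<beta> x) = norm (x - \<alpha>) * norm (poly \<beta>' x)"
      by (simp_all add: b' \<beta>' algebra_simps flip: norm_mult)
    have "norm (x - \<alpha>) * norm (poly b' x) \<le> norm (x - \<alpha>) * (K * (1 + norm x) ^ M * norm (poly \<beta>' x))"
      using Suc.prems(2)[of x] unfolding ev by (simp add: ac_simps)
    ultimately show "x \<in> ?S" by simp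
  qed
  moreover have "closed ?S" by (intro closed_Collect_le continuous_intros)
  ultimately have "closure (- {\<alpha>}) \<subseteq> ?S" by (rule closure_minimal)
  then have "norm (poly b' x) \<le> K * (1 + norm x) ^ M * norm (poly \<beta>' x)" for x by (auto simp: closure_complement)
  with Suc.hyps(1)[OF \<open>n = degree \<beta>'\<close> \<open>\<beta>' \<noteq> 0\<close>, of b'] obtain q where "b' = \<beta>' * q" "degree q \<le> M"
    by blast
  then show ?case by (intro exI[of _ q]) (simp only: b' \<beta>' mult.assoc simp_thms)
qed

lemma max_modulus_disc:
  assumes "continuous_on (cball 0 r) f" "f holomorphic_on ball 0 r"
    and "\<And>x. norm x = r \<Longrightarrow> norm (f x) \<le> C" "norm x \<le> r" "0 < r"
  shows "norm (f (x::complex)) \<le> C"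
proof (rule maximum_modulus_frontier[of f "cball 0 r"])
  show "norm (f z) \<le> C" if "z \<in> frontier (cball 0 r)" for z using that assms(3,5) by (simp add: frontier_cball)
qed (use assms in auto)

text \<open>Zeros of \<open>b\<close> on the circle obstruct the maximum principle. They are zeros
  of \<open>a\<close> too and can be divided out; the moduli still agree at the removed point, since
  the circle has no isolated points.\<close>

lemma poly_le_in_disc:
  fixes a b :: "complex poly"
  assumes "\<And>x. norm x < 1 \<Longrightarrow> poly b x \<noteq> 0" "\<And>x. norm x = 1 \<Longrightarrow> norm (poly a x) = norm (poly b x)"
    and "norm x < 1"
  shows "norm (poly a x) \<le> norm (poly b x)" using assms
proof (induction "degree b" arbitrary: a b rule: less_induct)
  case less
  show ?case
  proof (cases "\<exists>\<alpha>. norm \<alpha> = 1 \<and> poly b \<alpha> = 0")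
    case False
    then have nz: "poly b x \<noteq> 0" if "norm x \<le> 1" for x using that less.prems(1)[of x] by (cases "norm x = 1") auto
    have "norm (poly a x / poly b x) \<le> 1"
    proof (rule max_modulus_disc[of 1 "\<lambda>x. poly a x / poly b x"])
      show "continuous_on (cball 0 1) (\<lambda>x. poly a x / poly b x)" by (intro continuous_intros) (use nz in auto)
      show "(\<lambda>x. poly a x / poly b x) holomorphic_on ball 0 1" by (intro holomorphic_intros) (use nz in auto)
      show "norm (poly a x / poly b x) \<le> 1" if "norm x = 1" for x
        using less.prems(2)[OF that] nz[of x] that by (simp add: norm_divide)
    qed (use less.prems(3) in auto)
    then show ?thesis using nz[of x] less.prems(3) by (simp add: norm_divide divide_le_eq_1)
  next
    case True
    then obtain \<alpha> where \<alpha>: "norm \<alpha> = 1" "poly b \<alpha> = 0" by blast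
    then have "poly a \<alpha> = 0" using less.prems(2)[of \<alpha>] by simp
    then obtain a' where a': "a = [:- \<alpha>, 1:] * a'" by (metis dvdE poly_eq_0_iff_dvd)
    obtain b' where b': "b = [:- \<alpha>, 1:] * b'" using \<alpha>(2) by (metis dvdE poly_eq_0_iff_dvd)
    have "b' \<noteq> 0" using b' less.prems(1)[of 0] by auto
    then have "degree b = 1 + degree b'" unfolding b' by (subst degree_mult_eq) auto
    then have deg: "degree b' < degree b" by simp
    have ev: "norm (poly a y) = norm (y - \<alpha>) * norm (poly a' y)" "norm (poly b y) = norm (y - \<alpha>) * norm (poly b' y)" for y
      by (simp_all add: a' b' algebra_simps flip: norm_mult)
    let ?S = "{y. norm (poly a' y) = norm (poly b' y)}"
    have "sphere 0 1 - {\<alpha>} \<subseteq> ?S"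
    proof
      fix y assume y: "y \<in> sphere 0 1 - {\<alpha>}"
      then have "norm (y - \<alpha>) * norm (poly a' y) = norm (y - \<alpha>) * norm (poly b' y)"
        using less.prems(2)[of y] unfolding ev by simp
      then show "y \<in> ?S" using y by simp
    qed
    moreover have "closed ?S" by (intro closed_Collect_eq continuous_intros)
    ultimately have cl: "closure (sphere 0 1 - {\<alpha>}) \<subseteq> ?S" by (rule closure_minimal)
    have "\<alpha> \<in> closure (sphere 0 1 - {\<alpha>})"
    proof -
      have "\<alpha> islimpt sphere 0 1" using infinite_circle_arc[OF \<alpha>(1)] by (simp add: islimpt_eq_infinite_ball)
      then show ?thesis using islimpt_punctured[of \<alpha> "sphere 0 1"] by (simp add: closure_def)
    qed
    with cl have eq: "norm (poly a' y) = norm (poly b' y)" if "norm y = 1" for y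
      using that less.prems(2)[OF that] ev by (cases "y = \<alpha>") auto
    have "norm (poly a' x) \<le> norm (poly b' x)" by (rule less.hyps[OF deg _ eq]) (use less.prems(1,3) b' in auto)
    then show ?thesis unfolding ev by (intro mult_left_mono) auto
  qed
qed

section \<open>Finite Blaschke products\<close>

lemma norm_one_minus_cnj_circle: "norm x = 1 \<Longrightarrow> norm (1 - cnj \<alpha> * x) = norm (x - \<alpha>)"
proof -
  assume "norm x = 1"
  then have "x * cnj x = 1" using complex_norm_square[of x] by simp
  then have "1 - cnj \<alpha> * x = x * cnj (x - \<alpha>)" by (simp add: algebra_simps)
  then show ?thesis using \<open>norm x = 1\<close> by (metis complex_mod_cnj mult_1 norm_mult)
qed

text \<open>The poles of a Blaschke product are the reflections \<open>1 / cnj \<alpha>\<close> of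
  its zeros. When the zeros satisfy \<open>norm \<alpha> < r\<close>, the poles have modulus at
  least \<open>1 / r\<close>.\<close>

definition disc_fraction :: "real \<Rightarrow> nat \<Rightarrow> (complex \<Rightarrow> complex) \<Rightarrow> complex poly \<Rightarrow> complex poly \<Rightarrow> bool" where
  "disc_fraction r N \<phi> A B \<longleftrightarrow> degree A \<le> N \<and> degree B \<le> N \<and> B \<noteq> 0 \<and>
     (\<forall>x. norm x < 1 \<longrightarrow> poly B x * \<phi> x = poly A x) \<and> (\<forall>x. poly B x = 0 \<longrightarrow> 1 / r \<le> norm x)"

text \<open>Zeros are divided out one at a time; each of them lowers the modulus of the quotient at the
  fixed point \<open>(1 + r) / 2\<close> by a factor bounded away from \<open>1\<close>, which bounds their number.\<close>

lemma finite_Blaschke: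
  assumes r0: "0 < r" "r < 1"
  shows "\<exists>N. \<forall>\<phi>. continuous_on (cball 0 1) \<phi> \<longrightarrow> \<phi> holomorphic_on ball 0 1 \<longrightarrow>
    (\<forall>x. norm x = 1 \<longrightarrow> norm (\<phi> x) = 1) \<longrightarrow> (\<forall>x. r \<le> norm x \<longrightarrow> norm x \<le> 1 \<longrightarrow> 1 / 2 \<le> norm (\<phi> x)) \<longrightarrow>
    (\<exists>A B. disc_fraction r N \<phi> A B)"
proof -
  \<comment> \<open>Beyond \<open>r\<close> the lower bound \<open>1 / 2\<close> for
    \<open>\<phi>\<close> applies, and below \<open>1\<close> the Blaschke factors have modulus less
    than \<open>1\<close>. The circle of this radius also separates the zeros from the unit
    circle.\<close>
  define s where "s = (1 + r) / 2"
  define r1 where "r1 = complex_of_real s"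
  have s: "r < s" "s < 1" "0 < s" using r0 by (auto simp: s_def)
  have nr1: "norm r1 = s" using s by (simp add: r1_def)
  have nz: "1 - cnj \<alpha> * x \<noteq> 0" if "norm \<alpha> < 1" "norm x \<le> 1" for \<alpha> x
  proof -
    have "norm (cnj \<alpha> * x) < 1" using that by (simp add: norm_mult le_less_trans[OF mult_left_le])
    then show ?thesis by auto
  qed
  define M where "M \<alpha> = norm ((r1 - \<alpha>) / (1 - cnj \<alpha> * r1))" for \<alpha>
  have contM: "continuous_on (cball 0 r) M" unfolding M_def using nz[of _ r1] nr1 s r0 by (intro continuous_intros) auto
  have M1: "M \<alpha> < 1" if "norm \<alpha> \<le> r" for \<alpha>
    using Moebius_function_norm_lt_1[of \<alpha> r1 0] that s nr1 r0 by (simp add: M_def Moebius_function_def)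
  obtain \<alpha>0 where \<alpha>0: "norm \<alpha>0 \<le> r" "\<And>\<alpha>. norm \<alpha> \<le> r \<Longrightarrow> M \<alpha> \<le> M \<alpha>0"
    using continuous_attains_sup[OF _ _ contM] r0 by auto
  define \<rho> where "\<rho> = M \<alpha>0"
  have \<rho>: "0 \<le> \<rho>" "\<rho> < 1" using M1[OF \<alpha>0(1)] by (auto simp: \<rho>_def M_def)
  \<comment> \<open>With \<open>n\<close> zeros split off, \<open>norm (\<phi> r1)\<close> is at
    most \<open>\<rho> ^ n\<close>, but it is at least \<open>1 / 2\<close>.\<close>
  obtain N where N: "\<rho> ^ N < 1 / 2" using real_arch_pow_inv[OF _ \<rho>(2), of "1/2"] by auto
  show ?thesis
  proof (rule exI[of _ N], intro allI impI)
    fix \<phi> :: "complex \<Rightarrow> complex"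
    assume cont: "continuous_on (cball 0 1) \<phi>" and hol: "\<phi> holomorphic_on ball 0 1"
      and uni': "\<forall>x. norm x = 1 \<longrightarrow> norm (\<phi> x) = 1"
      and low': "\<forall>x. r \<le> norm x \<longrightarrow> norm x \<le> 1 \<longrightarrow> 1 / 2 \<le> norm (\<phi> x)"
    note uni = uni'[rule_format] and low = low'[rule_format]
    \<comment> \<open>The state after \<open>n\<close> zeros have been split off:
      \<open>A / B\<close> is the partial Blaschke product and \<open>h\<close> the remaining
      factor, again unimodular on the circle. The last clause is the count at
      \<open>r1\<close>.\<close>
    define St where "St n A B h \<longleftrightarrow> degree A \<le> n \<and> degree B \<le> n \<and> B \<noteq> 0 \<and> (\<forall>x. poly B x = 0 \<longrightarrow> 1 / r \<le> norm x) \<and>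
       continuous_on (cball 0 1) h \<and> h holomorphic_on ball 0 1 \<and> (\<forall>x. norm x = 1 \<longrightarrow> norm (h x) = 1) \<and>
       (\<forall>x. norm x \<le> 1 \<longrightarrow> poly B x * \<phi> x = poly A x * h x) \<and> norm (poly A r1) \<le> \<rho> ^ n * norm (poly B r1)" for n A B h
    have StD: "degree A \<le> n" "degree B \<le> n" "B \<noteq> 0" "\<And>x. poly B x = 0 \<Longrightarrow> 1 / r \<le> norm x"
        "continuous_on (cball 0 1) h" "h holomorphic_on ball 0 1" "\<And>x. norm x = 1 \<Longrightarrow> norm (h x) = 1"
        "\<And>x. norm x \<le> 1 \<Longrightarrow> poly B x * \<phi> x = poly A x * h x" "norm (poly A r1) \<le> \<rho> ^ n * norm (poly B r1)"
      if "St n A B h" for n A B h using that unfolding St_def by blast+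
    have StN: "n \<le> N" if St: "St n A B h" for n A B h
    proof -
      note h = StD[OF St]
      have h1: "norm (h r1) \<le> 1" by (rule max_modulus_disc[OF h(5,6)]) (use h(7) nr1 s in auto)
      have "1 < 1 / r" using r0 by simp
      then have B0: "norm (poly B r1) > 0" using h(4)[of r1] nr1 s by auto
      have "norm (poly B r1) * (1 / 2) \<le> norm (poly B r1) * norm (\<phi> r1)"
        using low[of r1] nr1 s by (intro mult_left_mono) auto
      also have "\<dots> = norm (poly A r1) * norm (h r1)" using h(8)[of r1] nr1 s by (simp flip: norm_mult)
      also have "\<dots> \<le> (\<rho> ^ n * norm (poly B r1)) * 1" using h(9) h1 \<rho> by (intro mult_mono) auto
      finally have *: "1 / 2 \<le> \<rho> ^ n" using B0 by (simp add: mult.commute)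
      show ?thesis
      proof (rule ccontr)
        assume "\<not> n \<le> N"
        then have "\<rho> ^ n \<le> \<rho> ^ N" using \<rho> by (intro power_decreasing) auto
        then show False using * N by simp
      qed
    qed
    have St0: "St 0 1 1 \<phi>" unfolding St_def using cont hol uni by auto
    have "\<exists>n. (\<exists>A B h. St n A B h) \<and> (\<nexists>A B h. St (Suc n) A B h)"
    proof (rule ccontr)
      assume no: "\<not> ?thesis"
      have "\<exists>A B h. St n A B h" for n by (induction n) (use St0 no in blast)+
      then show False using StN[of "Suc N"] by fastforce
    qed
    then obtain n A B h where n: "St n A B h" "\<And>A B h. \<not> St (Suc n) A B h" by blast
    note h = StD[OF n(1)]
    have hnz: "h \<alpha> \<noteq> 0" if \<alpha>: "norm \<alpha> < 1" for \<alpha>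
    proof
      assume h0: "h \<alpha> = 0"
      have "1 < 1 / r" using r0 by simp
      then have "poly B \<alpha> \<noteq> 0" using h(4)[of \<alpha>] \<alpha> by auto
      then have "\<phi> \<alpha> = 0" using h(8)[of \<alpha>] h0 \<alpha> by simp
      then have \<alpha>r: "norm \<alpha> < r" using low[of \<alpha>] \<alpha> by (cases "r \<le> norm \<alpha>") auto
      define D where "D x = (if x = \<alpha> then deriv h \<alpha> else (h x - h \<alpha>) / (x - \<alpha>))" for x
      define g where "g x = D x * (1 - cnj \<alpha> * x)" for x
      have D: "(x - \<alpha>) * D x = h x" for x using h0 by (simp add: D_def)
      have holD: "D holomorphic_on ball 0 1"
        unfolding D_def[abs_def] by (rule pole_lemma[OF h(6)]) (use \<alpha> in \<open>simp add: interior_open\<close>)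
      \<comment> \<open>On the circle \<open>h\<close> is merely continuous, so two arguments are
        glued: \<open>D\<close> is holomorphic inside, and in the annulus it is a quotient whose
        denominator does not vanish.\<close>
      have "continuous_on (cball 0 s \<union> (cball 0 1 - ball 0 s)) D"
      proof (rule continuous_on_closed_Un)
        show "continuous_on (cball 0 s) D"
          by (rule continuous_on_subset[OF holomorphic_on_imp_continuous_on[OF holD]]) (use s in auto)
        have "continuous_on (cball 0 1 - ball 0 s) (\<lambda>x. (h x - h \<alpha>) / (x - \<alpha>))"
          using \<alpha>r s by (intro continuous_intros continuous_on_subset[OF h(5)]) auto
        then show "continuous_on (cball 0 1 - ball 0 s) D"
          by (rule continuous_on_eq) (use \<alpha>r s in \<open>auto simp: D_def\<close>)
      qed (auto intro: closed_Diff)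
      moreover have "cball 0 s \<union> (cball 0 1 - ball 0 s) = cball (0::complex) 1" using s by auto
      ultimately have contD: "continuous_on (cball 0 1) D" by simp
      have "St (Suc n) (A * [:- \<alpha>, 1:]) (B * [:1, - cnj \<alpha>:]) g" unfolding St_def
      proof (intro conjI allI impI)
        show "degree (A * [:- \<alpha>, 1:]) \<le> Suc n" using degree_mult_le[of A "[:- \<alpha>, 1:]"] h(1) by simp
        show "degree (B * [:1, - cnj \<alpha>:]) \<le> Suc n"
          using degree_mult_le[of B "[:1, - cnj \<alpha>:]"] h(2) by (simp split: if_splits)
        show "B * [:1, - cnj \<alpha>:] \<noteq> 0" using h(3) by (simp only: mult_eq_0_iff) simp
        show "1 / r \<le> norm x" if "poly (B * [:1, - cnj \<alpha>:]) x = 0" for x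
        proof (cases "poly B x = 0")
          case False
          then have x: "1 - x * cnj \<alpha> = 0" using that by simp
          then have n1: "norm x * norm \<alpha> = 1" by (metis complex_mod_cnj eq_iff_diff_eq_0 norm_mult norm_one)
          then have "norm \<alpha> > 0" by (metis mult_zero_right norm_ge_zero order_le_less zero_neq_one)
          then have "norm x = 1 / norm \<alpha>" using n1 by (simp add: field_simps)
          also have "\<dots> \<ge> 1 / r" using \<alpha>r \<open>norm \<alpha> > 0\<close> r0 by (intro divide_left_mono) auto
          finally show ?thesis .
        qed (use h(4) in auto)
        show "continuous_on (cball 0 1) g" unfolding g_def by (intro continuous_intros contD)
        show "g holomorphic_on ball 0 1" unfolding g_def by (intro holomorphic_intros holD)
        show "norm (g x) = 1" if x: "norm x = 1" for x
        proof -
          have "norm (g x) = norm ((x - \<alpha>) * D x)" by (simp add: g_def norm_mult norm_one_minus_cnj_circle[OF x])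
          then show ?thesis using D h(7)[OF x] by simp
        qed
        show "poly (B * [:1, - cnj \<alpha>:]) x * \<phi> x = poly (A * [:- \<alpha>, 1:]) x * g x" if x: "norm x \<le> 1" for x
        proof -
          have "poly (B * [:1, - cnj \<alpha>:]) x * \<phi> x = (1 - cnj \<alpha> * x) * (poly B x * \<phi> x)"
            by (simp add: algebra_simps)
          also have "\<dots> = (1 - cnj \<alpha> * x) * (poly A x * ((x - \<alpha>) * D x))" using h(8)[OF x] D by simp
          finally show ?thesis by (simp add: g_def algebra_simps)
        qed
        have "norm (r1 - \<alpha>) \<le> \<rho> * norm (1 - cnj \<alpha> * r1)"
          using \<alpha>0(2)[of \<alpha>, folded \<rho>_def] \<alpha>r nz[of \<alpha> r1] \<alpha> nr1 s
          by (simp add: M_def norm_divide divide_le_eq)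
        then have "norm (poly A r1) * norm (r1 - \<alpha>) \<le> (\<rho> ^ n * norm (poly B r1)) * (\<rho> * norm (1 - cnj \<alpha> * r1))"
          using h(9) \<rho> by (intro mult_mono) auto
        then show "norm (poly (A * [:- \<alpha>, 1:]) r1) \<le> \<rho> ^ Suc n * norm (poly (B * [:1, - cnj \<alpha>:]) r1)"
          by (simp add: norm_mult algebra_simps flip: norm_mult)
      qed
      then show False using n(2) by simp
    qed
    have hnz': "h x \<noteq> 0" if "norm x \<le> 1" for x using hnz[of x] h(7)[of x] that by (cases "norm x = 1") auto
    have hle: "norm (h x) \<le> 1" if "norm x \<le> 1" for x by (rule max_modulus_disc[OF h(5,6)]) (use that h(7) in auto)
    \<comment> \<open>Free of zeros, both \<open>h\<close> and its inverse obey the maximum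
      principle; so \<open>norm (h 0)\<close> is the maximal value \<open>1\<close> and
      \<open>h\<close> is constant in the disc.\<close>
    have "norm (inverse (h 0)) \<le> 1" by (rule max_modulus_disc[of 1 "\<lambda>x. inverse (h x)"])
         (use h(5,6,7) hnz' in \<open>auto intro!: continuous_intros holomorphic_intros simp: norm_inverse\<close>)
    then have "1 \<le> norm (h 0)" using hnz'[of 0] by (simp add: norm_inverse inverse_le_1_iff)
    then have "h constant_on ball 0 1"
      using hle by (intro maximum_modulus_principle[OF h(6), of "ball 0 1" 0]) (auto intro: order.trans[of _ 1])
    then obtain c where c: "\<And>x. norm x < 1 \<Longrightarrow> h x = c" by (auto simp: constant_on_def)
    have "n \<le> N" using StN n(1) by blast
    show "\<exists>A B. disc_fraction r N \<phi> A B"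
      unfolding disc_fraction_def by (rule exI[of _ "smult c A"], rule exI[of _ B])
         (use h(1-4,8) c \<open>n \<le> N\<close> in \<open>auto intro: order.trans[OF degree_smult_le]\<close>)
  qed
qed

section \<open>The boundary measure\<close>

definition cisv :: "real^'n \<Rightarrow> complex^'n" where
  "cisv x = (\<chi> i. cis (2 * pi * x $ i))"

lemma continuous_cisv [continuous_intros]:
  "continuous_on A f \<Longrightarrow> continuous_on A (\<lambda>x. cisv (f x))" unfolding cisv_def by (intro continuous_intros)

lemma cisv_torus: "cisv x \<in> torus" by (simp add: cisv_def torus_def)

lemma cisv_surj:
  assumes "z \<in> torus"
  obtains x where "x \<in> cbox 0 (vec 1 :: real^'n)" "cisv x = z"
proof -
  have "\<exists>r. 0 \<le> r \<and> r \<le> 1 \<and> cis (2 * pi * r) = z $ i" for i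
  proof -
    have n: "norm (z $ i) = 1" using assms by (simp add: torus_def)
    have "z $ i \<noteq> 0" using n by auto
    then have "cis (Arg2pi (z $ i)) = z $ i" using n Arg2pi_eq[of "z $ i"] by (simp add: cis_conv_exp mult.commute)
    then show ?thesis using Arg2pi_ge_0[of "z $ i"] Arg2pi_lt_2pi[of "z $ i"]
      by (intro exI[of _ "Arg2pi (z $ i) / (2 * pi)"]) auto
  qed
  then obtain r where r: "\<And>i. 0 \<le> r i \<and> r i \<le> 1 \<and> cis (2 * pi * r i) = z $ i" by metis
  show thesis by (rule that[of "\<chi> i. r i"]) (use r in \<open>auto simp: cisv_def vec_eq_iff mem_box_cart\<close>)
qed

lemma unit_cube_emeasure: "emeasure lborel (cbox 0 (vec 1 :: real^'n)) = 1"
proof -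
  have "(vec 1 :: real^'n) \<bullet> b = 1" if "b \<in> Basis" for b
    using that by (auto simp: Basis_vec_def inner_axis simp del: vec_1)
  then show ?thesis by (simp add: emeasure_lborel_cbox_eq del: vec_1)
qed

text \<open>Integrate the indicator of the shifted zero set over \<open>s\<close> and
  \<open>x\<close>. By translation invariance the result is the measure of the zero set; in the
  other order each inner integral is over a finite set.\<close>

lemma AE_lborel_nonzero_by_translation:
  fixes h :: "'a::euclidean_space \<Rightarrow> complex"
  assumes h: "continuous_on UNIV h"
    and fin: "\<And>x. finite {s\<in>{0..<1}. h (s *\<^sub>R v + x) = 0}"
  shows "AE x in lborel. h x \<noteq> 0"
proof -
  define Z where "Z = {x. h x = 0}"
  have "closed Z" unfolding Z_def by (intro closed_Collect_eq h continuous_intros)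
  then have Z [measurable]: "Z \<in> sets borel" by simp
  have tr: "(\<integral>\<^sup>+x. indicator Z (s *\<^sub>R v + x) \<partial>lborel) = emeasure lborel Z" for s
  proof -
    have "emeasure lborel Z = (\<integral>\<^sup>+x. indicator Z x \<partial>lborel)" by simp
    also have "\<dots> = (\<integral>\<^sup>+x. indicator Z x \<partial>(distr lborel borel ((+) (s *\<^sub>R v))))"
      by (simp only: lborel_distr_plus)
    also have "\<dots> = (\<integral>\<^sup>+x. indicator Z (s *\<^sub>R v + x) \<partial>lborel)"
      by (subst nn_integral_distr) auto
    finally show ?thesis by simp
  qed
  have meas: "(\<lambda>(s, x). indicator {0..<1} s * indicator Z (s *\<^sub>R v + x) :: ennreal)
      \<in> borel_measurable (lborel \<Otimes>\<^sub>M lborel)" by measurable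
  have "emeasure lborel Z = (\<integral>\<^sup>+s. indicator {0..<1::real} s * emeasure lborel Z \<partial>lborel)"
    by (simp add: nn_integral_multc)
  also have "\<dots> = (\<integral>\<^sup>+s. (\<integral>\<^sup>+x. indicator {0..<1} s * indicator Z (s *\<^sub>R v + x) \<partial>lborel) \<partial>lborel)"
    by (simp add: nn_integral_cmult tr)
  also have "\<dots> = (\<integral>\<^sup>+x. (\<integral>\<^sup>+s. indicator {0..<1} s * indicator Z (s *\<^sub>R v + x) \<partial>lborel) \<partial>lborel)"
    by (rule lborel_pair.Fubini'[symmetric, of "\<lambda>s x. indicator {0..<1} s * indicator Z (s *\<^sub>R v + x)"]) (rule meas)
  also have "\<dots> = (\<integral>\<^sup>+x. 0 \<partial>(lborel :: 'a measure))"
  proof (rule nn_integral_cong)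
    fix x :: 'a
    let ?S = "{s\<in>{0..<1}. h (s *\<^sub>R v + x) = 0}"
    have "(\<integral>\<^sup>+s. indicator {0..<1} s * indicator Z (s *\<^sub>R v + x) \<partial>lborel) = (\<integral>\<^sup>+s. indicator ?S s \<partial>lborel)"
      by (intro nn_integral_cong) (auto simp: indicator_def Z_def)
    also have "\<dots> = emeasure lborel ?S" using fin[of x] by (intro nn_integral_indicator) (simp add: finite_imp_closed)
    also have "\<dots> = 0" using fin[of x] by (simp add: emeasure_lborel_countable countable_finite)
    finally show "(\<integral>\<^sup>+s. indicator {0..<1} s * indicator Z (s *\<^sub>R v + x) \<partial>lborel) = 0" .
  qed
  finally have "emeasure lborel Z = 0" by simp
  then have "Z \<in> null_sets lborel" by (simp add: null_sets_def)
  then have "AE x in lborel. x \<notin> Z" by (rule AE_not_in)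
  then show ?thesis by (simp add: Z_def)
qed

context weights
begin

lemma measurable_theta [measurable]: "theta \<in> borel_measurable borel"
  by (intro borel_measurable_continuous_onI continuous_intros)

lemma measurable_cisv [measurable]: "cisv \<in> borel_measurable borel"
  by (intro borel_measurable_continuous_onI continuous_intros)

lemma boundary_measure_eq:
  "boundary_measure m t = distr (uniform_measure lborel (cbox 0 (vec 1))) borel (\<lambda>x. theta (cisv x))"
  unfolding boundary_measure_def torus_measure_def cisv_def[symmetric] by (subst distr_distr) (auto simp: o_def)

lemma AE_boundaryD:
  fixes P :: "complex^'n::{finite,linorder} \<Rightarrow> bool"
  assumes "AE q in boundary_measure m t. P q"
  shows "AE x in lborel. x \<in> cbox 0 (vec 1) \<longrightarrow> P (theta (cisv x))"
proof -
  have "AE x in uniform_measure lborel (cbox 0 (vec 1)). P (theta (cisv x))"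
    using assms unfolding boundary_measure_eq by (rule AE_distrD[rotated]) simp
  then show ?thesis by (subst (asm) AE_uniform_measure) (simp_all add: unit_cube_emeasure del: vec_1)
qed

lemma AE_boundaryI:
  fixes P :: "complex^'n::{finite,linorder} \<Rightarrow> bool"
  assumes "{q. P q} \<in> sets borel" "AE x in lborel. P (theta (cisv x))"
  shows "AE q in boundary_measure m t. P q"
proof -
  have "AE x in uniform_measure lborel (cbox 0 (vec 1)). P (theta (cisv x))"
    using assms(2) by (subst AE_uniform_measure) (auto simp: unit_cube_emeasure simp del: vec_1 elim: eventually_mono)
  then show ?thesis unfolding boundary_measure_eq by (subst AE_distr_iff) (use assms(1) in auto)
qed

lemma compact_bdry: "compact (bdry :: (complex^'n::{finite,linorder}) set)"
  unfolding bdry_def by (intro compact_continuous_image compact_torus continuous_intros)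

text \<open>Full measure implies density: the points of the open cube at which \<open>P\<close>
  fails form an open set, and a negligible open set is empty.\<close>

lemma bdry_closed_AE:
  fixes P :: "complex^'n::{finite,linorder} \<Rightarrow> bool"
  assumes cl: "closed {q\<in>bdry. P q}" and ae: "AE q in boundary_measure m t. R q"
    and imp: "\<And>q. q \<in> bdry \<Longrightarrow> R q \<Longrightarrow> P q" and q: "q \<in> bdry"
  shows "P q"
proof (rule ccontr)
  assume nP: "\<not> P q"
  obtain z where z: "q = theta z" "z \<in> torus" using q by (auto simp: bdry_def)
  obtain x where x: "x \<in> cbox 0 (vec 1)" "cisv x = z" using cisv_surj[OF z(2)] .
  have ae': "AE x in lborel. x \<in> cbox 0 (vec 1) \<longrightarrow> R (theta (cisv x))" by (rule AE_boundaryD[OF ae])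
  then obtain N where N: "N \<in> null_sets lborel" "{x. \<not> (x \<in> cbox 0 (vec 1) \<longrightarrow> R (theta (cisv x)))} \<subseteq> N"
    unfolding eventually_ae_filter by auto
  have negN: "negligible N" using N(1) by (simp add: negligible_iff_null_sets null_sets_completionI)
  define W where "W = (\<lambda>x. theta (cisv x)) -` (- {q\<in>bdry. P q})"
  have "open W" unfolding W_def by (intro open_vimage continuous_intros) (use cl in \<open>auto simp: open_Compl\<close>)
  have "x \<in> W" using x z nP by (simp add: W_def)
  have "box 0 (vec 1 :: real^'n::{finite,linorder}) \<noteq> {}" by (simp add: interval_ne_empty_cart)
  then have "x \<in> closure (box 0 (vec 1))" using x(1) closure_box by blast
  then have "W \<inter> box 0 (vec 1) \<noteq> {}" using \<open>open W\<close> \<open>x \<in> W\<close> by (auto simp: closure_iff_nhds_not_empty)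
  moreover have "open (W \<inter> box 0 (vec 1))" using \<open>open W\<close> by (intro open_Int open_box)
  moreover have "W \<inter> box 0 (vec 1) \<subseteq> N"
  proof
    fix y assume y: "y \<in> W \<inter> box 0 (vec 1)"
    have "theta (cisv y) \<in> bdry" using cisv_torus by (auto simp: bdry_def)
    then have "\<not> R (theta (cisv y))" using y imp by (auto simp: W_def)
    moreover have "y \<in> cbox 0 (vec 1)" using y box_subset_cbox by blast
    ultimately show "y \<in> N" using N(2) by blast
  qed
  then have "negligible (W \<inter> box 0 (vec 1))" using negN negligible_subset by blast
  ultimately show False using open_not_negligible by blast
qed

lemma AE_bdry: "AE q in boundary_measure m t. (q :: complex^'n::{finite,linorder}) \<in> bdry"
proof (rule AE_boundaryI)
  show "{q :: 'n cvec. q \<in> bdry} \<in> sets borel" using borel_closed[OF compact_imp_closed[OF compact_bdry]] by simp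
qed (simp add: bdry_def cisv_torus)

text \<open>Translating along the diagonal of the cube acts on the torus by the dilations with unimodular
  factor, and on such an orbit \<open>Q\<close> is a polynomial in that factor with constant term \<open>Q 0\<close>.\<close>

lemma AE_boundary_nonzero:
  fixes Q :: "complex^'n::{finite,linorder} \<Rightarrow> complex"
  assumes "poly_fun Q" "Q 0 \<noteq> 0"
  shows "AE q in boundary_measure m t. Q q \<noteq> 0"
proof (rule AE_boundaryI)
  have "closed {q. Q q = 0}" by (intro closed_Collect_eq poly_fun_continuous assms continuous_intros)
  then have "open {q. Q q \<noteq> 0}" by (simp add: open_closed Compl_eq)
  then show "{q. Q q \<noteq> 0} \<in> sets borel" by simp
  show "AE x in lborel. Q (theta (cisv x)) \<noteq> 0"
  proof (rule AE_lborel_nonzero_by_translation[where v = "vec 1"])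
    show "continuous_on UNIV (\<lambda>x :: real^'n::{finite,linorder}. Q (theta (cisv x)))"
      by (rule continuous_on_compose2[OF poly_fun_continuous[OF assms(1), of UNIV]]) (auto intro!: continuous_intros)
    fix x :: "real^'n::{finite,linorder}"
    have *: "theta (cisv (s *\<^sub>R vec 1 + x)) = dil (cis (2 * pi * s)) (theta (cisv x))" for s
    proof -
      have "cisv (s *\<^sub>R vec 1 + x) = cis (2 * pi * s) *s cisv x" by (simp add: cisv_def vec_eq_iff cis_mult algebra_simps)
      then show ?thesis by (simp add: dil_theta)
    qed
    obtain q where q: "\<And>c. Q (dil c (theta (cisv x))) = poly q c"
      using poly_fun_curve[OF assms(1), of "\<lambda>c. dil c (theta (cisv x))"] dil_curve by blast
    have "poly q 0 \<noteq> 0" using q[of 0] assms(2) by simp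
    then have fin: "finite {c. poly q c = 0}" by (intro poly_roots_finite) auto
    have "inj_on (\<lambda>s. cis (2 * pi * s)) {0..<1}"
    proof (rule inj_onI)
      fix s s' :: real assume s: "s \<in> {0..<1}" "s' \<in> {0..<1}" "cis (2 * pi * s) = cis (2 * pi * s')"
      then have "exp (\<i> * (2 * pi * s)) = exp (\<i> * (2 * pi * s'))" by (simp add: cis_conv_exp)
      then obtain k :: int where "\<i> * (2 * pi * s) = \<i> * (2 * pi * s') + (of_int (2 * k) * pi) * \<i>"
        by (auto simp: exp_eq)
      then have "\<i> * complex_of_real (2 * pi * s) = \<i> * complex_of_real (2 * pi * (s' + k))" by (simp add: algebra_simps)
      then have "2 * pi * s = 2 * pi * (s' + k)" by (simp only: mult_cancel_left of_real_eq_iff) simp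
      then have "s = s' + k" by simp
      moreover have "\<bar>s - s'\<bar> < 1" using s by auto
      ultimately have "\<bar>real_of_int k\<bar> < 1" by simp
      then have "k = 0" by linarith
      then show "s = s'" using \<open>s = s' + k\<close> by simp
    qed
    then have "finite ((\<lambda>s. cis (2 * pi * s)) -` {c. poly q c = 0} \<inter> {0..<1})"
      by (rule finite_vimage_IntI[OF fin])
    moreover have "{s\<in>{0..<1}. Q (theta (cisv (s *\<^sub>R vec 1 + x))) = 0} = (\<lambda>s. cis (2 * pi * s)) -` {c. poly q c = 0} \<inter> {0..<1}"
      unfolding * q by auto
    ultimately show "finite {s\<in>{0..<1}. Q (theta (cisv (s *\<^sub>R vec 1 + x))) = 0}" by simp
  qed
qed

text \<open>The place where boundary values enter the algebra: a radial identity passes to the limit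
  almost everywhere, and continuity of \<open>X\<close> and \<open>Y\<close> extends the equality of
  moduli to all boundary points. \<open>X'\<close> and \<open>Y'\<close> are kept general because
  they will be polynomials in the dilation parameter whose coefficients stay at a boundary
  point.\<close>

lemma inner_modulus:
  fixes f :: "complex^'n::{finite,linorder} \<Rightarrow> complex"
  assumes "inner_fun m t f" "continuous_on UNIV X" "continuous_on UNIV Y"
    and rel: "\<And>q r. q \<in> bdry \<Longrightarrow> 0 < r \<Longrightarrow> r < 1 \<Longrightarrow> X' q r = Y' q r * f (dil (of_real r) q)"
    and X: "\<And>q. q \<in> bdry \<Longrightarrow> (X' q \<longlongrightarrow> X q) (at_left 1)"
    and Y: "\<And>q. q \<in> bdry \<Longrightarrow> (Y' q \<longlongrightarrow> Y q) (at_left (1::real))"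
    and q: "q \<in> bdry"
  shows "norm (X q) = norm (Y q :: complex)"
proof (rule bdry_closed_AE[where R = "\<lambda>q. \<exists>w. has_boundary_value m t f q w \<and> norm w = 1", OF _ _ _ q])
  have "closed {q. norm (X q) = norm (Y q)}" by (intro closed_Collect_eq continuous_intros assms)
  then have "closed (bdry \<inter> {q. norm (X q) = norm (Y q)})" by (rule closed_Int[OF compact_imp_closed[OF compact_bdry]])
  then show "closed {q\<in>bdry. norm (X q) = norm (Y q)}" by (simp add: Int_def)
  show "AE q in boundary_measure m t. \<exists>w. has_boundary_value m t f q w \<and> norm w = 1"
    using assms(1) by (simp add: inner_fun_def)
  fix q :: "'n cvec"
  assume q: "q \<in> bdry" and "\<exists>w. has_boundary_value m t f q w \<and> norm w = 1"
  then obtain w where w: "((\<lambda>r. f (dil (of_real r) q)) \<longlongrightarrow> w) (at_left 1)" "norm w = 1"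
    by (auto simp: has_boundary_value_def dilate_eq_dil)
  have "((\<lambda>r. Y' q r * f (dil (of_real r) q)) \<longlongrightarrow> Y q * w) (at_left 1)" by (intro tendsto_mult Y q w)
  moreover have "\<forall>\<^sub>F r in at_left 1. Y' q r * f (dil (of_real r) q) = X' q r"
    by (rule eventually_mono[OF eventually_at_left_real[of 0 1]]) (use rel q in auto)
  ultimately have "(X' q \<longlongrightarrow> Y q * w) (at_left 1)" by (rule Lim_transform_eventually)
  then have "X q = Y q * w" using X[OF q] tendsto_unique[of "at_left (1::real)"] by auto
  then show "norm (X q) = norm (Y q)" using w(2) by (simp add: norm_mult)
qed

end

section \<open>Taylor coefficients along the dilations\<close>

lemma has_derivative_vecI:
  assumes "\<And>i. ((\<lambda>x. c x $ i) has_field_derivative d i) (at x)"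
  shows "((c :: complex \<Rightarrow> complex^'n) has_derivative (\<lambda>h. h *s (\<chi> i. d i))) (at x)"
proof (subst has_derivative_componentwise_within, intro ballI)
  fix b :: "complex^'n" assume "b \<in> Basis"
  then obtain i u where b: "b = axis i u" "u \<in> Basis" by (auto simp: Basis_vec_def)
  have "((\<lambda>x. c x $ i \<bullet> u) has_derivative (\<lambda>h. (d i * h) \<bullet> u)) (at x)"
    using assms[of i] unfolding has_field_derivative_def by (rule has_derivative_inner_left)
  then show "((\<lambda>x. c x \<bullet> b) has_derivative (\<lambda>h. (h *s (\<chi> i. d i)) \<bullet> b)) (at x)"
    by (simp add: b inner_axis mult.commute)
qed

lemma holomorphic_several_compose:
  assumes "holomorphic_several S f" "open X" "\<And>x. x \<in> X \<Longrightarrow> c x \<in> S"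
    and "\<And>i. (\<lambda>x. c x $ i) holomorphic_on X"
  shows "(\<lambda>x. f (c x :: complex^'n)) holomorphic_on X"
proof -
  have "\<exists>f'. ((\<lambda>x. f (c x)) has_field_derivative f') (at x)" if x: "x \<in> X" for x
  proof -
    have "\<forall>i. \<exists>d. ((\<lambda>x. c x $ i) has_field_derivative d) (at x)"
      using assms(2,4) x by (auto simp: holomorphic_on_open)
    then obtain d where d: "\<And>i. ((\<lambda>x. c x $ i) has_field_derivative d i) (at x)" by metis
    obtain D where D: "(f has_derivative D) (at (c x))" "\<And>a v. D (a *s v) = a * D v"
      using assms(1,3) x unfolding holomorphic_several_def by blast
    have "((\<lambda>x. f (c x)) has_derivative (\<lambda>h. D (h *s (\<chi> i. d i)))) (at x)"
      using has_derivative_compose[OF has_derivative_vecI[of c d x, OF d] D(1)] .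
    then show ?thesis
      unfolding D has_field_derivative_def by (auto simp: mult.commute[of _ "D _"] intro!: exI[of _ "D (\<chi> i. d i)"])
  qed
  then show ?thesis using assms(2) by (simp add: holomorphic_on_open)
qed

lemma has_fps_expansion_unique:
  fixes f g :: "complex \<Rightarrow> complex"
  assumes "f has_fps_expansion F" "g has_fps_expansion G" "eventually (\<lambda>z. f z = g z) (nhds 0)"
  shows "F = G"
proof (rule fps_ext)
  fix n
  show "fps_nth F n = fps_nth G n" using fps_nth_fps_expansion[OF assms(1)] fps_nth_fps_expansion[OF assms(2)]
      higher_deriv_cong_ev[OF assms(3) refl] by simp
qed

lemma has_fps_expansion_poly: "poly p has_fps_expansion fps_of_poly (p :: complex poly)" unfolding has_fps_expansion_def by simp

section \<open>Taylor coefficients depending holomorphically on a parameter\<close>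

definition dquot :: "(complex \<Rightarrow> complex) \<Rightarrow> complex \<Rightarrow> complex" where
  "dquot g l = (if l = 0 then deriv g 0 else (g l - g 0) / l)"

lemma dquot_mult: "g l = g 0 + l * dquot g l" by (simp add: dquot_def)

lemma holomorphic_dquot:
  assumes "g holomorphic_on ball 0 r" "r > 0"
  shows "dquot g holomorphic_on ball 0 r"
proof -
  have "(\<lambda>z. if z = 0 then deriv g 0 else (g z - g 0) / (z - 0)) holomorphic_on ball 0 r"
    by (rule pole_lemma[OF assms(1)]) (use assms(2) in \<open>simp add: interior_open\<close>)
  moreover have "dquot g = (\<lambda>z. if z = 0 then deriv g 0 else (g z - g 0) / (z - 0))" by (simp add: dquot_def fun_eq_iff)
  ultimately show ?thesis by simp
qed

text \<open>On the circle of radius \<open>r / 2\<close> the numerator is at most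
  \<open>2 * M\<close>, and the maximum principle carries the bound inside.\<close>

lemma dquot_bound:
  assumes "g holomorphic_on ball 0 r" "r > 0" "\<And>l. norm l < r \<Longrightarrow> norm (g l) \<le> M" "norm l \<le> r / 2"
  shows "norm (dquot g l) \<le> 4 * M / r"
proof (rule max_modulus_disc[of "r / 2" "dquot g"])
  have h: "dquot g holomorphic_on ball 0 r" by (rule holomorphic_dquot[OF assms(1,2)])
  show "continuous_on (cball 0 (r / 2)) (dquot g)"
    using holomorphic_on_imp_continuous_on[OF h] by (rule continuous_on_subset) (use assms(2) in auto)
  show "dquot g holomorphic_on ball 0 (r / 2)" using h by (rule holomorphic_on_subset) (use assms(2) in auto)
  fix x :: complex assume x: "norm x = r / 2"
  then have "x \<noteq> 0" using assms(2) by auto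
  have "norm (g x - g 0) \<le> M + M" by (rule order.trans[OF norm_triangle_ineq4 add_mono]) (use assms x in auto)
  then have "norm (g x - g 0) / (r / 2) \<le> (M + M) / (r / 2)" using assms(2) by (intro divide_right_mono) auto
  also have "\<dots> = 4 * M / r" by simp
  finally show "norm (dquot g x) \<le> 4 * M / r"
    using \<open>x \<noteq> 0\<close> unfolding x[symmetric] by (simp add: dquot_def norm_divide x)
qed (use assms in auto)

lemma fps_expansion_dquot:
  assumes "g holomorphic_on ball 0 r" "r > 0"
  shows "fps_nth (fps_expansion g 0) (Suc j) = fps_nth (fps_expansion (dquot g) 0) j"
proof -
  have 1: "g has_fps_expansion fps_expansion g 0" using assms by (intro has_fps_expansion_fps_expansion[of "ball 0 r"]) auto
  have "dquot g has_fps_expansion fps_expansion (dquot g) 0"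
    using holomorphic_dquot[OF assms] assms(2) by (intro has_fps_expansion_fps_expansion[of "ball 0 r"]) auto
  then have "(\<lambda>l. g 0 + l * dquot g l) has_fps_expansion fps_const (g 0) + fps_X * fps_expansion (dquot g) 0"
    by (intro fps_expansion_intros)
  then have "fps_expansion g 0 = fps_const (g 0) + fps_X * fps_expansion (dquot g) 0"
    by (rule has_fps_expansion_unique[OF 1]) (rule always_eventually, simp flip: dquot_mult)
  then show ?thesis by simp
qed

text \<open>\<open>dquot\<close> shifts the Taylor coefficients, so \<open>j\<close> applications
  reduce to the value at \<open>0\<close>, at the price of half the radius each time. What needs
  proof is that \<open>dquot (G x) 0\<close> is holomorphic in \<open>x\<close>: it is the uniform
  limit of \<open>dquot (G x) (l n)\<close> for \<open>l n\<close> tending to \<open>0\<close>, the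
  error being controlled by a bound for the second quotient.\<close>

lemma holomorphic_Taylor_coeff:
  fixes G :: "complex \<Rightarrow> complex \<Rightarrow> complex"
  assumes "open X" "r > 0" "\<And>x. x \<in> X \<Longrightarrow> G x holomorphic_on ball 0 r"
    and "\<And>l. norm l < r \<Longrightarrow> (\<lambda>x. G x l) holomorphic_on X"
    and "\<And>x l. x \<in> X \<Longrightarrow> norm l < r \<Longrightarrow> norm (G x l) \<le> M"
  shows "(\<lambda>x. fps_nth (fps_expansion (G x) 0) j) holomorphic_on X" using assms
proof (induction j arbitrary: G r M)
  case 0
  have "(\<lambda>x. G x 0) holomorphic_on X" using 0(2,4) by simp
  then show ?case by (simp add: fps_expansion_def)
next
  case (Suc j)
  note hol = Suc.prems(3) and holx = Suc.prems(4) and bd = Suc.prems(5) and r = Suc.prems(2)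
  have bd1: "norm (dquot (G x) l) \<le> 4 * M / r" if "x \<in> X" "norm l \<le> r / 2" for x l
    using dquot_bound[OF hol r bd] that by blast
  have hol1: "dquot (G x) holomorphic_on ball 0 (r / 2)" if "x \<in> X" for x
    using holomorphic_dquot[OF hol[OF that] r] by (rule holomorphic_on_subset) (use r in auto)
  have bd2: "norm (dquot (dquot (G x)) l) \<le> 4 * (4 * M / r) / (r / 2)" if "x \<in> X" "norm l \<le> r / 4" for x l
    by (rule dquot_bound[OF hol1]) (use that r bd1 in auto)
  define C where "C = 4 * (4 * M / r) / (r / 2)"
  have holx1: "(\<lambda>x. dquot (G x) l) holomorphic_on X" if l: "norm l < r" "l \<noteq> 0" for l
    using holx[OF l(1)] holx[of 0] l r by (auto simp: dquot_def intro!: holomorphic_intros)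
  define l where "l n = complex_of_real (r / 4 / Suc n)" for n :: nat
  have ln: "norm (l n) = r / 4 / Suc n" for n using r unfolding l_def norm_of_real by simp
  have ln4: "norm (l n) \<le> r / 4" "l n \<noteq> 0" for n
  proof -
    show "norm (l n) \<le> r / 4" unfolding ln using r by (simp add: divide_le_eq)
    show "l n \<noteq> 0" using r by (simp add: l_def del: of_nat_Suc)
  qed
  have "(\<lambda>x. dquot (G x) 0) holomorphic_on X"
  proof (rule holomorphic_uniform_sequence[OF Suc.prems(1), of "\<lambda>n x. dquot (G x) (l n)"])
    show "(\<lambda>x. dquot (G x) (l n)) holomorphic_on X" for n by (rule holx1) (use ln4[of n] r in auto)
    fix x assume "x \<in> X"
    then obtain d where d: "d > 0" "cball x d \<subseteq> X" using Suc.prems(1) open_contains_cball by blast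
    have "uniform_limit (cball x d) (\<lambda>n x. dquot (G x) (l n)) (\<lambda>x. dquot (G x) 0) sequentially"
    proof (rule uniform_limitI)
      fix e :: real assume e: "e > 0"
      have "(\<lambda>n. C * (r / 4) * (1 / Suc n)) \<longlonglongrightarrow> C * (r / 4) * 0"
        by (intro tendsto_intros) (rule lim_inverse_n'[THEN LIMSEQ_Suc])
      then have "\<forall>\<^sub>F n in sequentially. C * (r / 4) * (1 / Suc n) < e" using e by (intro order_tendstoD(2)) auto
      then show "\<forall>\<^sub>F n in sequentially. \<forall>y\<in>cball x d. dist (dquot (G y) (l n)) (dquot (G y) 0) < e"
      proof eventually_elim
        case (elim n)
        show ?case
        proof
          fix y assume "y \<in> cball x d"
          then have "y \<in> X" using d by auto
          have "dist (dquot (G y) (l n)) (dquot (G y) 0) = norm (l n * dquot (dquot (G y)) (l n))"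
            by (subst dquot_mult[of "dquot (G y)" "l n"]) (simp add: dist_norm)
          also have "\<dots> \<le> norm (l n) * C"
            unfolding norm_mult C_def by (intro mult_left_mono bd2 \<open>y \<in> X\<close> ln4) auto
          also have "\<dots> = C * (r / 4) * (1 / Suc n)" by (simp add: ln)
          finally show "dist (dquot (G y) (l n)) (dquot (G y) 0) < e" using elim by simp
        qed
      qed
    qed
    then show "\<exists>d>0. cball x d \<subseteq> X \<and> uniform_limit (cball x d) (\<lambda>n x. dquot (G x) (l n)) (\<lambda>x. dquot (G x) 0) sequentially"
      using d by blast
  qed
  then have holx2: "(\<lambda>x. dquot (G x) l) holomorphic_on X" if "norm l < r" for l
    using holx1[of l] that by (cases "l = 0") auto
  have "(\<lambda>x. fps_nth (fps_expansion (dquot (G x)) 0) j) holomorphic_on X"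
    by (rule Suc.IH[of "r / 2" "\<lambda>x. dquot (G x)" "4 * M / r"]) (use Suc.prems(1) r hol1 holx2 bd1 in auto)
  then show ?case by (rule holomorphic_transform) (use fps_expansion_dquot[OF hol r] in simp)
qed

lemma norm_upd_le: "norm (upd p i x :: complex^'n) \<le> 2 * norm p + norm x"
proof -
  have "upd p i x = p + axis i (x - p $ i)" by (simp add: vec_eq_iff axis_def)
  moreover have "norm (axis i a :: complex^'n) = norm a" for a
  proof -
    have "(\<Sum>j\<in>UNIV. (norm (axis i a $ j))\<^sup>2) = (\<Sum>j\<in>UNIV. if j = i then (norm a)\<^sup>2 else 0)"
      by (intro sum.cong) (auto simp: axis_def)
    then show ?thesis by (simp add: norm_vec_def L2_set_def)
  qed
  ultimately have "norm (upd p i x) \<le> norm p + norm (x - p $ i)" using norm_triangle_ineq[of p "axis i (x - p $ i)"] by simp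
  also have "norm (x - p $ i) \<le> norm x + norm (p $ i)" by (rule norm_triangle_ineq4)
  also have "norm (p $ i) \<le> norm p" by (rule Finite_Cartesian_Product.norm_nth_le)
  finally show ?thesis by simp
qed

lemma norm_upd_growth: "1 + norm (upd p i x :: complex^'n) \<le> (1 + 2 * norm p) * (1 + norm x)"
proof -
  have "0 \<le> norm x * (norm p * 2)" by simp
  then show ?thesis using norm_upd_le[of p i x] by (simp add: algebra_simps del: zero_le_mult_iff mult_nonneg_nonneg)
qed

context weights
begin

definition taylor :: "(complex^'n::{finite,linorder} \<Rightarrow> complex) \<Rightarrow> nat \<Rightarrow> complex^'n::{finite,linorder} \<Rightarrow> complex" where
  "taylor f j p = fps_nth (fps_expansion (\<lambda>l. f (dil l p)) 0) j"

lemma holomorphic_dil: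
  assumes "holomorphic_several dom f"
  shows "(\<lambda>l. f (dil l p)) holomorphic_on {l. dil l p \<in> dom}"
  by (rule holomorphic_several_compose[OF assms open_dil_dom]) (auto simp: dil_nth intro!: holomorphic_intros)

lemma has_fps_expansion_taylor:
  assumes "holomorphic_several dom f"
  shows "(\<lambda>l. f (dil l p)) has_fps_expansion Abs_fps (\<lambda>j. taylor f j p)"
proof -
  have "(\<lambda>l. f (dil l p)) has_fps_expansion fps_expansion (\<lambda>l. f (dil l p)) 0"
    by (rule has_fps_expansion_fps_expansion[OF open_dil_dom _ holomorphic_dil[OF assms]]) (simp add: zero_in_dom)
  moreover have "Abs_fps (\<lambda>j. taylor f j p) = fps_expansion (\<lambda>l. f (dil l p)) 0"
    by (simp add: fps_eq_iff taylor_def)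
  ultimately show ?thesis by simp
qed

text \<open>Cauchy's estimate on the disc of radius \<open>e / (1 + norm p)\<close> bounds the
  coefficient by a multiple of \<open>(1 + norm p) ^ j\<close>. On each coordinate line it is
  entire, hence a polynomial of degree at most \<open>j\<close>, and separate polynomials of bounded
  degree glue. It is defined at every \<open>p\<close>, since small dilations move \<open>p\<close>
  into the domain.\<close>

lemma poly_fun_taylor:
  fixes f :: "complex^'n::{finite,linorder} \<Rightarrow> complex"
  assumes "f \<in> H_infinity dom"
  shows "poly_fun (taylor f j)"
proof -
  have hol: "holomorphic_several dom f" and "bounded (f ` dom)" using assms by (auto simp: H_infinity_def)
  then obtain M where M: "\<And>p. p \<in> dom \<Longrightarrow> norm (f p) \<le> M" by (auto simp: bounded_iff)
  have M0: "M \<ge> 0" using M[OF zero_in_dom] norm_ge_zero order.trans by blast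
  obtain e where e: "0 < e" "e \<le> 1"
    "\<And>c (p :: complex^'n::{finite,linorder}). norm c * (1 + norm p) \<le> e \<Longrightarrow> dil c p \<in> dom"
    using dil_dom_small[where 'n='n] by blast
  have growth: "norm (taylor f j p) \<le> M * ((1 + norm p) / e) ^ j" for p :: "'n cvec"
  proof -
    define r where "r = e / (1 + norm p)"
    have np: "1 + norm p > 0" by (simp add: add_pos_nonneg)
    have r: "r > 0" using e(1) np by (simp add: r_def)
    have sub: "dil l p \<in> dom" if "norm l \<le> r" for l using that np by (intro e(3)) (simp add: r_def field_simps)
    then have hol': "(\<lambda>l. f (dil l p)) holomorphic_on cball 0 r"
      by (intro holomorphic_on_subset[OF holomorphic_dil[OF hol]]) auto
    have "norm ((deriv ^^ j) (\<lambda>l. f (dil l p)) 0) \<le> fact j * M / r ^ j"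
    proof (rule Cauchy_inequality)
      show "(\<lambda>l. f (dil l p)) holomorphic_on ball 0 r" by (rule holomorphic_on_subset[OF hol']) auto
      show "continuous_on (cball 0 r) (\<lambda>l. f (dil l p))" by (rule holomorphic_on_imp_continuous_on[OF hol'])
    qed (use r sub M in auto)
    then have "norm (taylor f j p) \<le> M / r ^ j"
      by (simp add: taylor_def fps_expansion_def norm_divide divide_le_eq mult.commute)
    also have "\<dots> = M * ((1 + norm p) / e) ^ j" by (simp add: r_def power_divide)
    finally show ?thesis .
  qed
  have sep: "\<exists>q. degree q \<le> j \<and> (\<forall>x. taylor f j (upd p i x) = poly q x)" for p :: "'n cvec" and i
  proof (rule entire_poly_growth)
    have "(\<lambda>x. taylor f j (upd p i x)) holomorphic_on ball 0 R" if R: "R > 0" for R unfolding taylor_def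
    proof (rule holomorphic_Taylor_coeff[where r = "e / (1 + 2 * norm p + R)" and M = M])
      have pR: "1 + 2 * norm p + R > 0" using R by (simp add: add_nonneg_pos)
      then show "e / (1 + 2 * norm p + R) > 0" using e(1) by simp
      have sub: "dil l (upd p i x) \<in> dom" if "x \<in> ball 0 R" "norm l < e / (1 + 2 * norm p + R)" for x l
      proof (rule e(3))
        have "norm l * (1 + norm (upd p i x)) \<le> norm l * (1 + 2 * norm p + R)"
          using norm_upd_le[of p i x] that by (intro mult_left_mono) auto
        also have "\<dots> \<le> e" using that(2) pR by (simp add: field_simps)
        finally show "norm l * (1 + norm (upd p i x)) \<le> e" .
      qed
      show "(\<lambda>l. f (dil l (upd p i x))) holomorphic_on ball 0 (e / (1 + 2 * norm p + R))" if "x \<in> ball 0 R" for x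
        by (intro holomorphic_on_subset[OF holomorphic_dil[OF hol]]) (use sub that in auto)
      show "(\<lambda>x. f (dil l (upd p i x))) holomorphic_on ball 0 R" if "norm l < e / (1 + 2 * norm p + R)" for l
      proof (rule holomorphic_several_compose[OF hol])
        fix k
        show "(\<lambda>x. dil l (upd p i x) $ k) holomorphic_on ball 0 R"
          by (cases "k = i") (auto simp: dil_nth intro!: holomorphic_intros)
      qed (use sub that in auto)
      show "norm (f (dil l (upd p i x))) \<le> M" if "x \<in> ball 0 R" "norm l < e / (1 + 2 * norm p + R)" for x l
        using sub that M by blast
    qed auto
    then have d: "(\<lambda>x. taylor f j (upd p i x)) field_differentiable at x" for x
      using holomorphic_on_imp_differentiable_at[of "\<lambda>x. taylor f j (upd p i x)" "ball 0 (norm x + 1)" x]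
      by (simp add: add_nonneg_pos)
    then show "(\<lambda>x. taylor f j (upd p i x)) holomorphic_on UNIV" by (simp add: holomorphic_on_def)
    fix x
    have "((1 + norm (upd p i x)) / e) ^ j \<le> ((1 + 2 * norm p) * (1 + norm x) / e) ^ j"
      using e(1) norm_upd_growth[of p i x] by (intro power_mono divide_right_mono) auto
    then have "M * ((1 + norm (upd p i x)) / e) ^ j \<le> M * ((1 + 2 * norm p) * (1 + norm x) / e) ^ j"
      using M0 by (intro mult_left_mono)
    also have "\<dots> = (M * ((1 + 2 * norm p) / e) ^ j) * (1 + norm x) ^ j" by (simp add: power_mult_distrib power_divide)
    finally show "norm (taylor f j (upd p i x)) \<le> (M * ((1 + 2 * norm p) / e) ^ j) * (1 + norm x) ^ j"
      using growth[of "upd p i x"] by simp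
  qed
  have "\<exists>g. poly_fun g \<and> (\<forall>p. (\<forall>i. p $ i \<in> (UNIV :: complex set)) \<longrightarrow> taylor f j p = g p)"
    by (rule separately_poly_imp_poly_fun[where M = j]) (use sep infinite_UNIV_char_0 in auto)
  then obtain g where g: "poly_fun g" "\<And>p. taylor f j p = g p" by auto
  then have "taylor f j = g" by auto
  then show ?thesis using g(1) by simp
qed

text \<open>Equal power series give the identity near \<open>0\<close>. It continues analytically to
  \<open>l\<close>, because the orbit stays in the domain on a disc around \<open>0\<close> that
  contains \<open>l\<close>.\<close>

lemma dil_identity:
  fixes f :: "complex^'n::{finite,linorder} \<Rightarrow> complex"
  assumes hol: "holomorphic_several dom f"
    and eq: "fps_of_poly A = fps_of_poly B * Abs_fps (\<lambda>j. taylor f j p)" and l: "dil l p \<in> dom"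
  shows "poly A l = poly B l * f (dil l p)"
proof -
  obtain r where r: "r > norm l" "\<And>c. norm c \<le> r \<Longrightarrow> dil c p \<in> dom" using dil_dom_enlarge[OF l] by blast
  have rpos: "r > 0" using r(1) norm_ge_zero[of l] by linarith
  have "(\<lambda>l. poly B l * f (dil l p)) has_fps_expansion fps_of_poly A"
    unfolding eq by (intro fps_expansion_intros has_fps_expansion_poly has_fps_expansion_taylor[OF hol])
  moreover have "poly A has_fps_expansion fps_of_poly A" by (rule has_fps_expansion_poly)
  ultimately have "\<forall>\<^sub>F c in nhds 0. poly B c * f (dil c p) = poly A c"
    unfolding has_fps_expansion_def by (auto simp: eq_commute)
  then obtain d where d: "d > 0" "\<And>c. dist c 0 < d \<Longrightarrow> poly B c * f (dil c p) = poly A c"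
    unfolding eventually_nhds_metric by blast
  have "poly A l - poly B l * f (dil l p) = 0"
  proof (rule analytic_continuation_open[of "ball 0 (min d r)" "ball 0 r" "\<lambda>c. poly A c - poly B c * f (dil c p)" "\<lambda>_. 0" l])
    show "(\<lambda>c. poly A c - poly B c * f (dil c p)) holomorphic_on ball 0 r"
      by (intro holomorphic_intros holomorphic_on_subset[OF holomorphic_dil[OF hol]]) (use r in auto)
  qed (use d rpos r(1) in \<open>auto intro!: d(2)\<close>)
  then show ?thesis by simp
qed

end

section \<open>Fractions with a normalized denominator\<close>

text \<open>Polynomial functions as a type, so that the library theory of polynomials and power series over
  integral domains (in particular pseudo-division) applies to them.\<close>

typedef ('n::finite) pfun = "{g :: complex^'n \<Rightarrow> complex. poly_fun g}"
  morphisms pev Pfun using poly_fun_const by blast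

setup_lifting type_definition_pfun

instantiation pfun :: (finite) comm_ring_1
begin

lift_definition zero_pfun :: "'a pfun" is "\<lambda>_. 0" by (rule poly_fun_const)
lift_definition one_pfun :: "'a pfun" is "\<lambda>_. 1" by (rule poly_fun_const)
lift_definition plus_pfun :: "'a pfun \<Rightarrow> 'a pfun \<Rightarrow> 'a pfun" is "\<lambda>g h p. g p + h p" by (rule poly_fun_add)
lift_definition minus_pfun :: "'a pfun \<Rightarrow> 'a pfun \<Rightarrow> 'a pfun" is "\<lambda>g h p. g p - h p" by (rule poly_fun_diff)
lift_definition uminus_pfun :: "'a pfun \<Rightarrow> 'a pfun" is "\<lambda>g p. - g p" by (rule poly_fun_uminus)
lift_definition times_pfun :: "'a pfun \<Rightarrow> 'a pfun \<Rightarrow> 'a pfun" is "\<lambda>g h p. g p * h p" by (rule poly_fun_mult)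

instance by standard (transfer; simp add: fun_eq_iff algebra_simps)+

end

lemma pev_simps [simp]:
  "pev 0 p = 0" "pev 1 p = 1" "pev (a + b) p = pev a p + pev b p" "pev (a - b) p = pev a p - pev b p"
  "pev (- a) p = - pev a p" "pev (a * b) p = pev a p * pev b p" by (transfer, simp)+

lemma poly_fun_pev: "poly_fun (pev a)" using pev by blast

lemma pev_Pfun: "poly_fun g \<Longrightarrow> pev (Pfun g) = g" by (simp add: Pfun_inverse)

lemma pfun_eqI: "(\<And>p. pev a p = pev b p) \<Longrightarrow> a = b" by (simp add: pev_inject[symmetric] fun_eq_iff)

lemma pev_nonzero: "a \<noteq> 0 \<Longrightarrow> \<exists>p. pev a p \<noteq> 0" using pfun_eqI[of a 0] by auto

lemma poly_fun_dense:
  fixes R :: "complex^'n \<Rightarrow> complex"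
  assumes "poly_fun R" "R u \<noteq> 0" "closed {p. P p}" "\<And>p. R p \<noteq> 0 \<Longrightarrow> P p"
  shows "P p"
proof (rule ccontr)
  assume "\<not> P p"
  then have ne: "- {p. P p} \<noteq> {}" by blast
  have "R q = 0" if "q \<in> - {p. P p}" for q using that assms(4) by blast
  then have "R u = 0" by (rule poly_fun_zero_open[OF assms(1) open_Compl[OF assms(3)] ne])
  then show False using assms(2) by simp
qed

instance pfun :: (finite) idom
proof
  fix a b :: "'a pfun"
  assume "a \<noteq> 0" "b \<noteq> 0"
  obtain u v where u: "pev a u \<noteq> 0" and v: "pev b v \<noteq> 0"
    using pev_nonzero \<open>a \<noteq> 0\<close> \<open>b \<noteq> 0\<close> by blast
  show "a * b \<noteq> 0"
  proof
    assume ab: "a * b = 0"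
    have "pev b v = 0"
    proof (rule poly_fun_dense[OF poly_fun_pev[of a] u])
      show "closed {p. pev b p = 0}" by (intro closed_Collect_eq poly_fun_continuous poly_fun_pev continuous_intros)
      show "pev b p = 0" if "pev a p \<noteq> 0" for p using arg_cong[OF ab, of "\<lambda>c. pev c p"] that by simp
    qed
    then show False using v by simp
  qed
qed

lemma pev_sum: "pev (\<Sum>k\<in>K. h k) p = (\<Sum>k\<in>K. pev (h k) p)" by (induction K rule: infinite_finite_induct) auto

definition pevp :: "'n pfun poly \<Rightarrow> complex^'n::finite \<Rightarrow> complex poly" where
  "pevp A p = map_poly (\<lambda>r. pev r p) A"

definition fpev :: "'n pfun fps \<Rightarrow> complex^'n::finite \<Rightarrow> complex fps" where
  "fpev F p = Abs_fps (\<lambda>j. pev (fps_nth F j) p)"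

lemma coeff_pevp: "coeff (pevp A p) i = pev (coeff A i) p" by (simp add: pevp_def coeff_map_poly)

lemma degree_pevp_le: "degree (pevp A p) \<le> degree A" by (rule degree_le) (simp add: coeff_pevp coeff_eq_0)

lemma pevp_add: "pevp (A + B) p = pevp A p + pevp B p" by (simp add: poly_eq_iff coeff_pevp)

lemma pevp_mult: "pevp (A * B) p = pevp A p * pevp B p" by (simp add: poly_eq_iff coeff_pevp coeff_mult pev_sum)

lemma pevp_pCons: "pevp (pCons a A) p = pCons (pev a p) (pevp A p)"
  by (simp add: poly_eq_iff coeff_pevp coeff_pCons split: nat.split)

lemma pevp_0 [simp]: "pevp 0 p = 0" by (simp add: poly_eq_iff coeff_pevp)

lemma pevp_const: "pevp [:a:] p = [:pev a p:]" by (simp add: pevp_pCons)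

lemma poly_pevp: "poly (pevp A p) (pev r p) = pev (poly A r) p" by (induction A) (auto simp: pevp_pCons)

lemma poly_pevp_1: "poly (pevp A p) 1 = pev (poly A 1) p" using poly_pevp[of A p 1] by simp

lemma poly_fun_poly_pevp: "poly_fun (\<lambda>p. poly (pevp A p) u)"
proof -
  have "pev (Pfun (\<lambda>_. u)) p = u" for p :: "complex^'a" by (simp add: pev_Pfun poly_fun_const)
  then have "poly (pevp A p) u = pev (poly A (Pfun (\<lambda>_. u))) p" for p
    using poly_pevp[of A p "Pfun (\<lambda>_. u)"] by simp
  then show ?thesis by (simp add: poly_fun_pev)
qed

lemma fps_of_poly_pevp: "fps_of_poly (pevp A p) = fpev (fps_of_poly A) p" by (simp add: fps_eq_iff fpev_def coeff_pevp)

lemma fpev_mult: "fpev (F * G) p = fpev F p * fpev G p" by (simp add: fps_eq_iff fpev_def fps_mult_nth pev_sum)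

text \<open>Let \<open>E\<close> be nonzero of least degree in the ideal generated by
  \<open>A\<close> and \<open>B\<close>. By pseudo-division \<open>E\<close> divides nonzero scalar
  multiples of both; cancelling it gives another denominator, whose degree is smaller unless
  \<open>E\<close> is constant.\<close>

lemma minimal_fraction:
  fixes F :: "'r::idom fps"
  assumes "B0 \<noteq> 0" "fps_of_poly A0 = fps_of_poly B0 * F"
  obtains A B U V \<rho> where "fps_of_poly A = fps_of_poly B * F" "coeff B 0 \<noteq> 0" "\<rho> \<noteq> 0" "U * A + V * B = [:\<rho>:]"
proof -
  define Q where "Q n \<longleftrightarrow> (\<exists>A B. B \<noteq> 0 \<and> fps_of_poly A = fps_of_poly B * F \<and> degree B = n)" for n
  have "\<exists>n. Q n" using assms unfolding Q_def by blast
  then obtain n where n: "Q n" "\<And>k. k < n \<Longrightarrow> \<not> Q k" using exists_least_iff[of Q] by blast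
  then obtain A B where AB: "B \<noteq> 0" "fps_of_poly A = fps_of_poly B * F" "degree B = n" unfolding Q_def by blast
  have min: "n \<le> degree B'" if "B' \<noteq> 0" "fps_of_poly A' = fps_of_poly B' * F" for A' B'
  proof (rule ccontr)
    assume "\<not> n \<le> degree B'"
    then have "\<not> Q (degree B')" using n(2) by simp
    then show False using that unfolding Q_def by blast
  qed
  \<comment> \<open>Otherwise the variable divides the numerator as well and can be cancelled,
    against minimality.\<close>
  have "coeff B 0 \<noteq> 0"
  proof
    assume B0: "coeff B 0 = 0"
    then obtain B' where B': "B = pCons 0 B'" by (metis coeff_pCons_0 pCons_cases)
    have "fps_nth (fps_of_poly A) 0 = 0" using AB(2) B0 by simp
    then obtain A' where A': "A = pCons 0 A'" by (metis coeff_pCons_0 fps_of_poly_nth pCons_cases)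
    have "fps_X * fps_of_poly A' = fps_X * (fps_of_poly B' * F)"
      using AB(2) unfolding A' B' by (simp add: fps_of_poly_pCons ac_simps)
    then have "fps_of_poly A' = fps_of_poly B' * F" by (simp only: mult_cancel_left fps_X_neq_zero simp_thms)
    moreover have "B' \<noteq> 0" using AB(1) B' by auto
    ultimately have "n \<le> degree B'" using min by blast
    then show False using AB(3) B' \<open>B' \<noteq> 0\<close> by simp
  qed
  define I where "I = {U * A + V * B | U V. True}"
  have "0 * A + 1 * B \<in> I" "1 * A + 0 * B \<in> I" unfolding I_def by blast+
  then have "B \<in> I" "A \<in> I" by simp_all
  define E where "E = (ARG_MIN degree E. E \<in> I \<and> E \<noteq> 0)"
  have "E \<in> I \<and> E \<noteq> 0"
    unfolding E_def by (rule arg_min_natI[of _ B]) (use \<open>B \<in> I\<close> AB(1) in auto)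
  then have E: "E \<in> I" "E \<noteq> 0" by auto
  have Emin: "degree E \<le> degree G" if "G \<in> I" "G \<noteq> 0" for G
    unfolding E_def by (rule arg_min_nat_le) (use that in auto)
  have div: "\<exists>a S. a \<noteq> 0 \<and> smult a G = E * S" if G: "G \<in> I" for G
  proof -
    obtain a q where aq: "a \<noteq> 0" "smult a G = E * q + pseudo_mod G E"
        "pseudo_mod G E = 0 \<or> degree (pseudo_mod G E) < degree E" using pseudo_mod[OF E(2), of G] by metis
    obtain U1 V1 where G1: "G = U1 * A + V1 * B" using G by (auto simp: I_def)
    obtain U2 V2 where E1: "E = U2 * A + V2 * B" using E(1) by (auto simp: I_def)
    have "pseudo_mod G E = smult a G - E * q" using aq(2) by simp
    also have "\<dots> = (smult a U1 - U2 * q) * A + (smult a V1 - V2 * q) * B"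
      by (subst G1, subst E1) (simp add: smult_add_right algebra_simps)
    finally have "pseudo_mod G E \<in> I" unfolding I_def by blast
    then have "pseudo_mod G E = 0" using Emin aq(3) by (meson not_le)
    then show ?thesis using aq by auto
  qed
  obtain a S where S: "a \<noteq> 0" "smult a A = E * S" using div[OF \<open>A \<in> I\<close>] by blast
  obtain b T where T: "b \<noteq> 0" "smult b B = E * T" using div[OF \<open>B \<in> I\<close>] by blast
  have eA: "smult (a * b) A = E * smult b S" using S(2) by (metis mult.commute mult_smult_right smult_smult)
  have eB: "smult (a * b) B = E * smult a T" using T(2) by (metis mult_smult_right smult_smult)
  have "fps_of_poly E * fps_of_poly (smult b S) = fps_of_poly E * (fps_of_poly (smult a T) * F)"
    using AB(2) unfolding mult.assoc[symmetric] fps_of_poly_mult[symmetric] eA[symmetric] eB[symmetric]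
    by (simp add: fps_of_poly_smult mult.assoc)
  moreover have "fps_of_poly E \<noteq> 0" using E(2) by (metis fps_of_poly_0 fps_of_poly_eq_iff)
  ultimately have "fps_of_poly (smult b S) = fps_of_poly (smult a T) * F" by simp
  moreover have aT: "smult a T \<noteq> 0" using eB S(1) T(1) AB(1) by auto
  ultimately have "n \<le> degree (smult a T)" using min by blast
  moreover have "degree B = degree E + degree (smult a T)"
    using arg_cong[OF eB, of degree] S(1) T(1) E(2) aT by (simp add: degree_mult_eq)
  ultimately have "degree E = 0" using AB(3) by simp
  then obtain \<rho> where \<rho>: "E = [:\<rho>:]" by (auto elim: degree_eq_zeroE)
  obtain U V where "E = U * A + V * B" using E(1) by (auto simp: I_def)
  then show thesis using AB(2) \<open>coeff B 0 \<noteq> 0\<close> \<rho> E(2) by (intro that[of A B \<rho> U V]) auto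
qed

text \<open>The quotient is formed on a box where \<open>\<beta>\<close> has no zero. By
  \<open>poly_division_growth\<close> it is a polynomial of degree at most \<open>n\<close> along
  each coordinate line, and interpolation makes it a polynomial function; the product identity then
  extends from the box to all points.\<close>

lemma poly_fun_division:
  fixes b \<beta> :: "complex^'n \<Rightarrow> complex"
  assumes "poly_fun b" "poly_fun \<beta>" "\<beta> u \<noteq> 0" "K \<ge> 0"
    and bd: "\<And>p. norm (b p) \<le> K * (1 + norm p) ^ n * norm (\<beta> p)"
  shows "\<exists>c. poly_fun c \<and> (\<forall>p. b p = \<beta> p * c p)"
proof -
  have "closed {p. \<beta> p = 0}" by (intro closed_Collect_eq poly_fun_continuous assms continuous_intros)
  then have "open (- {p. \<beta> p = 0})" by (simp add: open_Compl)
  then obtain e where e: "e > 0" "\<And>q. (\<And>i. dist (q $ i) (u $ i) < e) \<Longrightarrow> q \<in> - {p. \<beta> p = 0}"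
    by (rule open_contains_box[of "- {p. \<beta> p = 0}" u]) (use assms(3) in auto)
  define X where "X i = ball (u $ i) e" for i
  have inf: "infinite (X i)" for i unfolding X_def using uncountable_ball[OF e(1)] countable_finite by blast
  have nz: "\<beta> p \<noteq> 0" if "\<And>i. p $ i \<in> X i" for p using e(2)[of p] that by (auto simp: X_def dist_commute)
  have "\<exists>c. poly_fun c \<and> (\<forall>p. (\<forall>j. p $ j \<in> X j) \<longrightarrow> b p / \<beta> p = c p)"
  proof (rule separately_poly_imp_poly_fun[OF inf, where M = n])
    fix p i assume p: "\<And>j. p $ j \<in> X j"
    obtain bq where bq: "\<And>x. b (upd p i x) = poly bq x" using poly_fun_upd[OF assms(1)] by blast
    obtain \<beta>q where \<beta>q: "\<And>x. \<beta> (upd p i x) = poly \<beta>q x" using poly_fun_upd[OF assms(2)] by blast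
    have "poly \<beta>q (p $ i) \<noteq> 0" using \<beta>q[of "p $ i"] nz[OF p] by simp
    then have "\<beta>q \<noteq> 0" by auto
    moreover have "norm (poly bq x) \<le> (K * (1 + 2 * norm p) ^ n) * (1 + norm x) ^ n * norm (poly \<beta>q x)" for x
    proof -
      have "(1 + norm (upd p i x)) ^ n \<le> (1 + 2 * norm p) ^ n * (1 + norm x) ^ n"
        unfolding power_mult_distrib[symmetric] using norm_upd_growth[of p i x] by (intro power_mono) auto
      then have "K * (1 + norm (upd p i x)) ^ n * norm (poly \<beta>q x) \<le> K * ((1 + 2 * norm p) ^ n * (1 + norm x) ^ n) * norm (poly \<beta>q x)"
        using assms(4) by (intro mult_right_mono mult_left_mono) auto
      then show ?thesis using bd[of "upd p i x"] by (simp add: bq \<beta>q mult.assoc)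
    qed
    ultimately obtain q where q: "bq = \<beta>q * q" "degree q \<le> n" using poly_division_growth by blast
    have "b (upd p i x) / \<beta> (upd p i x) = poly q x" if "x \<in> X i" for x
    proof -
      have "\<beta> (upd p i x) \<noteq> 0" by (rule nz) (use p that in auto)
      then show ?thesis by (simp add: bq \<beta>q q(1))
    qed
    then show "\<exists>q. degree q \<le> n \<and> (\<forall>x\<in>X i. b (upd p i x) / \<beta> (upd p i x) = poly q x)"
      using q(2) by blast
  qed
  then obtain c where c: "poly_fun c" "\<And>p. (\<And>j. p $ j \<in> X j) \<Longrightarrow> b p / \<beta> p = c p" by blast
  have "b p - \<beta> p * c p = 0" for p
  proof (rule poly_fun_zero[of "\<lambda>p. b p - \<beta> p * c p", OF _ inf])
    show "poly_fun (\<lambda>p. b p - \<beta> p * c p)" by (intro poly_fun_diff poly_fun_mult assms c)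
    show "b p - \<beta> p * c p = 0" if "\<And>j. p $ j \<in> X j" for p
      using c(2)[OF that] nz[OF that] by (simp add: field_simps)
  qed
  then show ?thesis using c(1) by auto
qed

context weights
begin

definition tseries :: "(complex^'n::{finite,linorder} \<Rightarrow> complex) \<Rightarrow> 'n pfun fps" where
  "tseries f = Abs_fps (\<lambda>j. Pfun (taylor f j))"

lemma fpev_tseries: "f \<in> H_infinity dom \<Longrightarrow> fpev (tseries f) p = Abs_fps (\<lambda>j. taylor f j p)"
  by (simp add: fpev_def tseries_def pev_Pfun poly_fun_taylor)

lemma pair_identity:
  fixes f :: "complex^'n::{finite,linorder} \<Rightarrow> complex"
  assumes "f \<in> H_infinity dom" "fps_of_poly A = fps_of_poly B * tseries f" "dil l p \<in> dom"
  shows "poly (pevp A p) l = poly (pevp B p) l * f (dil l p)"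
proof (rule dil_identity)
  show "holomorphic_several dom f" using assms(1) by (simp add: H_infinity_def)
  show "fps_of_poly (pevp A p) = fps_of_poly (pevp B p) * Abs_fps (\<lambda>j. taylor f j p)"
    unfolding fps_of_poly_pevp assms(2) fpev_mult fpev_tseries[OF assms(1)] ..
qed (fact assms(3))

lemma bezout_root:
  fixes f :: "complex^'n::{finite,linorder} \<Rightarrow> complex"
  assumes "f \<in> H_infinity dom" "fps_of_poly A = fps_of_poly B * tseries f" "U * A + V * B = [:\<rho>:]"
    and "pev \<rho> p \<noteq> 0" "poly (pevp B p) l = 0"
  shows "dil l p \<notin> dom"
proof
  assume "dil l p \<in> dom"
  then have "poly (pevp A p) l = 0" using pair_identity[OF assms(1,2)] assms(5) by simp
  then have "poly (pevp (U * A + V * B) p) l = 0" using assms(5) by (simp add: pevp_add pevp_mult)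
  then show False using assms(4) unfolding assms(3) pevp_const by simp
qed

lemma normalized_fraction:
  fixes f :: "complex^'n::{finite,linorder} \<Rightarrow> complex"
  assumes f: "f \<in> H_infinity dom" and ex: "B0 \<noteq> 0" "fps_of_poly A0 = fps_of_poly B0 * tseries f"
  obtains A B U V \<rho> where "fps_of_poly A = fps_of_poly B * tseries f" "coeff B 0 = 1" "\<rho> \<noteq> 0" "U * A + V * B = [:\<rho>:]"
proof -
  obtain A B U V \<rho> where AB: "fps_of_poly A = fps_of_poly B * tseries f" "coeff B 0 \<noteq> 0" "\<rho> \<noteq> 0" "U * A + V * B = [:\<rho>:]"
    using minimal_fraction[OF ex] .
  define \<beta> where "\<beta> = coeff B 0"
  define n where "n = degree B"
  obtain e where e: "0 < e" "e \<le> 1"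
    "\<And>c (p :: complex^'n::{finite,linorder}). norm c * (1 + norm p) \<le> e \<Longrightarrow> dil c p \<in> dom"
    using dil_dom_small[where 'n='n] by blast
  have "\<beta> * \<rho> \<noteq> 0" using AB by (simp add: \<beta>_def)
  then obtain u where u: "pev (\<beta> * \<rho>) u \<noteq> 0" using pev_nonzero by blast
  have bd: "norm (pev (coeff B i) p) \<le> (2 / e) ^ n * (1 + norm p) ^ n * norm (pev \<beta> p)" for i p
  proof (rule poly_fun_dense[OF poly_fun_pev u])
    show "closed {p. norm (pev (coeff B i) p) \<le> (2 / e) ^ n * (1 + norm p) ^ n * norm (pev \<beta> p)}"
      by (intro closed_Collect_le continuous_intros poly_fun_continuous poly_fun_pev)
    fix p assume p: "pev (\<beta> * \<rho>) p \<noteq> 0"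
    \<comment> \<open>Up to this radius the orbit of \<open>p\<close> is in the domain, where by
      \<open>bezout_root\<close> the denominator has no root.\<close>
    define s where "s = e / (1 + norm p)"
    have np: "1 + norm p > 0" by (simp add: add_pos_nonneg)
    have s: "0 < s" "s \<le> 1" unfolding s_def by (rule divide_pos_pos[OF e(1) np]) (subst divide_le_eq_1_pos[OF np], use e(2) norm_ge_zero[of p] in linarith)
    have "norm (coeff (pevp B p) i) \<le> (2 / s) ^ n * norm (coeff (pevp B p) 0)"
    proof (rule poly_coeff_bound[OF _ s])
      show "degree (pevp B p) \<le> n" unfolding n_def by (rule degree_pevp_le)
      fix x assume "poly (pevp B p) x = 0"
      then have "dil x p \<notin> dom" using bezout_root[OF f AB(1,4)] p by simp
      then have "norm x * (1 + norm p) > e" using e(3) by (meson not_le)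
      then show "s \<le> norm x" using np by (simp add: s_def field_simps)
    qed
    then show "norm (pev (coeff B i) p) \<le> (2 / e) ^ n * (1 + norm p) ^ n * norm (pev \<beta> p)"
    proof -
      have "2 / s = 2 / e * (1 + norm p)" by (simp add: s_def)
      then have "(2 / s) ^ n = (2 / e) ^ n * (1 + norm p) ^ n" by (simp only: power_mult_distrib)
      with \<open>norm (coeff (pevp B p) i) \<le> _\<close> show ?thesis by (simp add: coeff_pevp \<beta>_def)
    qed
  qed
  have "\<exists>c. coeff B i = \<beta> * c" for i
  proof -
    have "\<exists>c. poly_fun c \<and> (\<forall>p. pev (coeff B i) p = pev \<beta> p * c p)"
      by (rule poly_fun_division[OF poly_fun_pev poly_fun_pev _ _ bd, of u]) (use u e in auto)
    then obtain c where "poly_fun c" "\<And>p. pev (coeff B i) p = pev \<beta> p * c p" by blast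
    then have "coeff B i = \<beta> * Pfun c" by (intro pfun_eqI) (simp add: pev_Pfun)
    then show ?thesis by blast
  qed
  then obtain c where c: "\<And>i. coeff B i = \<beta> * c i" by metis
  have "\<beta> \<noteq> 0" using AB(2) by (simp add: \<beta>_def)
  define C where "C = (\<Sum>i\<le>n. monom (c i) i)"
  have cC: "coeff C i = c i" for i
  proof -
    have "coeff C i = (if i \<le> n then c i else 0)" unfolding C_def coeff_sum by simp
    moreover have "c i = 0" if "i > n" using c[of i] that \<open>\<beta> \<noteq> 0\<close> by (simp add: n_def coeff_eq_0)
    ultimately show ?thesis by auto
  qed
  have BC: "B = smult \<beta> C" by (simp add: poly_eq_iff cC c)
  have C0: "coeff C 0 = 1"
  proof -
    have "\<beta> * coeff C 0 = \<beta> * 1" using c[of 0] by (simp add: cC flip: \<beta>_def)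
    then show ?thesis using \<open>\<beta> \<noteq> 0\<close> by (simp only: mult_cancel_left simp_thms)
  qed
  \<comment> \<open>The numerator inherits the factor: it equals \<open>\<beta>\<close> times
    \<open>G\<close>, and as \<open>\<beta>\<close> is not a zero divisor, the series
    \<open>G\<close> terminates where \<open>A\<close> does.\<close>
  define G where "G = fps_of_poly C * tseries f"
  have AG: "coeff A j = \<beta> * fps_nth G j" for j
  proof -
    have "fps_of_poly A = fps_const \<beta> * G" unfolding AB(1) BC G_def by (simp add: fps_of_poly_smult mult.assoc)
    then show ?thesis by (metis fps_mult_left_const_nth fps_of_poly_nth)
  qed
  define A' where "A' = (\<Sum>j\<le>degree A. monom (fps_nth G j) j)"
  have cA': "coeff A' j = fps_nth G j" for j
  proof -
    have "coeff A' j = (if j \<le> degree A then fps_nth G j else 0)" unfolding A'_def coeff_sum by simp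
    moreover have "fps_nth G j = 0" if "j > degree A" using AG[of j] that \<open>\<beta> \<noteq> 0\<close> by (simp add: coeff_eq_0)
    ultimately show ?thesis by auto
  qed
  have "fps_of_poly A' = fps_of_poly C * tseries f" by (simp add: fps_eq_iff cA' flip: G_def)
  moreover have "A = smult \<beta> A'" by (simp add: poly_eq_iff cA' AG)
  then have "smult \<beta> U * A' + smult \<beta> V * C = [:\<rho>:]" using AB(4) BC by simp
  ultimately show thesis using C0 AB(3) by (intro that[of A' C \<rho> "smult \<beta> U" "smult \<beta> V"])
qed

end

section \<open>The reflection form of an inner function that is a fraction\<close>

lemma poly_only_root_zero:
  fixes p :: "complex poly"
  assumes "\<And>x. x \<noteq> 0 \<Longrightarrow> poly p x \<noteq> 0"
  shows "\<exists>c k. \<forall>x. poly p x = c * x ^ k"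
proof -
  have "p \<noteq> 0" using assms[of 1] by auto
  then obtain q where q: "p = [:- 0, 1:] ^ order 0 p * q" "\<not> [:- 0, 1:] dvd q" using order_decomp by blast
  have "poly q x \<noteq> 0" for x
  proof (cases "x = 0")
    case True
    then show ?thesis using q(2) by (simp add: poly_eq_0_iff_dvd)
  next
    case False
    then show ?thesis using assms[OF False] by (subst (asm) q(1)) auto
  qed
  then have "constant (poly q)" using fundamental_theorem_of_algebra by blast
  then have "poly q x = poly q 0" for x by (simp add: constant_def)
  then have "poly p x = poly q 0 * x ^ order 0 p" for x by (subst q(1)) (simp add: poly_power)
  then show ?thesis by blast
qed

context weights
begin

lemma poly_fun_zero_bdry_eq:
  fixes R :: "complex^'n::{finite,linorder} \<Rightarrow> complex"
  assumes "poly_fun R" "poly_fun S" "\<And>q. q \<in> bdry \<Longrightarrow> R q = S q"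
  shows "R p = S p" using poly_fun_zero_bdry[OF poly_fun_diff[OF assms(1,2)], of p] assms(3) by simp

text \<open>On the boundary \<open>\<alpha>\<close> times its reflection is \<open>1\<close>; with
  denominators cleared, \<open>\<alpha>' * \<alpha>\<close> is a power of \<open>p $ lst\<close>
  everywhere. So \<open>\<alpha>\<close> has no zero where \<open>p $ lst \<noteq> 0\<close>, and a
  polynomial of one variable without zeros is constant: there \<open>\<alpha>\<close> depends on the
  last coordinate only.\<close>

lemma unimodular_on_bdry:
  fixes \<alpha> :: "complex^'n::{finite,linorder} \<Rightarrow> complex"
  assumes pf: "poly_fun \<alpha>" and uni: "\<And>q. q \<in> bdry \<Longrightarrow> norm (\<alpha> q) = 1"
  obtains k \<tau> where "norm \<tau> = 1" "\<And>p. p $ lst \<noteq> 0 \<Longrightarrow> \<alpha> p = \<tau> * (p $ lst) ^ k"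
proof -
  obtain M \<alpha>' where \<alpha>': "poly_fun \<alpha>'" "\<And>p. p $ lst \<noteq> 0 \<Longrightarrow> \<alpha>' p = (p $ lst) ^ M * tilde \<alpha> p"
    using tilde_poly[OF pf] by blast
  have "\<alpha>' p * \<alpha> p = (p $ lst) ^ M" for p
  proof (rule poly_fun_zero_bdry_eq[of "\<lambda>p. \<alpha>' p * \<alpha> p" "\<lambda>p. (p $ lst) ^ M"])
    fix q :: "'n cvec" assume q: "q \<in> bdry"
    have "cnj (\<alpha> q) * \<alpha> q = 1" using uni[OF q] complex_norm_square[of "\<alpha> q"] by (simp add: mult.commute)
    moreover have "q $ lst \<noteq> 0" using norm_lst_bdry[OF q] by auto
    ultimately show "\<alpha>' q * \<alpha> q = (q $ lst) ^ M" using \<alpha>'(2)[of q] tilde_bdry[OF q] by simp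
  qed (intro poly_fun_mult poly_fun_power poly_fun_coord \<alpha>' pf)+
  then have nz: "\<alpha> p \<noteq> 0" if "p $ lst \<noteq> 0" for p using that by (metis mult_zero_right power_not_zero)
  have drop: "\<alpha> (upd p i x) = \<alpha> p" if "i \<noteq> lst" "p $ lst \<noteq> 0" for p i x
  proof -
    obtain q where q: "\<And>x. \<alpha> (upd p i x) = poly q x" using poly_fun_upd[OF pf] by blast
    have "poly q x \<noteq> 0" for x using nz[of "upd p i x"] that by (simp add: q)
    then have "constant (poly q)" using fundamental_theorem_of_algebra by blast
    then have "poly q x = poly q (p $ i)" by (simp add: constant_def)
    then show ?thesis by (simp flip: q)
  qed
  have "\<alpha> (\<chi> j. if j \<in> S then 0 else p $ j) = \<alpha> p" if "finite S" "lst \<notin> S" "p $ lst \<noteq> 0" for S p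
    using that
  proof (induction S rule: finite_induct)
    case (insert i S)
    let ?v = "\<chi> j. if j \<in> S then 0 else p $ j"
    have "(\<chi> j. if j \<in> insert i S then 0 else p $ j) = upd ?v i 0" by (auto simp: vec_eq_iff)
    then show ?case using drop[of i ?v 0] insert by auto
  qed (simp add: vec_lambda_eta)
  note drop_all = this
  obtain \<epsilon> where \<epsilon>: "\<And>x. \<alpha> (upd 0 lst x) = poly \<epsilon> x" using poly_fun_upd[OF pf] by blast
  have "poly \<epsilon> x \<noteq> 0" if "x \<noteq> 0" for x using nz[of "upd 0 lst x"] that by (simp add: \<epsilon>)
  then obtain c k where ck: "\<And>x. poly \<epsilon> x = c * x ^ k" using poly_only_root_zero by blast
  have main: "\<alpha> p = c * (p $ lst) ^ k" if "p $ lst \<noteq> 0" for p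
  proof -
    have "(\<chi> j. if j \<in> - {lst} then 0 else p $ j) = upd 0 lst (p $ lst)" by (simp add: vec_eq_iff)
    then have "\<alpha> p = \<alpha> (upd 0 lst (p $ lst))" using drop_all[of "- {lst}" p] that by simp
    then show ?thesis by (simp add: \<epsilon> ck)
  qed
  obtain q :: "'n cvec" where q: "q \<in> bdry" using bdry_nonempty by blast
  have "q $ lst \<noteq> 0" using norm_lst_bdry[OF q] by auto
  then have "norm c = 1" using uni[OF q] main[of q] norm_lst_bdry[OF q] by (simp add: norm_mult norm_power)
  then show thesis using main by (intro that[of c k])
qed

lemma inner_fraction:
  fixes f :: "complex^'n::{finite,linorder} \<Rightarrow> complex"
  assumes f: "inner_fun m t f" and ex: "B0 \<noteq> 0" "fps_of_poly A0 = fps_of_poly B0 * tseries f"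
  obtains A B U V \<rho> k \<tau> where
    "fps_of_poly A = fps_of_poly B * tseries f" "coeff B 0 = 1" "\<rho> \<noteq> 0" "U * A + V * B = [:\<rho>:]"
    "norm \<tau> = 1" "\<And>p. p \<in> dom \<Longrightarrow> pev (poly B 1) p \<noteq> 0"
    "\<And>p. p \<in> dom \<Longrightarrow> pev (poly A 1) p = pev (poly B 1) p * f p"
    "\<And>p. p $ lst \<noteq> 0 \<Longrightarrow> pev (poly A 1) p = \<tau> * (p $ lst) ^ k * tilde (pev (poly B 1)) p"
proof -
  have fH: "f \<in> H_infinity dom" using f by (simp add: inner_fun_def)
  obtain A B U V \<rho> where AB: "fps_of_poly A = fps_of_poly B * tseries f" "coeff B 0 = 1"
      "\<rho> \<noteq> 0" "U * A + V * B = [:\<rho>:]" using normalized_fraction[OF fH ex] .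
  define g where "g = pev (poly B 1)"
  define a where "a = pev (poly A 1)"
  have af: "a p = g p * f p" if "p \<in> dom" for p
    using pair_identity[OF fH AB(1), of 1 p] that by (simp add: poly_pevp_1 a_def g_def)
  have coeffB0: "coeff (pevp B p) 0 = 1" for p by (simp add: coeff_pevp AB(2))
  have circ: "norm (poly (pevp A q) u) = norm (poly (pevp B q) u)" if q: "q \<in> bdry" and u: "norm u = 1" for q u
  proof -
    have u0: "u \<noteq> 0" "cnj u * u = 1" using u complex_norm_square[of u] by (auto simp: mult.commute)
    have cont: "continuous_on UNIV (\<lambda>q :: 'n cvec. poly (pevp C (dil (cnj u) q)) u)" for C
      by (rule continuous_on_compose2[OF poly_fun_continuous[OF poly_fun_poly_pevp, of UNIV]])
         (auto intro!: continuous_intros)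
    have lim: "((\<lambda>r. poly D (of_real r * u)) \<longlongrightarrow> poly D u) (at_left (1::real))" for D
    proof -
      have "((\<lambda>r. poly D (of_real r * u)) \<longlongrightarrow> poly D (of_real 1 * u)) (at_left (1::real))"
        by (intro tendsto_intros)
      then show ?thesis by simp
    qed
    \<comment> \<open>\<open>inner_modulus\<close> speaks of radial limits. It is applied at the
      boundary point \<open>dil u q\<close>, and \<open>dil (cnj u)\<close> undoes the rotation in
      the coefficients, so that polynomials attached to \<open>q\<close> are evaluated at
      \<open>u\<close>.\<close>
    have "norm (poly (pevp A (dil (cnj u) (dil u q))) u) = norm (poly (pevp B (dil (cnj u) (dil u q))) u)"
    proof (rule inner_modulus[OF f cont cont,
        where X' = "\<lambda>q r. poly (pevp A (dil (cnj u) q)) (of_real r * u)" and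
              Y' = "\<lambda>q r. poly (pevp B (dil (cnj u) q)) (of_real r * u)"])
      fix q :: "'n cvec" and r :: real assume q: "q \<in> bdry" and r: "0 < r" "r < 1"
      have e: "dil (of_real r * u) (dil (cnj u) q) = dil (of_real r) q"
        using u0(2) by (simp add: dil_mult mult.assoc mult.commute[of u])
      have "dil (of_real r * u) (dil (cnj u) q) \<in> dom" unfolding e using dil_bdry[OF q] r by simp
      from pair_identity[OF fH AB(1) this]
      show "poly (pevp A (dil (cnj u) q)) (of_real r * u) =
          poly (pevp B (dil (cnj u) q)) (of_real r * u) * f (dil (of_real r) q)" unfolding e .
    qed (use lim dil_bdry_bdry[OF q u] in auto)
    then show ?thesis using u0 by (simp add: dil_mult)
  qed
  have "A \<noteq> 0"
  proof
    assume "A = 0"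
    obtain q :: "'n cvec" where q: "q \<in> bdry" using bdry_nonempty by blast
    have "pevp B q = 0" using circ[OF q] by (intro poly_eqI_circle) (simp add: \<open>A = 0\<close>)
    then show False using coeffB0[of q] by simp
  qed
  define \<alpha> where "\<alpha> = lead_coeff A"
  have "\<rho> * \<alpha> \<noteq> 0" using \<open>A \<noteq> 0\<close> AB(3) by (simp add: \<alpha>_def)
  then obtain u where u: "pev (\<rho> * \<alpha>) u \<noteq> 0" using pev_nonzero by blast
  have cont: "continuous_on UNIV (pev c)" for c :: "'n pfun" by (intro poly_fun_continuous poly_fun_pev)
  \<comment> \<open>Where \<open>\<rho> * \<alpha>\<close> does not vanish, the two polynomials are
    coprime and the degree of \<open>A\<close> does not drop, so that \<open>pev \<alpha> q\<close>
    is the leading coefficient.\<close>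
  have generic: "norm (pev \<alpha> q) = 1 \<and> a q = pev \<alpha> q * cnj (g q)" if q: "q \<in> bdry" for q
  proof (rule bdry_closed_property[OF poly_fun_pev u _ _ q])
    have "closed {q. norm (pev \<alpha> q) = 1}" "closed {q. a q = pev \<alpha> q * cnj (g q)}"
      unfolding a_def g_def by (intro closed_Collect_eq continuous_intros cont)+
    then show "closed {q. norm (pev \<alpha> q) = 1 \<and> a q = pev \<alpha> q * cnj (g q)}" by (rule closed_Collect_conj)
    fix q :: "'n cvec" assume q: "q \<in> bdry" and nz: "pev (\<rho> * \<alpha>) q \<noteq> 0"
    have bez: "pevp U q * pevp A q + pevp V q * pevp B q = [:pev \<rho> q:]"
      using arg_cong[OF AB(4), of "\<lambda>C. pevp C q"] by (simp add: pevp_add pevp_mult pevp_const)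
    have "degree (pevp A q) = degree A"
      using nz degree_pevp_le[of A q] le_degree[of "pevp A q" "degree A"] by (simp add: coeff_pevp \<alpha>_def)
    then have "lead_coeff (pevp A q) = pev \<alpha> q" by (simp add: coeff_pevp \<alpha>_def)
    with coprime_unimodular_circle[OF bez _ circ[OF q] coeffB0] nz
    show "norm (pev \<alpha> q) = 1 \<and> a q = pev \<alpha> q * cnj (g q)" by (simp add: poly_pevp_1 a_def g_def)
  qed
  have "norm (pev \<alpha> q) = 1" if "q \<in> bdry" for q using generic[OF that] by simp
  then obtain k \<tau> where k: "norm \<tau> = 1" "\<And>p. p $ lst \<noteq> 0 \<Longrightarrow> pev \<alpha> p = \<tau> * (p $ lst) ^ k"
    using unimodular_on_bdry[OF poly_fun_pev[of \<alpha>]] by metis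
  obtain M g' where g': "poly_fun g'" "\<And>p. p $ lst \<noteq> 0 \<Longrightarrow> g' p = (p $ lst) ^ M * tilde g p"
    using tilde_poly[OF poly_fun_pev[of "poly B 1"]] unfolding g_def by metis
  have form: "a p = \<tau> * (p $ lst) ^ k * tilde g p" if p: "p $ lst \<noteq> 0" for p
  proof -
    have "(p $ lst) ^ M * a p = \<tau> * (p $ lst) ^ k * g' p"
    proof (rule poly_fun_zero_bdry_eq[of "\<lambda>p. (p $ lst) ^ M * a p" "\<lambda>p. \<tau> * (p $ lst) ^ k * g' p"])
      fix q :: "'n cvec" assume q: "q \<in> bdry"
      have q0: "q $ lst \<noteq> 0" using norm_lst_bdry[OF q] by auto
      show "(q $ lst) ^ M * a q = \<tau> * (q $ lst) ^ k * g' q"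
        using generic[OF q] k(2)[OF q0] g'(2)[OF q0] tilde_bdry[OF q] by simp
    qed (unfold a_def, (intro poly_fun_mult poly_fun_power poly_fun_coord poly_fun_const poly_fun_pev g')+)
    then show ?thesis using g'(2)[OF p] p by simp
  qed
  obtain v where v: "pev \<rho> v \<noteq> 0" using AB(3) pev_nonzero by blast
  have nz: "g p \<noteq> 0" if p: "p \<in> dom" for p
  proof -
    obtain s where s: "s > 1" "\<And>c. norm c \<le> s \<Longrightarrow> dil c p \<in> dom"
      using dil_dom_enlarge[of 1 p] p by auto
    define n where "n = degree B"
    \<comment> \<open>Stated as a disjunction, the claim defines a closed set of points, so zeros of
      \<open>\<rho>\<close> can be reached by density.\<close>
    have "dil (of_real s) p \<notin> dom \<or> (1 - 1 / s) ^ n \<le> norm (g p)"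
    proof (rule poly_fun_dense[OF poly_fun_pev v])
      have "open ((\<lambda>p :: 'n cvec. dil (of_real s) p) -` dom)"
        by (intro open_vimage open_dom continuous_intros)
      then have "closed {p :: 'n cvec. dil (of_real s) p \<notin> dom}" by (simp add: closed_def Compl_eq vimage_def)
      moreover have "closed {p. (1 - 1 / s) ^ n \<le> norm (g p)}"
        unfolding g_def by (intro closed_Collect_le continuous_intros cont)
      ultimately show "closed {p. dil (of_real s) p \<notin> dom \<or> (1 - 1 / s) ^ n \<le> norm (g p)}"
        by (rule closed_Collect_disj)
      fix p assume \<rho>: "pev \<rho> p \<noteq> 0"
      show "dil (of_real s) p \<notin> dom \<or> (1 - 1 / s) ^ n \<le> norm (g p)"
      proof (cases "dil (of_real s) p \<in> dom")
        case True
        have "(1 - 1 / s) ^ n * norm (coeff (pevp B p) 0) \<le> norm (poly (pevp B p) 1)"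
        proof (rule poly_lower_bound[OF _ s(1)])
          show "degree (pevp B p) \<le> n" unfolding n_def by (rule degree_pevp_le)
          fix x assume "poly (pevp B p) x = 0"
          then have "dil x p \<notin> dom" by (rule bezout_root[OF fH AB(1,4) \<rho>])
          then show "s \<le> norm x" using dil_dom_mono[OF True, of x] s(1) by (cases "s \<le> norm x") auto
        qed
        then show ?thesis by (simp add: coeffB0 poly_pevp_1 g_def)
      qed simp
    qed
    moreover have "dil (of_real s) p \<in> dom" using s by auto
    moreover have "(1 - 1 / s) ^ n > 0" using s(1) by simp
    ultimately show ?thesis by auto
  qed
  show thesis by (rule that[OF AB(1-4) k(1), of k]) (use af form nz in \<open>simp_all add: a_def g_def\<close>)
qed

lemma reflection_formI:
  fixes f :: "complex^'n::{finite,linorder} \<Rightarrow> complex"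
  assumes "\<And>p. p \<in> S \<Longrightarrow> g p \<noteq> 0" "\<And>p. p \<in> S \<Longrightarrow> a p = g p * f p"
    and "\<And>p. p $ lst \<noteq> 0 \<Longrightarrow> a p = \<tau> * (p $ lst) ^ k * tilde g p"
  shows "has_reflection_form t S f k \<tau> g" unfolding has_reflection_form_def
proof (intro ballI impI)
  fix p :: "'n cvec" assume p: "p \<in> S" "p \<section> CARD('n) \<noteq> 0"
  have "g p * f p = \<tau> * (p $ lst) ^ k * tilde g p" using assms(2)[OF p(1)] assms(3)[of p] p(2) by simp
  then show "f p = \<tau> * (p \<section> CARD('n)) ^ k * (cnj (g (reflect t (\<chi> i. cnj (p $ i)))) / g p)"
    using assms(1)[OF p(1)] by (simp add: tilde_def field_simps)
qed

lemma poly_dil_series: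
  fixes P :: "complex^'n::{finite,linorder} \<Rightarrow> complex"
  assumes "poly_fun P"
  shows "\<exists>L. \<forall>p c. poly (pevp L p) c = P (dil c p)" using assms
proof (induction rule: poly_fun_induct)
  case (const c)
  show ?case by (rule exI[of _ "[:Pfun (\<lambda>_. c):]"]) (simp add: pevp_const pev_Pfun poly_fun_const)
next
  case (coord i)
  have "pevp (monom (Pfun (\<lambda>p. p $ i)) (wt i)) p = monom (p $ i) (wt i)" for p
    by (simp add: poly_eq_iff coeff_pevp coeff_monom pev_Pfun poly_fun_coord)
  then show ?case by (intro exI[of _ "monom (Pfun (\<lambda>p. p $ i)) (wt i)"]) (simp add: poly_monom dil_nth mult.commute)
next
  case (add g h)
  then obtain L K where "\<And>p c. poly (pevp L p) c = g (dil c p)" "\<And>p c. poly (pevp K p) c = h (dil c p)" by metis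
  then show ?case by (intro exI[of _ "L + K"]) (simp add: pevp_add)
next
  case (mult g h)
  then obtain L K where "\<And>p c. poly (pevp L p) c = g (dil c p)" "\<And>p c. poly (pevp K p) c = h (dil c p)" by metis
  then show ?case by (intro exI[of _ "L * K"]) (simp add: pevp_mult)
qed

lemma fps_pfun_eqI:
  fixes F G :: "'n::{finite,linorder} pfun fps"
  assumes "\<And>p. fpev F p = fpev G p"
  shows "F = G"
proof (rule fps_ext, rule pfun_eqI)
  fix j p
  show "pev (fps_nth F j) p = pev (fps_nth G j) p"
    using arg_cong[OF assms[of p], of "\<lambda>F. fps_nth F j"] by (simp add: fpev_def)
qed

lemma rational_fraction:
  fixes f :: "complex^'n::{finite,linorder} \<Rightarrow> complex"
  assumes "f \<in> H_infinity dom" "poly_fun P" "poly_fun Q" "\<And>p. p \<in> dom \<Longrightarrow> Q p \<noteq> 0 \<and> f p = P p / Q p"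
  obtains A B where "B \<noteq> 0" "fps_of_poly A = fps_of_poly B * tseries f"
proof -
  obtain A where A: "\<And>p c. poly (pevp A p) c = P (dil c p)" using poly_dil_series[OF assms(2)] by blast
  obtain B where B: "\<And>p c. poly (pevp B p) c = Q (dil c p)" using poly_dil_series[OF assms(3)] by blast
  have hol: "holomorphic_several dom f" using assms(1) by (simp add: H_infinity_def)
  have "poly (pevp B 0) 0 \<noteq> 0" unfolding B using assms(4)[OF zero_in_dom] by simp
  then have "B \<noteq> 0" by auto
  moreover have "fps_of_poly A = fps_of_poly B * tseries f"
  proof (rule fps_pfun_eqI)
    fix p :: "'n cvec"
    have "(\<lambda>l. poly (pevp B p) l * f (dil l p)) has_fps_expansion fps_of_poly (pevp B p) * Abs_fps (\<lambda>j. taylor f j p)"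
      by (intro fps_expansion_intros has_fps_expansion_poly has_fps_expansion_taylor[OF hol])
    moreover have "\<forall>\<^sub>F l in nhds 0. dil l p \<in> dom"
      using eventually_nhds_in_open[OF open_dil_dom[of p], of 0] zero_in_dom by simp
    then have "\<forall>\<^sub>F l in nhds 0. poly (pevp A p) l = poly (pevp B p) l * f (dil l p)"
      by (rule eventually_mono) (use A B assms(4) in auto)
    ultimately show "fpev (fps_of_poly A) p = fpev (fps_of_poly B * tseries f) p"
      using has_fps_expansion_unique[OF has_fps_expansion_poly[of "pevp A p"]]
      by (simp add: fpev_mult fpev_tseries[OF assms(1)] flip: fps_of_poly_pevp)
  qed
  ultimately show thesis by (rule that)
qed

end

section \<open>Rational functions that are unimodular on the boundary\<close>

text \<open>The coordinates move one at a time from the circle of radius \<open>r\<close> into the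
  disc; \<open>S\<close> holds those already released. The room between \<open>r\<close> and
  \<open>R\<close> supplies continuity on the closed disc.\<close>

lemma polydisc_max_modulus:
  fixes h :: "complex^'n \<Rightarrow> complex"
  assumes r: "0 < r" "r < R"
    and hol: "\<And>w i. (\<And>j. norm (w $ j) < R) \<Longrightarrow> (\<lambda>x. h (upd w i x)) holomorphic_on ball 0 R"
    and bd: "\<And>w. (\<And>j. norm (w $ j) = r) \<Longrightarrow> norm (h w) \<le> C"
    and w: "\<And>j. norm (w $ j) \<le> r"
  shows "norm (h w) \<le> C"
proof -
  have "finite S \<Longrightarrow> \<forall>w. (\<forall>j. norm (w $ j) \<le> r) \<longrightarrow> (\<forall>j. j \<notin> S \<longrightarrow> norm (w $ j) = r) \<longrightarrow> norm (h w) \<le> C" for S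
  proof (induction S rule: finite_induct)
    case empty
    then show ?case using bd by blast
  next
    case (insert i S)
    show ?case
    proof (intro allI impI)
      fix w :: "complex^'n"
      assume w: "\<forall>j. norm (w $ j) \<le> r" "\<forall>j. j \<notin> insert i S \<longrightarrow> norm (w $ j) = r"
      have "norm (w $ j) < R" for j using w(1) r(2) by (meson le_less_trans)
      then have hol': "(\<lambda>x. h (upd w i x)) holomorphic_on ball 0 R" by (rule hol)
      have "norm (h (upd w i (w $ i))) \<le> C"
      proof (rule max_modulus_disc[of r "\<lambda>x. h (upd w i x)"])
        show "continuous_on (cball 0 r) (\<lambda>x. h (upd w i x))"
          by (rule continuous_on_subset[OF holomorphic_on_imp_continuous_on[OF hol']]) (use r in auto)
        show "(\<lambda>x. h (upd w i x)) holomorphic_on ball 0 r" by (rule holomorphic_on_subset[OF hol']) (use r in auto)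
        show "norm (h (upd w i x)) \<le> C" if "norm x = r" for x using insert.IH w that by auto
      qed (use w r in auto)
      then show "norm (h w) \<le> C" by simp
    qed
  qed
  from this[of UNIV] show ?thesis using w by simp
qed

lemma radius_below_one:
  fixes z :: "complex^'n"
  assumes "\<And>i. norm (z $ i) < 1" "s < 1"
  obtains r where "s < r" "0 < r" "r < 1" "\<And>i. norm (z $ i) \<le> r"
proof -
  define M where "M = Max (range (\<lambda>i. norm (z $ i)))"
  have M: "norm (z $ i) \<le> M" for i unfolding M_def by (rule Max_ge) auto
  have "M \<in> range (\<lambda>i. norm (z $ i))" unfolding M_def by (rule Max_in) auto
  then have "M < 1" using assms(1) by auto
  then obtain r where "max (max s 0) M < r" "r < 1" using dense[of "max (max s 0) M" 1] assms(2) by auto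
  then show thesis using M by (intro that[of r]) (auto intro: order.trans less_imp_le)
qed

context weights
begin

lemma theta_polydisc: "(\<And>i. norm (z $ i) < 1) \<Longrightarrow> theta z \<in> dom"
  by (auto simp: basic_domain_def polydisc_def)

lemma sphere_theta:
  fixes w :: "complex^'n::{finite,linorder}"
  assumes "r > 0" "\<And>j. norm (w $ j) = r"
  obtains q where "q \<in> bdry" "theta w = dil (of_real r) q"
proof -
  define z where "z = (\<chi> j. w $ j / of_real r)"
  have "z \<in> torus" using assms by (simp add: torus_def z_def norm_divide)
  moreover have "w = of_real r *s z" using assms(1) by (simp add: vec_eq_iff z_def)
  ultimately show thesis by (intro that[of "theta z"]) (auto simp: bdry_def dil_theta)
qed

lemma poly_fun_upd_theta:
  fixes g :: "complex^'n::{finite,linorder} \<Rightarrow> complex"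
  assumes "poly_fun g"
  shows "\<exists>q. \<forall>x. g (theta (upd w i x)) = poly q x" by (rule poly_fun_upd[OF poly_fun_compose_theta[OF assms]])

text \<open>The polydisc around a preimage of \<open>p\<close> may be taken as large as desired, so
  the bound is asked only for radii beyond \<open>s\<close>. Sets with all coordinates of modulus
  \<open>r\<close> are mapped by \<open>theta\<close> to dilated boundary points.\<close>

lemma quotient_max_principle:
  fixes P Q :: "complex^'n::{finite,linorder} \<Rightarrow> complex"
  assumes P: "poly_fun P" and Q: "poly_fun Q" and nz: "\<And>p. p \<in> dom \<Longrightarrow> Q p \<noteq> 0" and s: "s < 1"
    and le: "\<And>q r. q \<in> bdry \<Longrightarrow> s < r \<Longrightarrow> 0 < r \<Longrightarrow> r < 1 \<Longrightarrow> norm (P (dil (of_real r) q)) \<le> C * norm (Q (dil (of_real r) q))"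
    and p: "p \<in> dom"
  shows "norm (P p) \<le> C * norm (Q p)"
proof -
  obtain z where z: "p = theta z" "\<And>i. norm (z $ i) < 1" using p by (auto simp: basic_domain_def polydisc_def)
  obtain r where r: "s < r" "0 < r" "r < 1" "\<And>i. norm (z $ i) \<le> r" using radius_below_one[OF z(2) s] by metis
  have "norm (P (theta z) / Q (theta z)) \<le> C"
  proof (rule polydisc_max_modulus[OF r(2,3), of "\<lambda>w. P (theta w) / Q (theta w)"])
    fix w :: "'n cvec" and i assume w: "\<And>j. norm (w $ j) < 1"
    obtain a where a: "\<And>x. P (theta (upd w i x)) = poly a x" using poly_fun_upd_theta[OF P] by blast
    obtain b where b: "\<And>x. Q (theta (upd w i x)) = poly b x" using poly_fun_upd_theta[OF Q] by blast
    have "poly b x \<noteq> 0" if "norm x < 1" for x using nz[OF theta_polydisc[of "upd w i x"]] w that b by auto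
    then show "(\<lambda>x. P (theta (upd w i x)) / Q (theta (upd w i x))) holomorphic_on ball 0 1"
      unfolding a b by (intro holomorphic_intros) auto
  next
    fix w :: "'n cvec" assume "\<And>j. norm (w $ j) = r"
    then obtain q where q: "q \<in> bdry" "theta w = dil (of_real r) q" using sphere_theta r(2) by blast
    have "theta w \<in> dom" unfolding q(2) using r by (intro dil_bdry[OF q(1)]) simp
    then show "norm (P (theta w) / Q (theta w)) \<le> C"
      using le[OF q(1) r(1-3)] nz[of "theta w"] by (simp add: norm_divide divide_le_eq q(2))
  qed (rule r(4))
  then show ?thesis using nz[OF p] by (simp add: z(1) norm_divide divide_le_eq)
qed

text \<open>\<open>P\<close> and \<open>Q\<close> may vanish together on the boundary, so the
  quotient need not extend continuously. Orbits of boundary points are treated by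
  \<open>poly_le_in_disc\<close>, which divides out such zeros.\<close>

lemma rational_le_1:
  fixes P Q :: "complex^'n::{finite,linorder} \<Rightarrow> complex"
  assumes P: "poly_fun P" and Q: "poly_fun Q" and nz: "\<And>p. p \<in> dom \<Longrightarrow> Q p \<noteq> 0"
    and eq: "\<And>q. q \<in> bdry \<Longrightarrow> norm (P q) = norm (Q q)" and p: "p \<in> dom"
  shows "norm (P p / Q p) \<le> 1"
proof -
  have slice: "norm (P (dil x q)) \<le> norm (Q (dil x q))" if q: "q \<in> bdry" and x: "norm x < 1" for q x
  proof -
    obtain a where a: "\<And>x. P (dil x q) = poly a x" using poly_fun_curve[OF P dil_curve] by blast
    obtain b where b: "\<And>x. Q (dil x q) = poly b x" using poly_fun_curve[OF Q dil_curve] by blast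
    have "norm (poly a x) \<le> norm (poly b x)"
    proof (rule poly_le_in_disc[OF _ _ x])
      show "poly b y \<noteq> 0" if "norm y < 1" for y using nz[OF dil_bdry[OF q that]] b by simp
      show "norm (poly a y) = norm (poly b y)" if "norm y = 1" for y using eq[OF dil_bdry_bdry[OF q that]] a b by simp
    qed
    then show ?thesis by (simp add: a b)
  qed
  have "norm (P p) \<le> 1 * norm (Q p)" by (rule quotient_max_principle[OF P Q nz zero_less_one _ p]) (use slice in auto)
  then show ?thesis using nz[OF p] by (simp add: norm_divide)
qed

lemma rational_holomorphic:
  fixes P Q :: "complex^'n::{finite,linorder} \<Rightarrow> complex"
  assumes P: "poly_fun P" and Q: "poly_fun Q" and f: "\<And>p. p \<in> dom \<Longrightarrow> Q p \<noteq> 0 \<and> f p = P p / Q p"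
  shows "holomorphic_several dom f" unfolding holomorphic_several_def
proof
  fix z :: "'n cvec" assume z: "z \<in> dom"
  obtain D where D: "(P has_derivative D) (at z)" "\<And>c v. D (c *s v) = c * D v" using poly_fun_has_derivative[OF P] by blast
  obtain E where E: "(Q has_derivative E) (at z)" "\<And>c v. E (c *s v) = c * E v" using poly_fun_has_derivative[OF Q] by blast
  have Qz: "Q z \<noteq> 0" using f[OF z] by simp
  have "((\<lambda>p. P p / Q p) has_derivative (\<lambda>v. (D v * Q z - P z * E v) / (Q z * Q z))) (at z)"
    by (rule has_derivative_divide'[OF D(1) E(1) Qz])
  then have "(f has_derivative (\<lambda>v. (D v * Q z - P z * E v) / (Q z * Q z))) (at z)"
    by (rule has_derivative_transform_within_open[OF _ open_dom z]) (use f in auto)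
  then show "\<exists>D. (f has_derivative D) (at z) \<and> (\<forall>c v. D (c *s v) = c * D v)"
    by (intro exI conjI) (assumption, simp add: D E algebra_simps)
qed

lemma rational_unimodular_inner:
  fixes P Q :: "complex^'n::{finite,linorder} \<Rightarrow> complex"
  assumes P: "poly_fun P" and Q: "poly_fun Q" and f: "\<And>p. p \<in> dom \<Longrightarrow> Q p \<noteq> 0 \<and> f p = P p / Q p"
    and eq: "\<And>q. q \<in> bdry \<Longrightarrow> norm (P q) = norm (Q q)"
  shows "inner_fun m t f"
proof -
  have "norm (f p) \<le> 1" if "p \<in> dom" for p using rational_le_1[OF P Q _ eq that] f that by auto
  then have "bounded (f ` dom)" by (auto simp: bounded_iff)
  \<comment> \<open>\<open>Q\<close> may have zeros on the boundary, but by
    \<open>AE_boundary_nonzero\<close> they form a null set.\<close>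
  have Q0: "Q 0 \<noteq> 0" using f[OF zero_in_dom] by simp
  have "f \<in> H_infinity dom" using \<open>bounded (f ` dom)\<close> rational_holomorphic[OF P Q f] by (simp add: H_infinity_def)
  moreover have "AE q in boundary_measure m t. \<exists>w. has_boundary_value m t f q w \<and> norm w = 1"
    using AE_bdry AE_boundary_nonzero[OF Q Q0]
  proof (eventually_elim)
    fix q :: "'n cvec" assume q: "q \<in> bdry" and Qq: "Q q \<noteq> 0"
    have lim: "((\<lambda>r. g (dil (of_real r) q)) \<longlongrightarrow> g q) (at_left (1::real))" if g: "poly_fun g" for g
    proof -
      obtain a where a: "\<And>x. g (dil x q) = poly a x" using poly_fun_curve[OF g dil_curve] by blast
      have "((\<lambda>r. poly a (of_real r)) \<longlongrightarrow> poly a (of_real 1)) (at_left (1::real))"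
        by (intro tendsto_intros)
      then show ?thesis using a[of 1] by (simp add: a)
    qed
    have "((\<lambda>r. P (dil (of_real r) q) / Q (dil (of_real r) q)) \<longlongrightarrow> P q / Q q) (at_left (1::real))"
      by (intro tendsto_divide lim P Q Qq)
    moreover have "\<forall>\<^sub>F r in at_left (1::real). P (dil (of_real r) q) / Q (dil (of_real r) q) = f (dil (of_real r) q)"
      by (rule eventually_mono[OF eventually_at_left_real[of 0 1]]) (use f dil_bdry[OF q] in auto)
    ultimately have "((\<lambda>r. f (dil (of_real r) q)) \<longlongrightarrow> P q / Q q) (at_left (1::real))"
      by (rule Lim_transform_eventually)
    then show "\<exists>w. has_boundary_value m t f q w \<and> norm w = 1"
      using eq[OF q] Qq by (intro exI[of _ "P q / Q q"]) (simp add: has_boundary_value_def dilate_eq_dil norm_divide)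
  qed
  ultimately show ?thesis by (simp add: inner_fun_def)
qed

lemma reflection_form_unimodular:
  fixes P Q :: "complex^'n::{finite,linorder} \<Rightarrow> complex"
  assumes P: "poly_fun P" and Q: "poly_fun Q" and f: "\<And>p. p \<in> dom \<Longrightarrow> Q p \<noteq> 0 \<and> f p = P p / Q p"
    and \<tau>: "norm \<tau> = 1" and g: "poly_fun g" "\<And>p. p \<in> dom \<Longrightarrow> g p \<noteq> 0"
    and form: "has_reflection_form t dom f k \<tau> g" and q: "q \<in> bdry"
  shows "norm (P q) = norm (Q q)"
proof -
  obtain M g' where g': "poly_fun g'" "\<And>p. p $ lst \<noteq> 0 \<Longrightarrow> g' p = (p $ lst) ^ M * tilde g p"
    using tilde_poly[OF g(1)] by blast
  \<comment> \<open>The reflection form is silent where \<open>p $ lst = 0\<close>. The extra factor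
    makes \<open>R\<close> vanish there too, hence on the whole domain and therefore on the
    boundary.\<close>
  define R where "R p = p $ lst * ((p $ lst) ^ M * P p * g p - \<tau> * (p $ lst) ^ k * g' p * Q p)" for p
  have "poly_fun R" unfolding R_def by (intro poly_fun_mult poly_fun_diff poly_fun_power poly_fun_coord poly_fun_const P Q g g')
  moreover have "R p = 0" if p: "p \<in> dom" for p
  proof (cases "p $ lst = 0")
    case False
    have "P p / Q p = \<tau> * (p $ lst) ^ k * (tilde g p / g p)"
      using form p False f[OF p] by (auto simp: has_reflection_form_def tilde_def)
    then have "P p * g p = \<tau> * (p $ lst) ^ k * tilde g p * Q p" using f[OF p] g(2)[OF p] by (simp add: field_simps)
    then show ?thesis using g'(2)[OF False] by (simp add: R_def)
  qed (simp add: R_def)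
  ultimately have R: "R p = 0" for p using poly_fun_zero_dom by blast
  show ?thesis
  proof (rule bdry_closed_property[OF g(1) g(2)[OF zero_in_dom] _ _ q])
    show "closed {q. norm (P q) = norm (Q q)}" by (intro closed_Collect_eq continuous_intros poly_fun_continuous P Q)
    fix q :: "'n cvec" assume q: "q \<in> bdry" and gq: "g q \<noteq> 0"
    have n: "norm (q $ lst) = 1" by (rule norm_lst_bdry[OF q])
    then have q0: "q $ lst \<noteq> 0" by auto
    have "(q $ lst) ^ M * P q * g q = \<tau> * (q $ lst) ^ k * ((q $ lst) ^ M * cnj (g q)) * Q q"
      using R[of q] q0 g'(2)[OF q0] tilde_bdry[OF q] by (simp add: R_def)
    from arg_cong[OF this, of norm] show "norm (P q) = norm (Q q)" using n \<tau> gq by (simp add: norm_mult norm_power)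
  qed
qed

section \<open>Inner functions continuous up to the boundary\<close>

text \<open>Uniform continuity on the compact set \<open>{0..1} \<times> bdry\<close> covers real
  factors; a complex factor is a real one times a rotation, and rotations preserve the
  boundary.\<close>

lemma uniformly_large_near_bdry:
  fixes F :: "complex^'n::{finite,linorder} \<Rightarrow> complex"
  assumes cont: "continuous_on (closure dom) F" and low: "\<And>q. q \<in> bdry \<Longrightarrow> c \<le> norm (F q)" and c: "c > 0"
  obtains r where "0 < r" "r < 1" "\<And>q x. q \<in> bdry \<Longrightarrow> r \<le> norm x \<Longrightarrow> norm x \<le> 1 \<Longrightarrow> c / 2 \<le> norm (F (dil x q))"
proof -
  have "continuous_on ({0..1} \<times> bdry) (\<lambda>x :: real \<times> 'n cvec. F (dil (of_real (fst x)) (snd x)))"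
    by (rule continuous_on_compose2[OF cont]) (auto intro!: continuous_intros dil_bdry_closure)
  then have "uniformly_continuous_on ({0..1} \<times> bdry) (\<lambda>x :: real \<times> 'n cvec. F (dil (of_real (fst x)) (snd x)))"
    by (intro compact_uniformly_continuous compact_Times compact_bdry) auto
  then obtain d where d: "d > 0" "\<And>x y :: real \<times> 'n cvec.
      x \<in> {0..1} \<times> bdry \<Longrightarrow> y \<in> {0..1} \<times> bdry \<Longrightarrow> dist y x < d \<Longrightarrow>
      dist (F (dil (of_real (fst y)) (snd y))) (F (dil (of_real (fst x)) (snd x))) < c / 2"
    unfolding uniformly_continuous_on_def using c by (meson half_gt_zero)
  define r where "r = max (1 - d / 2) (1 / 2)"
  have r: "0 < r" "r < 1" "1 - d < r" using d(1) by (auto simp: r_def)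
  show thesis
  proof (rule that[OF r(1,2)])
    fix q :: "'n cvec" and x :: complex
    assume q: "q \<in> bdry" and x: "r \<le> norm x" "norm x \<le> 1"
    define u where "u = x / norm x"
    have "x \<noteq> 0" using x r by auto
    then have u: "norm u = 1" "x = norm x * u" by (auto simp: u_def norm_divide)
    define q' where "q' = dil u q"
    have q': "q' \<in> bdry" unfolding q'_def by (rule dil_bdry_bdry[OF q u(1)])
    have xq: "dil x q = dil (of_real (norm x)) q'" unfolding q'_def dil_mult using u(2) by simp
    have "dist (F (dil (of_real (norm x)) q')) (F (dil (of_real 1) q')) < c / 2"
      using d(2)[of "(1, q')" "(norm x, q')"] q' x r by (simp add: dist_Pair_Pair dist_real_def)
    then have "norm (F q' - F (dil x q)) < c / 2" by (simp add: xq dist_norm norm_minus_commute)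
    then show "c / 2 \<le> norm (F (dil x q))" using low[OF q'] norm_triangle_ineq2[of "F q'" "F (dil x q)"] by linarith
  qed
qed

lemma nonvanishing_closure:
  fixes g :: "complex^'n::{finite,linorder} \<Rightarrow> complex"
  assumes g: "poly_fun g" and nz: "\<And>p. p \<in> dom \<Longrightarrow> g p \<noteq> 0"
    and low: "\<And>q. q \<in> bdry \<Longrightarrow> c \<le> norm (g q)" and c: "c > 0" and p: "p \<in> closure dom"
  shows "g p \<noteq> 0"
proof -
  obtain s where s: "0 < s" "s < 1" "\<And>q x. q \<in> bdry \<Longrightarrow> s \<le> norm x \<Longrightarrow> norm x \<le> 1 \<Longrightarrow> c / 2 \<le> norm (g (dil x q))"
    using uniformly_large_near_bdry[OF poly_fun_continuous[OF g] low c] by blast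
  have "c / 2 \<le> norm (g p)" if p: "p \<in> dom" for p
  proof -
    \<comment> \<open>The maximum principle for \<open>1 / g\<close>, which is bounded by
      \<open>2 / c\<close> on the dilated boundaries of radius beyond \<open>s\<close>.\<close>
    have "norm (1::complex) \<le> 2 / c * norm (g p)"
    proof (rule quotient_max_principle[OF poly_fun_const g nz s(2) _ p])
      fix q :: "'n cvec" and r :: real
      assume "q \<in> bdry" "s < r" "0 < r" "r < 1"
      then have "c / 2 \<le> norm (g (dil (of_real r) q))" by (intro s(3)) auto
      then show "norm (1::complex) \<le> 2 / c * norm (g (dil (of_real r) q))" using c by (simp add: field_simps)
    qed
    then show ?thesis using c by (simp add: field_simps)
  qed
  moreover have "closed {p. c / 2 \<le> norm (g p)}" by (intro closed_Collect_le continuous_intros poly_fun_continuous g)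
  ultimately have "closure dom \<subseteq> {p. c / 2 \<le> norm (g p)}" by (intro closure_minimal) auto
  then show ?thesis using p c by auto
qed

lemma inner_unimodular_bdry:
  fixes f :: "complex^'n::{finite,linorder} \<Rightarrow> complex"
  assumes f: "inner_fun m t f" and cont: "continuous_on (closure dom) f" and q: "q \<in> bdry"
  shows "norm (f q) = 1"
proof (rule bdry_closed_AE[where R = "\<lambda>q. \<exists>w. has_boundary_value m t f q w \<and> norm w = 1", OF _ _ _ q])
  have "continuous_on bdry (\<lambda>q. norm (f q))"
    by (intro continuous_intros continuous_on_subset[OF cont bdry_subset_closure])
  then have "closed (bdry \<inter> (\<lambda>q. norm (f q)) -` {1})"
    by (intro continuous_closed_preimage compact_imp_closed compact_bdry) auto
  then show "closed {q\<in>bdry. norm (f q) = 1}" by (simp add: Int_def)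
  show "AE q in boundary_measure m t. \<exists>w. has_boundary_value m t f q w \<and> norm w = 1"
    using f by (simp add: inner_fun_def)
  fix q :: "'n cvec" assume q: "q \<in> bdry" and "\<exists>w. has_boundary_value m t f q w \<and> norm w = 1"
  then obtain w where w: "((\<lambda>r. f (dil (of_real r) q)) \<longlongrightarrow> w) (at_left 1)" "norm w = 1"
    by (auto simp: has_boundary_value_def dilate_eq_dil)
  have "continuous_on {0..1} (\<lambda>r :: real. f (dil (of_real r) q))"
    by (intro continuous_on_compose2[OF cont]) (use q in \<open>auto intro!: continuous_intros dil_bdry_closure\<close>)
  then have "((\<lambda>r. f (dil (of_real r) q)) \<longlongrightarrow> f (dil (of_real 1) q)) (at 1 within {0..1::real})"
    unfolding continuous_on_def by (auto simp del: of_real_1)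
  then have "((\<lambda>r. f (dil (of_real r) q)) \<longlongrightarrow> f q) (at_left (1::real))"
    by (simp add: at_within_Icc_at_left)
  then have "f q = w" using w(1) by (rule tendsto_unique[rotated]) simp
  then show "norm (f q) = 1" using w(2) by simp
qed

end

text \<open>The proof is Gaussian elimination without division. In the application the second alternative
  is excluded by the values at the boundary points.\<close>

lemma annihilator_or_generic_rank:
  fixes V :: "(nat \<Rightarrow> 'n::finite pfun) set"
  shows "(\<exists>b. (\<exists>i<M. b i \<noteq> 0) \<and> (\<forall>v\<in>V. (\<Sum>i<M. b i * v i) = 0)) \<or>
    (\<exists>\<delta>. \<delta> \<noteq> 0 \<and> (\<forall>q c. pev \<delta> q \<noteq> 0 \<longrightarrow> (\<forall>v\<in>V. (\<Sum>i<M. c i * pev (v i) q) = 0) \<longrightarrow> (\<forall>i<M. c i = 0)))"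
proof (induction M arbitrary: V)
  case 0
  show ?case by (intro disjI2 exI[of _ 1]) simp
next
  case (Suc M)
  show ?case
  proof (cases "\<forall>v\<in>V. v M = 0")
    case True
    then show ?thesis by (intro disjI1 exI[of _ "\<lambda>i. if i = M then 1 else 0"]) auto
  next
    case False
    then obtain u where u: "u \<in> V" "u M \<noteq> 0" by blast
    \<comment> \<open>Cross multiplication with the pivot \<open>u M\<close>: entry \<open>M\<close>
      of \<open>T v\<close> is zero.\<close>
    define T where "T v = (\<lambda>i. u M * v i - v M * u i)" for v
    consider b where "\<exists>i<M. b i \<noteq> 0" "\<And>v. v \<in> V \<Longrightarrow> (\<Sum>i<M. b i * T v i) = 0"
      | \<delta> where "\<delta> \<noteq> 0" "\<And>q c. pev \<delta> q \<noteq> 0 \<Longrightarrow> (\<forall>v\<in>V. (\<Sum>i<M. c i * pev (T v i) q) = 0) \<Longrightarrow> (\<forall>i<M. c i = 0)"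
      using Suc.IH[of "T ` V"] by auto
    then show ?thesis
    proof cases
      case 1
      \<comment> \<open>A relation for the vectors \<open>T v\<close> is read as one for
        \<open>v\<close>; the last coefficient collects the terms with \<open>v M\<close>.\<close>
      define b' where "b' i = (if i < M then u M * b i else - (\<Sum>i<M. b i * u i))" for i
      have "(\<Sum>i<Suc M. b' i * v i) = 0" if v: "v \<in> V" for v
      proof -
        have "(\<Sum>i<Suc M. b' i * v i) = (\<Sum>i<M. u M * b i * v i) - (\<Sum>i<M. b i * u i) * v M" by (simp add: b'_def)
        also have "\<dots> = (\<Sum>i<M. b i * T v i)"
          by (simp add: T_def sum_distrib_left right_diff_distrib sum_subtractf ac_simps)
        finally show ?thesis using 1(2)[OF v] by simp
      qed
      moreover have "\<exists>i<Suc M. b' i \<noteq> 0" using 1(1) u(2) by (auto simp: b'_def intro: less_SucI)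
      ultimately show ?thesis by blast
    next
      case 2
      have "\<forall>i<Suc M. c i = 0" if d: "pev (\<delta> * u M) q \<noteq> 0" and c: "\<forall>v\<in>V. (\<Sum>i<Suc M. c i * pev (v i) q) = 0" for q c
      proof -
        have "(\<Sum>i<M. c i * pev (T v i) q) = 0" if v: "v \<in> V" for v
        proof -
          have "(\<Sum>i<M. c i * pev (T v i) q) = pev (u M) q * (\<Sum>i<M. c i * pev (v i) q) - pev (v M) q * (\<Sum>i<M. c i * pev (u i) q)"
            by (simp add: T_def sum_distrib_left algebra_simps sum_subtractf)
          also have "\<dots> = pev (u M) q * (\<Sum>i<Suc M. c i * pev (v i) q) - pev (v M) q * (\<Sum>i<Suc M. c i * pev (u i) q)"
            by (simp add: algebra_simps)
          finally show ?thesis using c v u(1) by simp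
        qed
        then have 0: "\<forall>i<M. c i = 0" using 2(2)[of q c] d by simp
        have "(\<Sum>i<Suc M. c i * pev (u i) q) = c M * pev (u M) q" using 0 by simp
        moreover have "(\<Sum>i<Suc M. c i * pev (u i) q) = 0" using c u(1) by blast
        ultimately have "c M = 0" using d by simp
        then show ?thesis using 0 less_Suc_eq by auto
      qed
      moreover have "\<delta> * u M \<noteq> 0" using 2(1) u(2) by simp
      ultimately show ?thesis by blast
    qed
  qed
qed

context weights
begin

lemma slice_fps:
  fixes f :: "complex^'n::{finite,linorder} \<Rightarrow> complex"
  assumes "f \<in> H_infinity dom" "\<And>x. norm x < 1 \<Longrightarrow> poly B x * f (dil x q) = poly A x"
  shows "fps_of_poly A = fps_of_poly B * fpev (tseries f) q"
proof -
  have hol: "holomorphic_several dom f" using assms(1) by (simp add: H_infinity_def)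
  have "(\<lambda>l. poly B l * f (dil l q)) has_fps_expansion fps_of_poly B * Abs_fps (\<lambda>j. taylor f j q)"
    by (intro fps_expansion_intros has_fps_expansion_poly has_fps_expansion_taylor[OF hol])
  moreover have "\<forall>\<^sub>F x in nhds 0. poly A x = poly B x * f (dil x q)"
    by (rule eventually_mono[OF eventually_nhds_in_open[of "ball 0 1" "0::complex"]]) (use assms(2) in auto)
  ultimately show ?thesis
    using has_fps_expansion_unique[OF has_fps_expansion_poly[of A]] by (simp add: fpev_tseries[OF assms(1)])
qed

lemma disc_algebra_inner:
  fixes f :: "complex^'n::{finite,linorder} \<Rightarrow> complex"
  assumes f: "inner_fun m t f" and fd: "f \<in> disc_algebra dom"
  obtains a g k \<tau> where "poly_fun a" "poly_fun g" "norm \<tau> = 1" "\<And>p. p \<in> closure dom \<Longrightarrow> g p \<noteq> 0"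
    "\<And>p. p \<in> closure dom \<Longrightarrow> a p = g p * f p" "\<And>p. p $ lst \<noteq> 0 \<Longrightarrow> a p = \<tau> * (p $ lst) ^ k * tilde g p"
proof -
  have cont: "continuous_on (closure dom) f" and hol: "holomorphic_several dom f" using fd by (auto simp: disc_algebra_def)
  have fH: "f \<in> H_infinity dom" using f by (simp add: inner_fun_def)
  have uni: "norm (f q) = 1" if "q \<in> bdry" for q by (rule inner_unimodular_bdry[OF f cont that])
  obtain r where r: "0 < r" "r < 1" "\<And>q x. q \<in> bdry \<Longrightarrow> r \<le> norm x \<Longrightarrow> norm x \<le> 1 \<Longrightarrow> 1 / 2 \<le> norm (f (dil x q))"
    using uniformly_large_near_bdry[OF cont, of 1] uni by auto
  obtain N where N: "\<And>\<phi>. continuous_on (cball 0 1) \<phi> \<longrightarrow> \<phi> holomorphic_on ball 0 1 \<longrightarrow>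
    (\<forall>x. norm x = 1 \<longrightarrow> norm (\<phi> x) = 1) \<longrightarrow> (\<forall>x. r \<le> norm x \<longrightarrow> norm x \<le> 1 \<longrightarrow> 1 / 2 \<le> norm (\<phi> x)) \<longrightarrow>
    (\<exists>A B. disc_fraction r N \<phi> A B)" using finite_Blaschke[OF r(1,2)] by auto
  have slice: "\<exists>A B. disc_fraction r N (\<lambda>x. f (dil x q)) A B"
    if q: "q \<in> bdry" for q
  proof (rule N[rule_format])
    show "continuous_on (cball 0 1) (\<lambda>x. f (dil x q))"
      by (intro continuous_on_compose2[OF cont]) (use q in \<open>auto intro!: continuous_intros dil_bdry_closure\<close>)
    show "(\<lambda>x. f (dil x q)) holomorphic_on ball 0 1"
      by (rule holomorphic_on_subset[OF holomorphic_dil[OF hol]]) (use dil_bdry[OF q] in auto)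
  qed (use uni dil_bdry_bdry[OF q] r(3)[OF q] in auto)
  define F where "F = tseries f"
  \<comment> \<open>Rows of the Hankel matrix, read backwards: \<open>b\<close> annihilates all of
    them iff the polynomial with the coefficients \<open>b 0, ..., b N\<close> times
    \<open>F\<close> has no terms beyond degree \<open>N\<close>.\<close>
  define V where "V = {\<lambda>i. fps_nth F (j - i) | j. j > N}"
  \<comment> \<open>At a boundary point the denominator of the Blaschke product on its orbit is a
    nonzero solution of the evaluated system.\<close>
  have "\<not> (\<exists>\<delta>. \<delta> \<noteq> 0 \<and> (\<forall>q c. pev \<delta> q \<noteq> 0 \<longrightarrow> (\<forall>v\<in>V. (\<Sum>i<Suc N. c i * pev (v i) q) = 0) \<longrightarrow> (\<forall>i<Suc N. c i = 0)))"
  proof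
    assume "\<exists>\<delta>. \<delta> \<noteq> 0 \<and> (\<forall>q c. pev \<delta> q \<noteq> 0 \<longrightarrow> (\<forall>v\<in>V. (\<Sum>i<Suc N. c i * pev (v i) q) = 0) \<longrightarrow> (\<forall>i<Suc N. c i = 0))"
    then obtain \<delta> where \<delta>: "\<delta> \<noteq> 0"
      "\<And>q c. pev \<delta> q \<noteq> 0 \<Longrightarrow> (\<forall>v\<in>V. (\<Sum>i<Suc N. c i * pev (v i) q) = 0) \<Longrightarrow> (\<forall>i<Suc N. c i = 0)" by blast
    have "\<exists>q\<in>bdry. pev \<delta> q \<noteq> 0"
    proof (rule ccontr)
      assume "\<not> ?thesis"
      then have "pev \<delta> q = 0" if "q \<in> bdry" for q using that by blast
      then have "pev \<delta> p = 0" for p by (rule poly_fun_zero_bdry[OF poly_fun_pev])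
      then show False using \<delta>(1) pev_nonzero by blast
    qed
    then obtain q where q: "q \<in> bdry" "pev \<delta> q \<noteq> 0" by blast
    obtain A B where AB: "degree A \<le> N" "degree B \<le> N" "B \<noteq> 0" "\<And>x. norm x < 1 \<Longrightarrow> poly B x * f (dil x q) = poly A x"
      using slice[OF q(1)] unfolding disc_fraction_def by blast
    have eq: "fps_of_poly A = fps_of_poly B * fpev F q" unfolding F_def by (rule slice_fps[OF fH AB(4)])
    have "\<forall>v\<in>V. (\<Sum>i<Suc N. coeff B i * pev (v i) q) = 0"
    proof
      fix v assume "v \<in> V"
      then obtain j where j: "j > N" "v = (\<lambda>i. fps_nth F (j - i))" by (auto simp: V_def)
      have "(\<Sum>i<Suc N. coeff B i * pev (v i) q) = (\<Sum>i=0..j. coeff B i * pev (fps_nth F (j - i)) q)"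
        unfolding j(2) using j(1) AB(2) by (intro sum.mono_neutral_left) (auto simp: coeff_eq_0)
      also have "\<dots> = fps_nth (fps_of_poly A) j" unfolding eq by (simp add: fps_mult_nth fpev_def)
      also have "\<dots> = 0" using AB(1) j(1) by (simp add: coeff_eq_0)
      finally show "(\<Sum>i<Suc N. coeff B i * pev (v i) q) = 0" .
    qed
    then have z: "\<forall>i<Suc N. coeff B i = 0" using \<delta>(2)[OF q(2), of "coeff B"] by blast
    have "coeff B i = 0" for i using z AB(2) by (cases "i < Suc N") (auto simp: coeff_eq_0)
    then have "B = 0" by (simp add: poly_eq_iff)
    then show False using AB(3) by simp
  qed
  then obtain b where b: "\<exists>i<Suc N. b i \<noteq> 0" "\<And>v. v \<in> V \<Longrightarrow> (\<Sum>i<Suc N. b i * v i) = 0"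
    using annihilator_or_generic_rank[of "Suc N" V] by blast
  define B0 where "B0 = (\<Sum>i<Suc N. monom (b i) i)"
  have cB0: "coeff B0 i = (if i < Suc N then b i else 0)" for i unfolding B0_def coeff_sum by simp
  have "B0 \<noteq> 0" using b(1) cB0 by (metis coeff_0)
  define G where "G = fps_of_poly B0 * F"
  define A0 where "A0 = (\<Sum>j\<le>N. monom (fps_nth G j) j)"
  have "fps_of_poly A0 = fps_of_poly B0 * tseries f"
  proof (rule fps_ext)
    fix j
    have "fps_nth G j = 0" if j: "j > N"
    proof -
      have "fps_nth G j = (\<Sum>i=0..j. coeff B0 i * fps_nth F (j - i))" by (simp add: G_def fps_mult_nth)
      also have "\<dots> = (\<Sum>i<Suc N. b i * fps_nth F (j - i))"
        using j by (intro sum.mono_neutral_cong_right) (auto simp: cB0)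
      also have "\<dots> = 0" using j b(2)[of "\<lambda>i. fps_nth F (j - i)"] by (auto simp: V_def)
      finally show ?thesis .
    qed
    moreover have "coeff A0 j = (if j \<le> N then fps_nth G j else 0)" unfolding A0_def coeff_sum by simp
    ultimately show "fps_nth (fps_of_poly A0) j = fps_nth (fps_of_poly B0 * tseries f) j" by (auto simp: G_def F_def)
  qed
  then obtain A B U W \<rho> k \<tau> where AB:
    "fps_of_poly A = fps_of_poly B * tseries f" "coeff B 0 = 1" "\<rho> \<noteq> 0" "U * A + W * B = [:\<rho>:]"
    and \<tau>: "norm \<tau> = 1" and nz: "\<And>p. p \<in> dom \<Longrightarrow> pev (poly B 1) p \<noteq> 0"
    and af: "\<And>p. p \<in> dom \<Longrightarrow> pev (poly A 1) p = pev (poly B 1) p * f p"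
    and form: "\<And>p. p $ lst \<noteq> 0 \<Longrightarrow> pev (poly A 1) p = \<tau> * (p $ lst) ^ k * tilde (pev (poly B 1)) p"
    by (rule inner_fraction[OF f \<open>B0 \<noteq> 0\<close>]) (rule that; blast)
  obtain v where v: "pev \<rho> v \<noteq> 0" using AB(3) pev_nonzero by blast
  define n where "n = degree B"
  \<comment> \<open>Cross multiplication with the Blaschke fraction \<open>A' / B'\<close> and the
    Bezout identity show that roots of \<open>pevp B q\<close> are roots of \<open>B'\<close>, so
    they have modulus at least \<open>1 / r\<close>. Then \<open>poly_lower_bound\<close> with
    \<open>1 / r\<close> gives a constant independent of \<open>q\<close>.\<close>
  have low: "(1 - r) ^ n \<le> norm (pev (poly B 1) q)" if q: "q \<in> bdry" for q
  proof (rule bdry_closed_property[OF poly_fun_pev v _ _ q])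
    show "closed {q. (1 - r) ^ n \<le> norm (pev (poly B 1) q)}"
      by (intro closed_Collect_le continuous_intros poly_fun_continuous poly_fun_pev)
    fix q :: "'n cvec" assume q: "q \<in> bdry" and \<rho>q: "pev \<rho> q \<noteq> 0"
    obtain A' B' where A'B': "\<And>x. norm x < 1 \<Longrightarrow> poly B' x * f (dil x q) = poly A' x"
        "\<And>x. poly B' x = 0 \<Longrightarrow> 1 / r \<le> norm x" using slice[OF q] unfolding disc_fraction_def by blast
    have "pevp A q * B' - pevp B q * A' = 0"
    proof (rule ccontr)
      assume ne: "pevp A q * B' - pevp B q * A' \<noteq> 0"
      have "poly (pevp A q * B' - pevp B q * A') x = 0" if "norm x < 1" for x
        using pair_identity[OF fH AB(1) dil_bdry[OF q that]] A'B'(1)[OF that, symmetric] by simp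
      then have "ball 0 1 \<subseteq> {x. poly (pevp A q * B' - pevp B q * A') x = 0}" by auto
      then have "finite (ball (0::complex) 1)" using poly_roots_finite[OF ne] finite_subset by blast
      then show False using uncountable_ball[of 1 "0::complex"] countable_finite by auto
    qed
    then have id: "pevp A q * B' = pevp B q * A'" by simp
    have "(1 - 1 / (1 / r)) ^ n * norm (coeff (pevp B q) 0) \<le> norm (poly (pevp B q) 1)"
    proof (rule poly_lower_bound)
      show "degree (pevp B q) \<le> n" unfolding n_def by (rule degree_pevp_le)
      show "1 < 1 / r" using r by simp
      fix x assume x: "poly (pevp B q) x = 0"
      have "poly (pevp A q) x \<noteq> 0"
      proof
        assume "poly (pevp A q) x = 0"
        then have "poly (pevp (U * A + W * B) q) x = 0" using x by (simp add: pevp_add pevp_mult)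
        then show False using \<rho>q unfolding AB(4) pevp_const by simp
      qed
      moreover have "poly (pevp A q) x * poly B' x = 0" using arg_cong[OF id, of "\<lambda>p. poly p x"] x by simp
      ultimately have "poly B' x = 0" by simp
      then show "1 / r \<le> norm x" by (rule A'B'(2))
    qed
    then show "(1 - r) ^ n \<le> norm (pev (poly B 1) q)" using r(1) by (simp add: coeff_pevp AB(2) poly_pevp_1)
  qed
  have nzc: "pev (poly B 1) p \<noteq> 0" if "p \<in> closure dom" for p
    by (rule nonvanishing_closure[OF poly_fun_pev nz low _ that]) (use r in auto)
  have "pev (poly A 1) p - pev (poly B 1) p * f p = 0" if "p \<in> closure dom" for p
  proof (rule continuous_constant_on_closure[OF _ _ that])
    show "continuous_on (closure dom) (\<lambda>p. pev (poly A 1) p - pev (poly B 1) p * f p)"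
      by (intro continuous_intros poly_fun_continuous poly_fun_pev cont)
  qed (use af in auto)
  then show thesis
    using \<tau> nzc form by (intro that[of "pev (poly A 1)" "pev (poly B 1)" \<tau> k]) (auto simp: poly_fun_pev)
qed

end

theorem theoremD:
  fixes m t :: nat
  assumes "CARD('n::{finite,linorder}) > 1" and "m > 0" and "t > 0" and "t dvd m"
  shows
    "(\<forall>f :: complex^'n::{finite,linorder} \<Rightarrow> complex. rational_inner m t f \<longrightarrow>
        (\<exists>k \<tau> g. norm \<tau> = 1 \<and> poly_fun g \<and> (\<forall>p\<in>basic_domain m t. g p \<noteq> 0) \<and>
           has_reflection_form t (basic_domain m t) f k \<tau> g)) \<and>
     (\<forall>(f :: complex^'n::{finite,linorder} \<Rightarrow> complex) k \<tau> g.
        rational_on (basic_domain m t) f \<longrightarrow> norm \<tau> = 1 \<longrightarrow>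
        poly_fun g \<longrightarrow> (\<forall>p\<in>basic_domain m t. g p \<noteq> 0) \<longrightarrow>
        has_reflection_form t (basic_domain m t) f k \<tau> g \<longrightarrow> inner_fun m t f) \<and>
     (\<forall>f :: complex^'n::{finite,linorder} \<Rightarrow> complex.
        inner_fun m t f \<longrightarrow> f \<in> disc_algebra (basic_domain m t) \<longrightarrow>
        rational_on (closure (basic_domain m t)) f \<and>
        (\<exists>k \<tau> g. norm \<tau> = 1 \<and> poly_fun g \<and> (\<forall>p\<in>closure (basic_domain m t). g p \<noteq> 0) \<and>
           has_reflection_form t (closure (basic_domain m t)) f k \<tau> g))"
proof (intro conjI allI impI)
  interpret weights m t using assms(2-4) by unfold_locales
  {
    fix f :: "complex^'n::{finite,linorder} \<Rightarrow> complex"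
    assume "rational_inner m t f"
    then obtain P Q where f: "inner_fun m t f" and PQ: "poly_fun P" "poly_fun Q"
        "\<And>p. p \<in> basic_domain m t \<Longrightarrow> Q p \<noteq> 0 \<and> f p = P p / Q p"
      unfolding rational_inner_def rational_on_def by blast
    have "f \<in> H_infinity (basic_domain m t)" using f by (simp add: inner_fun_def)
    then obtain A0 B0 where AB0: "B0 \<noteq> 0" "fps_of_poly A0 = fps_of_poly B0 * tseries f"
      by (rule rational_fraction[OF _ PQ])
    obtain A B U V \<rho> k \<tau> where "fps_of_poly A = fps_of_poly B * tseries f" "coeff B 0 = 1" "\<rho> \<noteq> 0"
      "U * A + V * B = [:\<rho>:]" and AB: "norm \<tau> = 1"
      "\<And>p. p \<in> basic_domain m t \<Longrightarrow> pev (poly B 1) p \<noteq> 0"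
      "\<And>p. p \<in> basic_domain m t \<Longrightarrow> pev (poly A 1) p = pev (poly B 1) p * f p"
      "\<And>p. p $ lst \<noteq> 0 \<Longrightarrow> pev (poly A 1) p = \<tau> * (p $ lst) ^ k * tilde (pev (poly B 1)) p"
      by (rule inner_fraction[OF f AB0]) (rule that; blast)
    then show "\<exists>k \<tau> g. norm \<tau> = 1 \<and> poly_fun g \<and> (\<forall>p\<in>basic_domain m t. g p \<noteq> 0) \<and>
        has_reflection_form t (basic_domain m t) f k \<tau> g"
      by (intro exI[of _ k] exI[of _ \<tau>] exI[of _ "pev (poly B 1)"] conjI poly_fun_pev
          reflection_formI[of _ _ "pev (poly A 1)"]) auto
  next
    fix f :: "complex^'n::{finite,linorder} \<Rightarrow> complex" and k \<tau> g
    assume "rational_on (basic_domain m t) f" and g: "norm \<tau> = 1" "poly_fun g"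
        "\<forall>p\<in>basic_domain m t. g p \<noteq> 0" "has_reflection_form t (basic_domain m t) f k \<tau> g"
    then obtain P Q where PQ: "poly_fun P" "poly_fun Q" "\<And>p. p \<in> basic_domain m t \<Longrightarrow> Q p \<noteq> 0 \<and> f p = P p / Q p"
      unfolding rational_on_def by blast
    show "inner_fun m t f"
    proof (rule rational_unimodular_inner[OF PQ])
      have "g p \<noteq> 0" if "p \<in> basic_domain m t" for p using g(3) that by blast
      then show "norm (P q) = norm (Q q)" if "q \<in> bdry" for q
        using reflection_form_unimodular[OF PQ g(1,2) _ g(4) that] by blast
    qed
  next
    fix f :: "complex^'n::{finite,linorder} \<Rightarrow> complex"
    assume f: "inner_fun m t f" "f \<in> disc_algebra (basic_domain m t)"
    obtain a g k \<tau> where ag: "poly_fun a" "poly_fun g" "norm \<tau> = 1" "\<And>p. p \<in> closure (basic_domain m t) \<Longrightarrow> g p \<noteq> 0"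
      "\<And>p. p \<in> closure (basic_domain m t) \<Longrightarrow> a p = g p * f p"
      "\<And>p. p $ lst \<noteq> 0 \<Longrightarrow> a p = \<tau> * (p $ lst) ^ k * tilde g p"
      using disc_algebra_inner[OF f] by metis
    show "rational_on (closure (basic_domain m t)) f"
      unfolding rational_on_def by (intro exI[of _ a] exI[of _ g] conjI ag ballI) (use ag(4,5) in auto)
    show "\<exists>k \<tau> g. norm \<tau> = 1 \<and> poly_fun g \<and> (\<forall>p\<in>closure (basic_domain m t). g p \<noteq> 0) \<and>
        has_reflection_form t (closure (basic_domain m t)) f k \<tau> g"
      by (intro exI[of _ k] exI[of _ \<tau>] exI[of _ g] conjI ag reflection_formI[of _ _ a]) (use ag in auto)
  }
qed

end
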